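(* Let $V$ be an admissible potential with Fourier coefficients $V_{m_1,m_2}$ and assume the non-degeneracy condition $V_{1,1}\neq\pm V_{0,1}$. Consider $H^\varepsilon=-\Delta+\varepsilon V$ with $\varepsilon$ real. There exists $\varepsilon_1>0$ such that for all $0<|\varepsilon|<\varepsilon_1$ the $4$-dimensional $L^2_{\mathbf M}$-eigenspace of $H^0=-\Delta$ corresponding to the eigenvalue $\mu_S^{(0)}=|\mathbf M|^2=2\pi^2$ perturbs to a $2$-dimensional eigenspace with eigenvalue $\mu_S^\varepsilon$ and, additionally, two $1$-dimensional eigenspaces with eigenvalues $\mu^\varepsilon_{(+1)}$ and $\mu^\varepsilon_{(-1)}$, as follows. 1. $\mu_S^\varepsilon$ is an $L^2_{\mathbf M}$-eigenvalue of $H^\varepsilon$ of geometric multiplicity $2$, with $2$-dimensional eigenspace $\mathbb X_i\oplus\mathbb X_{-i}$, $\mathbb X_{i}\subset L^2_{\mathbf M,i}$, $\mathbb X_{-i}\subset L^2_{\mathbf M,-i}$, and $$\mu_S^\varepsilon=|\mathbf M|^2+\varepsilon(V_{0,0}-V_{1,1})+\mathcal O(\varepsilon^2).$$ Associated with it are eigenstates $\Phi_1^\varepsilon=\Phi_{(+i)}^\varepsilon\in L^2_{\mathbf M,i}$ and $\Phi_2^\varepsilon=\Phi_{(-i)}^\varepsilon\in L^2_{\mathbf M,-i}$ related by $\Phi_2^\varepsilon(\mathbf x)=\overline{\Phi_1^\varepsilon(-\mathbf x)}$, with Fourier expansions $$\Phi_1^\varepsilon(\mathbf x)=\sum_{\mathbf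 m\in\mathcal S}c^\varepsilon_{(+i)}(\mathbf m)\left(e^{i\mathbf M^{\mathbf m}\cdot\mathbf x}-ie^{iR\mathbf M^{\mathbf m}\cdot\mathbf x}-e^{iR^2\mathbf M^{\mathbf m}\cdot\mathbf x}+ie^{iR^3\mathbf M^{\mathbf m}\cdot\mathbf x}\right),$$ $$\Phi_2^\varepsilon(\mathbf x)=\sum_{\mathbf m\in\mathcal S}\overline{c^\varepsilon_{(+i)}(\mathbf m)}\left(e^{i\mathbf M^{\mathbf m}\cdot\mathbf x}+ie^{iR\mathbf M^{\mathbf m}\cdot\mathbf x}-e^{iR^2\mathbf M^{\mathbf m}\cdot\mathbf x}-ie^{iR^3\mathbf M^{\mathbf m}\cdot\mathbf x}\right).$$ 2. The distinct eigenvalues $\mu^\varepsilon_{(+1)}$ and $\mu^\varepsilon_{(-1)}$ are each of geometric multiplicity $1$, with corresponding $1$-dimensional eigenspaces $\mathbb X_{\pm1}\subset L^2_{\mathbf M,\pm1}$, and $$\mu_{(\pm1)}^\varepsilon=|\mathbf M|^2+\varepsilon(V_{0,0}\pm2V_{0,1}+V_{1,1})+\mathcal O(\varepsilon^2),$$ with associated eigenstates $$\Phi_{(\pm1)}^\varepsilon(\mathbf x)=\sum_{\mathbf m\in\mathcal S}c^\varepsilon_{(\pm1)}(\mathbf m)\left(e^{i\mathbf M^{\mathbf m}\cdot\mathbf x}\pm e^{iR\mathbf M^{\mathbf m}\cdot\mathbf x}+e^{iR^2\mathbf M^{\mathbf m}\cdot\mathbf x}\pm e^{iR^3\mathbf M^{\mathbf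 m}\cdot\mathbf x}\right).$$
   Context: $\Lambda=\mathbb Z^2$, $\mathbf k_1=(2\pi,0)^T$, $\mathbf k_2=(0,2\pi)^T$, $\mathbf M=(\pi,\pi)^T$, and $\mathbf M^{\mathbf m}=\mathbf M+m_1\mathbf k_1+m_2\mathbf k_2$ for $\mathbf m=(m_1,m_2)\in\mathbb Z^2$. $L^2_{\mathbf M}=\{f\in L^2_{\rm loc}(\mathbb R^2): e^{-i\mathbf M\cdot\mathbf x}f(\mathbf x)\text{ is }\Lambda\text{-periodic}\}$ with inner product $\langle f,g\rangle=\int_{[0,1]^2}\overline f g$. $R=\begin{pmatrix}0&1\\-1&0\end{pmatrix}$, so $R^*(x_1,x_2)=(-x_2,x_1)$, and $\mathcal R[f](\mathbf x)=f(R^*\mathbf x)$. For $\sigma\in\{1,-1,i,-i\}$, $L^2_{\mathbf M,\sigma}=\{f\in L^2_{\mathbf M}:\mathcal R[f]=\sigma f\}$. A potential $V$ is admissible if it is $C^\infty$ on $\mathbb R^2$, $\Lambda$-periodic, real-valued, even ($V(-\mathbf x)=V(\mathbf x)$), and $\pi/2$-rotationally invariant ($V(R^*\mathbf x)=V(\mathbf x)$). Its Fourier coefficients are defined by $V(\mathbf x)=\sum_{(m_1,m_2)\in\mathbb Z^2}V_{m_1,m_2}e^{2\pi i(m_1x_1+m_2x_2)}$. The map $\mathcal R(m_1,m_2)=(m_2,-1-m_1)$ on $\mathbb Z^2$ (which satisfies $R\mathbf M^{\mathbf m}=\mathbf M^{\mathcal R\mathbf m}$) partitions $\mathbb Z^2$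 into orbits of length four; $\mathcal S$ is a set containing exactly one representative of each orbit. The coefficient families $c^\varepsilon(\cdot)$ belong to $l^2(\mathcal S)$.
   Formalization: That μ_(+1) and μ_(-1) are distinct is claimed only if V_{0,1}≠0 (it fails for V=2cos(2πx₁)cos(2πx₂)); their multiplicity 1 in L²_M is claimed whenever they differ, and if they coincide the eigenspace is the 2-dimensional X_{+1}⊕X_{-1}. *)

theory Defs
  imports "HOL-Analysis.Analysis" "HOL-Library.Landau_Symbols"
begin

definition Lambda :: "(real^2) set" where
  "Lambda = {v. \<forall>i. v $ i \<in> \<int>}"

definition k1 :: "real^2" where "k1 = vector [2 * pi, 0]"
definition k2 :: "real^2" where "k2 = vector [0, 2 * pi]"
definition M_pt :: "real^2" where "M_pt = vector [pi, pi]"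

definition M_shift :: "int \<times> int \<Rightarrow> real^2" where
  "M_shift m = M_pt + of_int (fst m) *\<^sub>R k1 + of_int (snd m) *\<^sub>R k2"

definition R_mat :: "real^2^2" where
  "R_mat = vector [vector [0, 1], vector [-1, 0]]"

definition rot_index :: "int \<times> int \<Rightarrow> int \<times> int" where
  "rot_index m = (snd m, - 1 - fst m)"

lemma R_mat_M_shift: "R_mat *v M_shift m = M_shift (rot_index m)"
  by (simp add: vec_eq_iff forall_2 matrix_vector_mult_def sum_2 R_mat_def M_shift_def
      M_pt_def k1_def k2_def rot_index_def algebra_simps)

definition orbit_representatives :: "(int \<times> int) set \<Rightarrow> bool" where
  "orbit_representatives S \<longleftrightarrow> (\<forall>m. \<exists>!n. n \<in> S \<and> (\<exists>j. n = (rot_index ^^ j) m))"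

definition plane_wave :: "real^2 \<Rightarrow> real^2 \<Rightarrow> complex" where
  "plane_wave k x = exp (\<i> * complex_of_real (k \<bullet> x))"

definition partial_deriv :: "2 \<Rightarrow> (real^2 \<Rightarrow> 'b::real_normed_vector) \<Rightarrow> real^2 \<Rightarrow> 'b" where
  "partial_deriv i f x = frechet_derivative f (at x) (axis i 1)"

fun C_k :: "nat \<Rightarrow> (real^2 \<Rightarrow> 'b::real_normed_vector) \<Rightarrow> bool" where
  "C_k 0 f \<longleftrightarrow> continuous_on UNIV f"
| "C_k (Suc k) f \<longleftrightarrow> (\<forall>x. f differentiable (at x)) \<and> (\<forall>i. C_k k (partial_deriv i f))"

definition smooth :: "(real^2 \<Rightarrow> 'b::real_normed_vector) \<Rightarrow> bool" where
  "smooth f \<longleftrightarrow> (\<forall>k. C_k k f)"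

definition laplacian :: "(real^2 \<Rightarrow> 'b::real_normed_vector) \<Rightarrow> real^2 \<Rightarrow> 'b" where
  "laplacian f x = (\<Sum>i\<in>UNIV. partial_deriv i (partial_deriv i f) x)"

definition admissible :: "(real^2 \<Rightarrow> real) \<Rightarrow> bool" where
  "admissible V \<longleftrightarrow> smooth V \<and> (\<forall>x. \<forall>v\<in>Lambda. V (x + v) = V x) \<and>
     (\<forall>x. V (- x) = V x) \<and> (\<forall>x. V (transpose R_mat *v x) = V x)"

definition unit_cell :: "(real^2) set" where
  "unit_cell = cbox 0 1"

text \<open>The coefficients of \<open>V(x) = \<Sum> V\<^sub>m exp (2\<pi>i m \<bullet> x)\<close>, obtained by integrating the series
  over the unit cell.\<close>

definition fourier_coeff :: "(real^2 \<Rightarrow> real) \<Rightarrow> int \<times> int \<Rightarrow> complex" where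
  "fourier_coeff V m = (LINT x:unit_cell|lborel. complex_of_real (V x) *
     exp (- (2 * pi * \<i> * complex_of_real (of_int (fst m) * x $ 1 + of_int (snd m) * x $ 2))))"

text \<open>Elements of the \<open>L\<^sup>2\<close> spaces are represented by Borel functions. All identities between
  elements are required almost everywhere, and dimensions and direct sums below are
  those of the quotient by almost-everywhere equality.\<close>

definition L2_loc :: "(real^2 \<Rightarrow> complex) set" where
  "L2_loc = {f. f \<in> borel_measurable borel \<and>
     (\<forall>K. compact K \<longrightarrow> set_integrable lborel K (\<lambda>x. (cmod (f x))\<^sup>2))}"

definition L2_M :: "(real^2 \<Rightarrow> complex) set" where
  "L2_M = {f \<in> L2_loc. \<forall>v\<in>Lambda. AE x in lborel.
     plane_wave (- M_pt) (x + v) * f (x + v) = plane_wave (- M_pt) x * f x}"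

definition L2_M_sigma :: "complex \<Rightarrow> (real^2 \<Rightarrow> complex) set" where
  "L2_M_sigma \<sigma> = {f \<in> L2_M. AE x in lborel. f (transpose R_mat *v x) = \<sigma> * f x}"

definition cell_inner :: "(real^2 \<Rightarrow> complex) \<Rightarrow> (real^2 \<Rightarrow> complex) \<Rightarrow> complex" where
  "cell_inner f g = (LINT x:unit_cell|lborel. cnj (f x) * g x)"

text \<open>A basis modulo almost-everywhere equality: uniqueness of the coefficient list
  gives linear independence of the classes as soon as \<open>E\<close> contains \<open>0\<close>.\<close>

definition L2_basis :: "(real^2 \<Rightarrow> complex) list \<Rightarrow> (real^2 \<Rightarrow> complex) set \<Rightarrow> bool" where
  "L2_basis bs E \<longleftrightarrow> set bs \<subseteq> E \<and>
     (\<forall>f\<in>E. \<exists>!as. length as = length bs \<and>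
        (AE x in lborel. f x = (\<Sum>j<length bs. as ! j * (bs ! j) x)))"

definition has_L2_dim :: "(real^2 \<Rightarrow> complex) set \<Rightarrow> nat \<Rightarrow> bool" where
  "has_L2_dim E n \<longleftrightarrow> (\<exists>bs. length bs = n \<and> L2_basis bs E)"

definition L2_direct_sum ::
  "(real^2 \<Rightarrow> complex) set \<Rightarrow> (real^2 \<Rightarrow> complex) set \<Rightarrow> (real^2 \<Rightarrow> complex) set \<Rightarrow> bool" where
  "L2_direct_sum E A B \<longleftrightarrow> E = {\<lambda>x. g x + h x | g h. g \<in> A \<and> h \<in> B} \<and>
     (\<forall>f \<in> A \<inter> B. AE x in lborel. f x = 0)"

definition L2_has_sum ::
  "('i \<Rightarrow> real^2 \<Rightarrow> complex) \<Rightarrow> (real^2 \<Rightarrow> complex) \<Rightarrow> 'i set \<Rightarrow> bool" where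
  "L2_has_sum g f S \<longleftrightarrow>
     ((\<lambda>F. LINT x:unit_cell|lborel. (cmod (f x - (\<Sum>m\<in>F. g m x)))\<^sup>2) \<longlongrightarrow> 0)
       (finite_subsets_at_top S)"

text \<open>\<open>g = \<Delta>f\<close> in the sense of distributions, for \<open>f\<close> and \<open>g\<close> pseudo-periodic;
  the test functions are the smooth pseudo-periodic functions. The domain
  \<open>{f \<in> L\<^sup>2\<^sub>M. \<Delta>f \<in> L\<^sup>2\<^sub>M}\<close> is that of the self-adjoint realisation
  (the pseudo-periodic \<open>H\<^sup>2\<close> functions).\<close>

definition weak_laplacian :: "(real^2 \<Rightarrow> complex) \<Rightarrow> (real^2 \<Rightarrow> complex) \<Rightarrow> bool" where
  "weak_laplacian f g \<longleftrightarrow> f \<in> L2_M \<and> g \<in> L2_M \<and>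
     (\<forall>\<phi>. smooth \<phi> \<and> \<phi> \<in> L2_M \<longrightarrow> cell_inner (laplacian \<phi>) f = cell_inner \<phi> g)"

text \<open>The graph of \<open>H\<^sup>\<epsilon> = -\<Delta> + \<epsilon>V\<close> in \<open>L\<^sup>2\<^sub>M\<close>.\<close>

definition H_graph ::
  "(real^2 \<Rightarrow> real) \<Rightarrow> real \<Rightarrow> (real^2 \<Rightarrow> complex) \<Rightarrow> (real^2 \<Rightarrow> complex) \<Rightarrow> bool" where
  "H_graph V \<epsilon> f h \<longleftrightarrow> (\<exists>g. weak_laplacian f g \<and>
     (AE x in lborel. h x = - g x + complex_of_real (\<epsilon> * V x) * f x))"

definition eigenspace :: "(real^2 \<Rightarrow> real) \<Rightarrow> real \<Rightarrow> real \<Rightarrow> (real^2 \<Rightarrow> complex) set" where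
  "eigenspace V \<epsilon> \<mu> = {f. H_graph V \<epsilon> f (\<lambda>x. complex_of_real \<mu> * f x)}"

definition is_eigenvalue :: "(real^2 \<Rightarrow> real) \<Rightarrow> real \<Rightarrow> real \<Rightarrow> bool" where
  "is_eigenvalue V \<epsilon> \<mu> \<longleftrightarrow> (\<exists>f \<in> eigenspace V \<epsilon> \<mu>. \<not> (AE x in lborel. f x = 0))"

definition X :: "(real^2 \<Rightarrow> real) \<Rightarrow> real \<Rightarrow> real \<Rightarrow> complex \<Rightarrow> (real^2 \<Rightarrow> complex) set" where
  "X V \<epsilon> \<mu> \<sigma> = eigenspace V \<epsilon> \<mu> \<inter> L2_M_sigma \<sigma>"

end

theory Submission
  imports Defs
begin

text \<open>The Fourier coefficients \<open>c\<close> of an eigenfunction satisfy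
  \<open>(\<bar>M\<^sup>m\<bar>\<^sup>2 - \<mu>) c(m) + \<epsilon> (V * c)(m) = 0\<close>, and both terms commute with the rotation of the indices.
  Split \<open>c\<close> into the four rotation sectors. In the sector \<open>\<sigma>\<close> the four resonant coefficients are
  determined by \<open>c(0)\<close>; if it vanishes, then \<open>c = 0\<close> by the spectral gap, and otherwise normalise
  \<open>c(0) = 1\<close>. For small \<open>\<epsilon>\<close> the remaining equations together with the resonant one, which
  expresses \<open>\<mu>\<close> by \<open>c\<close>, are a fixed-point equation for a contraction of a closed subset of
  \<open>l\<^sup>\<infinity>(\<int>\<^sup>2)\<close>. So every sector contributes exactly one eigenvalue near \<open>2\<pi>\<^sup>2\<close>, with first-order term
  \<open>\<epsilon> (V\<^sub>0\<^sub>0 + (\<sigma> + \<sigma>\<^sup>3) V\<^sub>0\<^sub>1 + \<sigma>\<^sup>2 V\<^sub>1\<^sub>1)\<close>, and complex conjugation identifies the sectors \<open>\<plusminus>\<i>\<close>.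
  Since \<open>V\<close> has rapidly decreasing coefficients, so has the fixed point, whose Fourier series is
  therefore a smooth eigenfunction.\<close>

subsection \<open>The period cell\<close>

text \<open>The supremum norm serves uniqueness: the coefficients of an integrable function are
  known in advance only to be bounded, and convolution with the summable sequence \<open>Vh\<close>
  acts on bounded sequences with norm at most \<open>Vsum\<close>. Existence, uniqueness and the
  error estimate then live in one space. Decay is recovered afterwards, since dividing by
  \<open>ksq m - \<mu>\<close> gains one power of the weight \<open>wt\<close>. The eigenvalue is
  itself an unknown of the fixed-point problem, so the denominators move with the iterate. The
  condition \<open>\<bar>\<epsilon>\<bar> * Vsum \<le> 1/4\<close> keeps it within 1/4 of 2 pi^2 and
  makes the iteration contract. Exact multiplicities need the converse as well: an arbitrary
  eigenfunction with eigenvalue within 1 of 2 pi^2 is projected to the sectors, and each projection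
  is shown to be a multiple of the fixed point there. The passage between functions and sequences
  rests on two facts: an integrable Borel function orthogonal to all exponentials vanishes almost
  everywhere, and absolutely convergent series of waves can be integrated term by term.\<close>

definition cell :: "(real^2) measure" where
  "cell = restrict_space lborel unit_cell"

definition tk :: "int \<times> int \<Rightarrow> real^2" where
  "tk m = of_int (fst m) *\<^sub>R k1 + of_int (snd m) *\<^sub>R k2"

abbreviation tw :: "int \<times> int \<Rightarrow> real^2 \<Rightarrow> complex" where
  "tw m \<equiv> plane_wave (tk m)"

abbreviation ew :: "int \<times> int \<Rightarrow> real^2 \<Rightarrow> complex" where
  "ew m \<equiv> plane_wave (M_shift m)"

text \<open>A representation-level form of pseudo-periodicity: identities hold everywhere, not just almost everywhere.\<close>

definition bloch :: "real^2 \<Rightarrow> (real^2 \<Rightarrow> complex) \<Rightarrow> bool" where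
  "bloch \<theta> f \<longleftrightarrow> (\<forall>v\<in>Lambda. \<forall>x. f (x + v) = plane_wave \<theta> v * f x)"

lemma LINT_cell: "(LINT x:unit_cell|lborel. f x) = (\<integral>x. f x \<partial>cell)"
  for f :: "real^2 \<Rightarrow> 'b::{banach,second_countable_topology}"
  by (simp add: cell_def set_lebesgue_integral_def integral_restrict_space unit_cell_def)

lemma set_integrable_cell: "set_integrable lborel unit_cell f \<longleftrightarrow> integrable cell f"
  for f :: "real^2 \<Rightarrow> 'b::{banach,second_countable_topology}"
  by (simp add: cell_def set_integrable_def integrable_restrict_space unit_cell_def)

lemma space_cell [simp]: "space cell = unit_cell"
  by (simp add: cell_def unit_cell_def space_restrict_space)

lemma prod_Basis_2: "(\<Prod>b\<in>Basis. (1::real^2) \<bullet> b) = 1"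
  by (rule prod.neutral) (auto simp: Basis_vec_def inner_axis)

lemma emeasure_cell: "emeasure cell unit_cell = 1"
proof -
  have "emeasure lborel (cbox (0::real^2) 1) = ennreal (\<Prod>b\<in>Basis. ((1::real^2) - 0) \<bullet> b)"
    by (intro emeasure_lborel_cbox) (auto simp: Basis_vec_def inner_axis)
  then show ?thesis
    using prod_Basis_2 by (simp add: cell_def unit_cell_def emeasure_restrict_space)
qed

lemma finite_measure_cell: "finite_measure cell"
  by (rule finite_measureI) (simp add: emeasure_cell)

lemma measure_cell [simp]: "measure cell unit_cell = 1"
  by (simp add: measure_def emeasure_cell)

lemma borel_measurable_cell: "f \<in> borel_measurable borel \<Longrightarrow> f \<in> borel_measurable cell"
  by (simp add: cell_def measurable_restrict_space1)

lemma AE_cell_iff: "(AE x in cell. P x) \<longleftrightarrow> (AE x in lborel. x \<in> unit_cell \<longrightarrow> P x)"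
proof -
  have "unit_cell \<inter> space lborel \<in> sets lborel" by (simp add: unit_cell_def)
  then show ?thesis unfolding cell_def by (rule AE_restrict_space_iff)
qed

lemma AE_cell: "AE x in lborel. P x \<Longrightarrow> AE x in cell. P x"
  by (auto simp: AE_cell_iff)

lemma integral_cell_const [simp]: "(\<integral>x. c \<partial>cell) = c"
  for c :: "'b::{banach,second_countable_topology}"
  by (simp add: lebesgue_integral_const)

lemma integrable_cell_bounded:
  fixes f :: "real^2 \<Rightarrow> 'b::{banach,second_countable_topology}"
  assumes "f \<in> borel_measurable borel" "\<And>x. x \<in> unit_cell \<Longrightarrow> norm (f x) \<le> B"
  shows "integrable cell f"
  using assms finite_measure_cell
  by (intro finite_measure.integrable_const_bound[where B=B]) (auto simp: borel_measurable_cell)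

lemma continuous_borel: "continuous_on UNIV f \<Longrightarrow> f \<in> borel_measurable borel"
  for f :: "real^2 \<Rightarrow> 'b::topological_space"
  by (rule borel_measurable_continuous_onI)

lemma compact_unit_cell: "compact unit_cell"
  by (simp add: unit_cell_def)

lemma continuous_bounded_cell:
  fixes f :: "real^2 \<Rightarrow> 'b::real_normed_vector"
  assumes "continuous_on UNIV f"
  obtains B where "\<And>x. x \<in> unit_cell \<Longrightarrow> norm (f x) \<le> B" "B > 0"
proof -
  have "compact (f ` unit_cell)"
    using assms compact_unit_cell compact_continuous_image continuous_on_subset by blast
  then obtain B where "B > 0" "\<forall>y\<in>f ` unit_cell. norm y \<le> B"
    using bounded_pos compact_imp_bounded by metis
  then show ?thesis using that by blast
qed

lemma integrable_cell_continuous: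
  fixes f :: "real^2 \<Rightarrow> 'b::{banach,second_countable_topology}"
  assumes "continuous_on UNIV f"
  shows "integrable cell f"
  by (metis assms continuous_bounded_cell continuous_borel integrable_cell_bounded)

lemma integrable_cell_mult_bounded:
  fixes f g :: "real^2 \<Rightarrow> complex"
  assumes f: "integrable cell f" and g: "g \<in> borel_measurable borel" "\<And>x. x \<in> unit_cell \<Longrightarrow> cmod (g x) \<le> B"
  shows "integrable cell (\<lambda>x. g x * f x)"
proof (rule Bochner_Integration.integrable_bound)
  show "integrable cell (\<lambda>x. B * norm (f x))" using f by auto
  show "(\<lambda>x. g x * f x) \<in> borel_measurable cell"
    using borel_measurable_integrable[OF f] borel_measurable_cell[OF g(1)] by simp
  show "AE x in cell. norm (g x * f x) \<le> norm (B * norm (f x))"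
    by (rule AE_I2) (auto simp: norm_mult abs_mult intro!: mult_right_mono g(2) intro: order_trans[OF g(2)])
qed

lemma integrable_cell_mult_continuous:
  fixes f g :: "real^2 \<Rightarrow> complex"
  assumes "integrable cell f" "continuous_on UNIV g"
  shows "integrable cell (\<lambda>x. g x * f x)"
  by (metis assms continuous_bounded_cell continuous_borel integrable_cell_mult_bounded)

subsection \<open>Plane waves\<close>

lemma plane_wave_add: "plane_wave (a + b) x = plane_wave a x * plane_wave b x"
  by (simp add: plane_wave_def inner_add_left ring_distribs exp_add)

lemma plane_wave_add_right: "plane_wave a (x + y) = plane_wave a x * plane_wave a y"
  by (simp add: plane_wave_def inner_add_right ring_distribs exp_add)

lemma plane_wave_cnj: "cnj (plane_wave a x) = plane_wave (- a) x"
  by (simp add: plane_wave_def exp_cnj)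

lemma plane_wave_minus_right: "plane_wave a (- x) = plane_wave (- a) x"
  by (simp add: plane_wave_def)

lemma plane_wave_0 [simp]: "plane_wave 0 x = 1" "plane_wave a 0 = 1"
  by (simp_all add: plane_wave_def)

lemma norm_plane_wave [simp]: "cmod (plane_wave a x) = 1"
  by (simp add: plane_wave_def norm_exp_eq_Re)

lemma plane_wave_nz [simp]: "plane_wave a x \<noteq> 0"
  using norm_plane_wave[of a x] by (metis norm_zero zero_neq_one)

lemma plane_wave_minus_cancel [simp]: "plane_wave (- a) x * plane_wave a x = 1" "plane_wave a x * plane_wave (- a) x = 1"
  by (simp_all flip: plane_wave_add)

lemma continuous_plane_wave [continuous_intros]:
  "continuous_on A g \<Longrightarrow> continuous_on A (\<lambda>x. plane_wave a (g x))"
  unfolding plane_wave_def by (intro continuous_intros)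

lemma inner_real2: "a \<bullet> b = a $ 1 * b $ 1 + a $ 2 * b $ 2" for a b :: "real^2"
  by (simp add: inner_vec_def sum_2)

lemma rot_nth: "(transpose R_mat *v x) $ 1 = - x $ 2" "(transpose R_mat *v x) $ 2 = x $ 1"
  "(R_mat *v x) $ 1 = x $ 2" "(R_mat *v x) $ 2 = - x $ 1"
  by (simp_all add: matrix_vector_mult_def sum_2 R_mat_def transpose_def)

lemma plane_wave_rot: "plane_wave a (transpose R_mat *v x) = plane_wave (R_mat *v a) x"
  unfolding plane_wave_def inner_real2 rot_nth by (simp add: algebra_simps)

lemma tk_nth: "tk m $ 1 = 2 * pi * of_int (fst m)" "tk m $ 2 = 2 * pi * of_int (snd m)"
  by (simp_all add: tk_def k1_def k2_def)

lemma M_pt_nth [simp]: "M_pt $ i = pi"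
  using exhaust_2[of i] by (auto simp: M_pt_def)

lemma M_shift_tk: "M_shift m = M_pt + tk m"
  by (simp add: M_shift_def tk_def)

lemma M_shift_nth: "M_shift m $ 1 = pi * of_int (2 * fst m + 1)" "M_shift m $ 2 = pi * of_int (2 * snd m + 1)"
  by (simp_all add: M_shift_tk tk_nth algebra_simps)

lemma tk_add: "tk (m + n) = tk m + tk n" and tk_minus: "tk (- m) = - tk m"
  and tk_diff: "tk (m - n) = tk m - tk n" and tk_0 [simp]: "tk 0 = 0"
  by (simp_all add: tk_def algebra_simps)

lemma M_shift_add: "M_shift (m + n) = M_shift m + tk n"
  by (simp add: M_shift_tk tk_add)

lemma tw_add: "tw (m + n) x = tw m x * tw n x"
  by (simp add: tk_add plane_wave_add)

lemma ew_tw: "ew m x = plane_wave M_pt x * tw m x"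
  by (simp add: M_shift_tk plane_wave_add)

lemma cnj_ew_ew: "cnj (ew m x) * ew n x = tw (n - m) x"
  by (simp add: plane_wave_cnj M_shift_tk tk_diff flip: plane_wave_add)

lemma axis_Lambda: "axis i 1 \<in> Lambda"
  by (simp add: Lambda_def axis_def)

lemma tw_Lambda: "v \<in> Lambda \<Longrightarrow> tw m v = 1"
proof -
  assume "v \<in> Lambda"
  then have "v $ 1 \<in> \<int>" "v $ 2 \<in> \<int>"
    by (auto simp: Lambda_def)
  then obtain a b where "v $ 1 = of_int a" "v $ 2 = of_int b"
    by (auto elim!: Ints_cases)
  then have *: "tk m \<bullet> v = 2 * pi * of_int (fst m * a + snd m * b)"
    by (simp add: inner_real2 tk_nth algebra_simps)
  have "plane_wave (tk m) v = exp (2 * of_int (fst m * a + snd m * b) * complex_of_real pi * \<i>)"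
    unfolding plane_wave_def * by (simp add: mult_ac)
  also have "\<dots> = 1"
    using exp_integer_2pi[of "of_int (fst m * a + snd m * b)"] by (simp add: mult_ac)
  finally show ?thesis .
qed

lemma bloch_tw: "bloch 0 (tw m)"
  by (simp add: bloch_def plane_wave_add_right tw_Lambda)

lemma bloch_plane_wave: "bloch a (plane_wave a)"
  by (simp add: bloch_def plane_wave_add_right mult.commute)

lemma bloch_mult: "bloch a f \<Longrightarrow> bloch b g \<Longrightarrow> bloch (a + b) (\<lambda>x. f x * g x)"
  by (simp add: bloch_def plane_wave_add)

lemma bloch_cnj: "bloch a f \<Longrightarrow> bloch (- a) (\<lambda>x. cnj (f x))"
  by (simp add: bloch_def plane_wave_cnj)

lemma bloch_ew: "bloch M_pt (ew m)"
  using bloch_mult[OF bloch_plane_wave bloch_tw, of M_pt m] by (simp add: ew_tw[abs_def])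

section \<open>Derivatives of plane waves and of pseudo-periodic functions\<close>

lemma plane_wave_has_derivative:
  "(plane_wave k has_derivative (\<lambda>h. \<i> * complex_of_real (k \<bullet> h) * plane_wave k x)) (at x)"
proof -
  have "((\<lambda>x. \<i> * complex_of_real (k \<bullet> x)) has_derivative (\<lambda>h. \<i> * complex_of_real (k \<bullet> h))) (at x)"
    by (intro has_derivative_mult_right has_derivative_of_real has_derivative_inner_right has_derivative_ident)
  moreover have "(exp has_derivative (\<lambda>h. exp (\<i> * complex_of_real (k \<bullet> x)) * h)) (at (\<i> * complex_of_real (k \<bullet> x)))"
    using DERIV_exp[of "\<i> * complex_of_real (k \<bullet> x)"] by (simp add: has_field_derivative_def)
  ultimately show ?thesis
    unfolding plane_wave_def[abs_def] using has_derivative_compose by (fastforce simp: mult_ac)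
qed

lemma partial_deriv_eq:
  assumes "(f has_derivative f') (at x)"
  shows "partial_deriv i f x = f' (axis i 1)"
  unfolding partial_deriv_def using frechet_derivative_at[OF assms] by simp

lemma partial_deriv_cmult_plane_wave:
  "partial_deriv i (\<lambda>x. a * plane_wave k x) = (\<lambda>x. (a * \<i> * complex_of_real (k $ i)) * plane_wave k x)"
proof
  fix x
  show "partial_deriv i (\<lambda>x. a * plane_wave k x) x = (a * \<i> * complex_of_real (k $ i)) * plane_wave k x"
    by (subst partial_deriv_eq[OF has_derivative_mult_right[OF plane_wave_has_derivative]])
       (simp add: inner_axis)
qed

lemma partial_deriv_plane_wave:
  "partial_deriv i (plane_wave k) = (\<lambda>x. (\<i> * complex_of_real (k $ i)) * plane_wave k x)"
  using partial_deriv_cmult_plane_wave[of i 1 k] by simp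

lemma smooth_plane_wave: "smooth (plane_wave k)"
proof -
  \<comment> \<open>The amplitude \<open>a\<close> has to vary in the induction, because each
    partial derivative multiplies it by \<open>\<i>\<close> times a component of
    \<open>k\<close>.\<close>
  have "C_k n (\<lambda>x. a * plane_wave k x)" for n a
  proof (induction n arbitrary: a)
    case 0
    then show ?case by (auto intro!: continuous_intros)
  next
    case (Suc n)
    have "(\<lambda>x. a * plane_wave k x) differentiable (at x)" for x
      unfolding differentiable_def using has_derivative_mult_right[OF plane_wave_has_derivative] by blast
    then show ?case using Suc by (simp add: partial_deriv_cmult_plane_wave)
  qed
  from this[of _ 1] show ?thesis by (simp add: smooth_def)
qed

lemma laplacian_plane_wave: "laplacian (plane_wave k) x = - complex_of_real ((norm k)\<^sup>2) * plane_wave k x"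
  unfolding laplacian_def partial_deriv_plane_wave partial_deriv_cmult_plane_wave
  unfolding power2_norm_eq_inner inner_real2
  by (simp add: sum_2 algebra_simps)

lemma smooth_differentiable: "smooth f \<Longrightarrow> f differentiable (at x)"
  unfolding smooth_def using C_k.simps(2) by blast

lemma smooth_continuous: "smooth f \<Longrightarrow> continuous_on UNIV f"
  unfolding smooth_def using C_k.simps(1) by blast

lemma smooth_partial: "smooth f \<Longrightarrow> smooth (partial_deriv i f)"
  unfolding smooth_def using C_k.simps(2) by blast

lemma smooth_of_real:
  assumes "smooth f"
  shows "smooth (\<lambda>x. complex_of_real (f x))"
proof -
  have "C_k n f \<Longrightarrow> C_k n (\<lambda>x. complex_of_real (f x))" for n and f :: "real^2 \<Rightarrow> real"
  proof (induction n arbitrary: f)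
    case 0
    then show ?case by (auto intro!: continuous_intros)
  next
    case (Suc n)
    have d: "((\<lambda>x. complex_of_real (f x)) has_derivative (\<lambda>h. complex_of_real (frechet_derivative f (at x) h))) (at x)" for x
      using Suc.prems by (auto intro!: has_derivative_of_real simp: frechet_derivative_works[symmetric])
    then have "partial_deriv i (\<lambda>x. complex_of_real (f x)) = (\<lambda>x. complex_of_real (partial_deriv i f x))" for i
      by (simp add: partial_deriv_eq[OF d] fun_eq_iff) (simp add: partial_deriv_def)
    moreover have "(\<lambda>x. complex_of_real (f x)) differentiable (at x)" for x
      using d differentiable_def by blast
    ultimately show ?case using Suc by simp
  qed
  then show ?thesis using assms by (simp add: smooth_def)
qed

text \<open>The identity \<open>f (y + v) = plane_wave a v * f y\<close> is differentiated in
  \<open>y\<close>; the derivative at a point is unique.\<close>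

lemma bloch_partial:
  assumes f: "\<And>x. f differentiable (at x)" and b: "bloch a f"
  shows "bloch a (partial_deriv i f)"
  unfolding bloch_def
proof (intro ballI allI)
  fix v x assume v: "v \<in> Lambda"
  have d: "(f has_derivative frechet_derivative f (at (x + v))) (at (x + v))"
    using f frechet_derivative_works by blast
  have "((\<lambda>y. f (y + v)) has_derivative frechet_derivative f (at (x + v))) (at x)"
    by (rule has_derivative_compose[of "\<lambda>y. y + v" "\<lambda>h. h" x UNIV f, OF _ d])
       (auto intro!: derivative_eq_intros)
  moreover have "((\<lambda>y. plane_wave a v * f y) has_derivative (\<lambda>h. plane_wave a v * frechet_derivative f (at x) h)) (at x)"
    using f frechet_derivative_works has_derivative_mult_right by blast
  moreover have "(\<lambda>y. f (y + v)) = (\<lambda>y. plane_wave a v * f y)"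
    using b v by (auto simp: bloch_def)
  ultimately have "frechet_derivative f (at (x + v)) = (\<lambda>h. plane_wave a v * frechet_derivative f (at x) h)"
    using has_derivative_unique by metis
  then show "partial_deriv i f (x + v) = plane_wave a v * partial_deriv i f x"
    by (simp add: partial_deriv_def)
qed

subsection \<open>Integration by parts on the cell\<close>

lemma lborel_integral_shift:
  fixes f :: "real^2 \<Rightarrow> complex"
  assumes "f \<in> borel_measurable borel"
  shows "(\<integral>x. f (x + c) \<partial>lborel) = (\<integral>x. f x \<partial>lborel)"
proof -
  have "(\<integral>x. f x \<partial>lborel) = (\<integral>x. f x \<partial>(distr lborel borel ((+) c)))"
    by (simp add: lborel_distr_plus)
  also have "\<dots> = (\<integral>x. f (c + x) \<partial>lborel)"
    using assms by (intro integral_distr) auto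
  finally show ?thesis by (simp add: add.commute)
qed

lemma set_integral_shift:
  fixes f :: "real^2 \<Rightarrow> complex"
  assumes "f \<in> borel_measurable borel" "A \<in> sets borel"
  shows "(LINT x:{x. x + c \<in> A}|lborel. f (x + c)) = (LINT x:A|lborel. f x)"
proof -
  have "(\<lambda>x. indicator A x *\<^sub>R f x) \<in> borel_measurable borel"
    using assms by auto
  from lborel_integral_shift[OF this, of c]
  show ?thesis unfolding set_lebesgue_integral_def indicator_def by simp
qed

lemma AE_coord_neq: "AE x in lborel. (x::real^2) $ i \<noteq> c"
proof -
  have "negligible {x::real^2. x $ i = c}"
    using negligible_standard_hyperplane[of "axis i 1 :: real^2" c] by (simp add: inner_axis axis_in_Basis_iff)
  moreover have "closed {x::real^2. x $ i = c}"
    by (intro closed_Collect_eq continuous_intros)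
  ultimately have "{x::real^2. x $ i = c} \<in> null_sets lborel"
    using null_sets_completion_iff[of "{x::real^2. x $ i = c}" lborel]
    by (auto simp: negligible_iff_null_sets)
  then show ?thesis
    by (rule AE_I') auto
qed

lemma mem_unit_cell: "x \<in> unit_cell \<longleftrightarrow> (\<forall>j. 0 \<le> x $ j \<and> x $ j \<le> 1)"
  by (simp add: unit_cell_def mem_box_cart)

lemma set_integrable_continuous_subset:
  fixes f :: "real^2 \<Rightarrow> complex"
  assumes "continuous_on UNIV f" "A \<in> sets borel" "A \<subseteq> cbox a b"
  shows "set_integrable lborel A f"
proof (rule set_integrable_subset)
  show "set_integrable lborel (cbox a b) f"
    unfolding set_integrable_def
    using borel_integrable_compact[of "cbox a b" f] assms(1) continuous_on_subset by auto
qed (use assms in auto)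

text \<open>Cut and paste: the shifted cell \<open>D\<close> is cut at coordinate 1.
  \<open>A\<close> stays in place, and the protruding part \<open>B\<close> is moved back by a unit
  vector, where \<open>p\<close> has the same values. \<open>A\<close> and the translate
  \<open>B'\<close> tile the cell up to two hyperplanes, which are null sets.\<close>

lemma integral_cell_shift:
  fixes p :: "real^2 \<Rightarrow> complex"
  assumes p: "continuous_on UNIV p" and per: "bloch 0 p" and t: "0 \<le> t" "t \<le> 1"
  shows "(\<integral>x. p (x + t *\<^sub>R axis i 1) \<partial>cell) = (\<integral>x. p x \<partial>cell)"
proof -
  define e :: "real^2" where "e = axis i 1"
  have e_nth: "e $ j = (if j = i then 1 else 0)" for j
    by (auto simp: e_def axis_def)
  have pe: "p (x + e) = p x" for x
    using per axis_Lambda[of i] by (simp add: bloch_def e_def)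
  have pb: "p \<in> borel_measurable borel"
    by (rule continuous_borel[OF p])
  define D where "D = {y::real^2. y - t *\<^sub>R e \<in> unit_cell}"
  define A where "A = {y \<in> D. y $ i \<le> 1}"
  define B where "B = {y \<in> D. y $ i > 1}"
  define B' where "B' = {x. x + e \<in> B}"
  have D': "D = {y. \<forall>j. t * e $ j \<le> y $ j \<and> y $ j \<le> 1 + t * e $ j}"
    by (auto simp: D_def mem_unit_cell algebra_simps)
  have "closed D"
    unfolding D' by (intro closed_Collect_all closed_Collect_conj closed_Collect_le continuous_intros)
  then have Dm [measurable]: "D \<in> sets borel" by simp
  have Am: "A \<in> sets borel" and Bm: "B \<in> sets borel"
    unfolding A_def B_def by measurable
  have "(\<lambda>x. x + e) -` B \<inter> space borel \<in> sets borel"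
    by (rule measurable_sets[OF _ Bm]) auto
  then have B'm: "B' \<in> sets borel"
    by (simp add: B'_def vimage_def)
  have Dsub: "D \<subseteq> cbox (-1) 2" "B' \<subseteq> cbox (-1) 2"
  proof -
    have e01: "0 \<le> e $ j" "e $ j \<le> 1" "0 \<le> t * e $ j" "t * e $ j \<le> 1" for j
      using t by (auto simp: e_nth)
    show "D \<subseteq> cbox (-1) 2"
    proof
      fix x assume "x \<in> D"
      then have "t * e $ j \<le> x $ j \<and> x $ j \<le> 1 + t * e $ j" for j by (simp add: D')
      then have "-1 \<le> x $ j \<and> x $ j \<le> 2" for j using e01[of j] by (smt (verit))
      then show "x \<in> cbox (-1) 2" by (simp add: mem_box_cart)
    qed
    show "B' \<subseteq> cbox (-1) 2"
    proof
      fix x assume "x \<in> B'"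
      then have "t * e $ j \<le> x $ j + e $ j \<and> x $ j + e $ j \<le> 1 + t * e $ j" for j by (simp add: D' B'_def B_def)
      then have "-1 \<le> x $ j \<and> x $ j \<le> 2" for j using e01[of j] by (smt (verit))
      then show "x \<in> cbox (-1) 2" by (simp add: mem_box_cart)
    qed
  qed
  have int: "set_integrable lborel A p" "set_integrable lborel B p" "set_integrable lborel B' p"
    using Dsub Am Bm B'm by (auto intro!: set_integrable_continuous_subset[OF p, of _ "-1" 2] simp: A_def B_def)
  have "(\<integral>x. p (x + t *\<^sub>R e) \<partial>cell) = (LINT x:{x. x + t *\<^sub>R e \<in> D}|lborel. p (x + t *\<^sub>R e))"
    by (simp add: D_def LINT_cell)
  also have "\<dots> = (LINT x:D|lborel. p x)"
    by (rule set_integral_shift[OF pb Dm])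
  also have "D = A \<union> B"
    by (auto simp: A_def B_def)
  also have "(LINT x:A \<union> B|lborel. p x) = (LINT x:A|lborel. p x) + (LINT x:B|lborel. p x)"
    by (rule set_integral_Un) (use int in \<open>auto simp: A_def B_def\<close>)
  also have "(LINT x:B|lborel. p x) = (LINT x:B'|lborel. p x)"
    using set_integral_shift[OF pb Bm, of e] by (simp add: pe B'_def)
  also have "(LINT x:A|lborel. p x) + (LINT x:B'|lborel. p x) = (LINT x:A \<union> B'|lborel. p x)"
  proof (rule set_integral_Un_AE[symmetric])
    show "AE x in lborel. \<not> (x \<in> A \<and> x \<in> B')"
      using AE_coord_neq[of i t]
    proof eventually_elim
      case (elim x)
      have "\<not> (x $ i \<ge> t \<and> x $ i \<le> t)" using elim by auto
      moreover have "x \<in> A \<Longrightarrow> x $ i \<ge> t"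
        using e_nth[of i] by (auto simp: A_def D' dest: spec[of _ i])
      moreover have "x \<in> B' \<Longrightarrow> x $ i \<le> t"
        using e_nth[of i] by (auto simp: B'_def B_def D' dest: spec[of _ i])
      ultimately show ?case by blast
    qed
  qed (use Am B'm int in auto)
  also have "\<dots> = (LINT x:unit_cell|lborel. p x)"
  proof (rule set_integral_cong_set)
    have "unit_cell \<in> sets lborel" by (simp add: unit_cell_def)
    moreover have "A \<union> B' \<in> sets lborel" using Am B'm by auto
    ultimately show "set_borel_measurable lborel unit_cell p" "set_borel_measurable lborel (A \<union> B') p"
      using pb by (auto simp: set_borel_measurable_def)
    show "AE x in lborel. x \<in> unit_cell \<longleftrightarrow> x \<in> A \<union> B'"
      using AE_coord_neq[of i 0]
    proof eventually_elim
      case (elim x)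
      have 1: "x \<in> A \<longleftrightarrow> (\<forall>j. j \<noteq> i \<longrightarrow> 0 \<le> x $ j \<and> x $ j \<le> 1) \<and> t \<le> x $ i \<and> x $ i \<le> 1"
        unfolding A_def D' mem_Collect_eq e_nth using t by auto
      have 2: "x \<in> B' \<longleftrightarrow> (\<forall>j. j \<noteq> i \<longrightarrow> 0 \<le> x $ j \<and> x $ j \<le> 1) \<and> 0 < x $ i \<and> x $ i \<le> t"
        unfolding B'_def B_def D' mem_Collect_eq vector_add_component e_nth using t by auto
      have 3: "x \<in> unit_cell \<longleftrightarrow> (\<forall>j. j \<noteq> i \<longrightarrow> 0 \<le> x $ j \<and> x $ j \<le> 1) \<and> 0 \<le> x $ i \<and> x $ i \<le> 1"
        unfolding mem_unit_cell by auto
      show ?case unfolding Un_iff 1 2 3 using elim t by auto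
    qed
  qed
  finally show ?thesis by (simp add: e_def LINT_cell)
qed

lemma has_vector_derivative_difference_quotient:
  fixes g :: "real \<Rightarrow> 'b::real_normed_vector"
  assumes "(g has_vector_derivative d) (at 0)"
  shows "((\<lambda>h. (g h - g 0) /\<^sub>R h) \<longlongrightarrow> d) (at 0)"
proof -
  have "((\<lambda>h. norm (g h - g 0 - h *\<^sub>R d) / norm h) \<longlongrightarrow> 0) (at 0)"
    using assms by (simp add: has_vector_derivative_def has_derivative_at)
  moreover have "eventually (\<lambda>h::real. norm (g h - g 0 - h *\<^sub>R d) / norm h = norm ((g h - g 0) /\<^sub>R h - d)) (at 0)"
    using eventually_neq_at_within[of 0]
  proof eventually_elim
    case (elim h)
    have "(g h - g 0) /\<^sub>R h - d = (g h - g 0 - h *\<^sub>R d) /\<^sub>R h"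
      using elim by (simp add: scaleR_diff_right)
    then show ?case by (simp add: divide_inverse mult.commute)
  qed
  ultimately have "((\<lambda>h. norm ((g h - g 0) /\<^sub>R h - d)) \<longlongrightarrow> 0) (at 0)"
    using tendsto_cong by fastforce
  then show ?thesis
    using Lim_null tendsto_norm_zero_iff by blast
qed

text \<open>The shifted difference quotients of \<open>u\<close> have integral zero over the cell; pass to the limit.\<close>

lemma integral_cell_partial_deriv:
  fixes u :: "real^2 \<Rightarrow> complex"
  assumes d: "\<And>x. u differentiable (at x)" and c: "continuous_on UNIV (partial_deriv i u)"
    and per: "bloch 0 u"
  shows "(\<integral>x. partial_deriv i u x \<partial>cell) = 0"
proof -
  define e :: "real^2" where "e = axis i 1"
  define s where "s n x = (u (x + (1 / real (Suc n)) *\<^sub>R e) - u x) /\<^sub>R (1 / real (Suc n))" for n x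
  have cu: "continuous_on UNIV u"
    using d differentiable_imp_continuous_within continuous_at_imp_continuous_on by blast
  have vd: "((\<lambda>r. u (x + r *\<^sub>R e)) has_vector_derivative partial_deriv i u (x + r *\<^sub>R e)) (at r within T)" for x r T
  proof -
    have "((\<lambda>r. x + r *\<^sub>R e) has_derivative (\<lambda>h. h *\<^sub>R e)) (at r within T)"
      by (auto intro!: derivative_eq_intros)
    from has_derivative_compose[OF this, of u "frechet_derivative u (at (x + r *\<^sub>R e))"]
    have *: "((\<lambda>r. u (x + r *\<^sub>R e)) has_derivative (\<lambda>h. frechet_derivative u (at (x + r *\<^sub>R e)) (h *\<^sub>R e))) (at r within T)"
      using d frechet_derivative_works by blast
    have "linear (frechet_derivative u (at (x + r *\<^sub>R e)))"
      using d linear_frechet_derivative by blast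
    with * show ?thesis
      by (simp add: has_vector_derivative_def partial_deriv_def e_def linear_scale)
  qed
  have s0: "(\<integral>x. s n x \<partial>cell) = 0" for n
  proof -
    have "continuous_on UNIV (\<lambda>x. u (x + (1 / real (Suc n)) *\<^sub>R e))"
      by (intro continuous_on_compose2[OF cu] continuous_intros) auto
    then have "(\<integral>x. u (x + (1 / real (Suc n)) *\<^sub>R e) - u x \<partial>cell) = 0"
      using integral_cell_shift[OF cu per, of "1 / real (Suc n)" i] cu
      by (subst Bochner_Integration.integral_diff) (auto intro!: integrable_cell_continuous simp: e_def)
    then show ?thesis unfolding s_def by (subst integral_scaleR_right) simp
  qed
  \<comment> \<open>For \<open>x\<close> in the cell and a shift of length at most 1, the whole
    segment lies in \<open>cbox 0 2\<close>. The mean value inequality with this bound dominates all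
    difference quotients.\<close>
  have "compact (partial_deriv i u ` cbox 0 2)"
    by (rule compact_continuous_image[OF continuous_on_subset[OF c subset_UNIV] compact_cbox])
  then obtain B where B: "\<forall>y\<in>partial_deriv i u ` cbox 0 2. norm y \<le> B"
    using bounded_pos compact_imp_bounded by metis
  have "(\<lambda>n. \<integral>x. s n x \<partial>cell) \<longlonglongrightarrow> (\<integral>x. partial_deriv i u x \<partial>cell)"
  proof (rule integral_dominated_convergence)
    show "integrable cell (\<lambda>x. B)"
      by (rule integrable_cell_continuous) auto
    show "partial_deriv i u \<in> borel_measurable cell"
      by (intro borel_measurable_cell continuous_borel c)
    show "s n \<in> borel_measurable cell" for n
      unfolding s_def
      by (intro borel_measurable_cell continuous_borel continuous_intros continuous_on_compose2[OF cu]) auto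
    show "AE x in cell. (\<lambda>n. s n x) \<longlonglongrightarrow> partial_deriv i u x"
    proof (rule AE_I2)
      fix x
      have "filterlim (\<lambda>n. 1 / real (Suc n)) (at 0) sequentially"
        using LIMSEQ_inverse_real_of_nat by (auto simp: filterlim_at divide_inverse)
      from filterlim_compose[OF has_vector_derivative_difference_quotient[OF vd[of x 0 UNIV]] this]
      show "(\<lambda>n. s n x) \<longlonglongrightarrow> partial_deriv i u x"
        by (simp add: s_def)
    qed
    show "AE x in cell. norm (s n x) \<le> B" for n
    proof (rule AE_I2)
      fix x assume x: "x \<in> space cell"
      define h where "h = 1 / real (Suc n)"
      have h: "0 < h" "h \<le> 1" by (auto simp: h_def)
      have "norm (u (x + h *\<^sub>R e) - u (x + 0 *\<^sub>R e)) \<le> B * norm (h - 0)"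
      proof (rule differentiable_bound[of "{0..1}" "\<lambda>r. u (x + r *\<^sub>R e)" "\<lambda>r k. k *\<^sub>R partial_deriv i u (x + r *\<^sub>R e)"])
        show "((\<lambda>r. u (x + r *\<^sub>R e)) has_derivative (\<lambda>k. k *\<^sub>R partial_deriv i u (x + r *\<^sub>R e))) (at r within {0..1})" for r
          using vd by (simp add: has_vector_derivative_def)
        show "onorm (\<lambda>k. k *\<^sub>R partial_deriv i u (x + r *\<^sub>R e)) \<le> B" if "r \<in> {0..1}" for r
        proof (rule onorm_le)
          fix k
          have "0 \<le> x $ j + r * e $ j \<and> x $ j + r * e $ j \<le> 2" for j
          proof -
            have "0 \<le> x $ j" "x $ j \<le> 1" using x by (auto simp: mem_unit_cell)
            moreover have "0 \<le> r * e $ j" "r * e $ j \<le> 1" using that by (auto simp: e_def axis_def)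
            ultimately show ?thesis by linarith
          qed
          then have "x + r *\<^sub>R e \<in> cbox 0 2"
            by (simp add: mem_box_cart)
          then have "norm (partial_deriv i u (x + r *\<^sub>R e)) \<le> B"
            using B by blast
          then show "norm (k *\<^sub>R partial_deriv i u (x + r *\<^sub>R e)) \<le> B * norm k"
            by (simp add: mult.commute[of B] mult_left_mono)
        qed
      qed (use h in auto)
      then show "norm (s n x) \<le> B"
        using h unfolding s_def h_def[symmetric] norm_scaleR by (simp add: inverse_eq_divide field_simps)
    qed
  qed
  then show ?thesis using s0 by (simp add: LIMSEQ_const_iff)
qed

text \<open>The phases \<open>a\<close> and \<open>- a\<close> cancel, so the product with the wave
  is periodic and its partial derivative has integral zero; the product rule does the rest.\<close>

lemma integral_cell_by_parts:
  fixes f :: "real^2 \<Rightarrow> complex"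
  assumes d: "\<And>x. f differentiable (at x)" and c: "continuous_on UNIV (partial_deriv i f)"
    and per: "bloch a f" and per': "bloch (- a) (plane_wave k)"
  shows "(\<integral>x. partial_deriv i f x * plane_wave k x \<partial>cell)
       = - (\<i> * complex_of_real (k $ i)) * (\<integral>x. f x * plane_wave k x \<partial>cell)"
proof -
  have cf: "continuous_on UNIV f"
    using d differentiable_imp_continuous_within continuous_at_imp_continuous_on by blast
  have D: "((\<lambda>x. f x * plane_wave k x) has_derivative
     (\<lambda>h. f x * (\<i> * complex_of_real (k \<bullet> h) * plane_wave k x) + frechet_derivative f (at x) h * plane_wave k x)) (at x)" for x
    using d by (intro has_derivative_mult plane_wave_has_derivative) (simp flip: frechet_derivative_works)
  have eq: "partial_deriv i (\<lambda>x. f x * plane_wave k x) =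
      (\<lambda>x. partial_deriv i f x * plane_wave k x + \<i> * complex_of_real (k $ i) * (f x * plane_wave k x))"
    by (simp add: fun_eq_iff partial_deriv_eq[OF D] inner_axis) (simp add: partial_deriv_def)
  have "(\<integral>x. partial_deriv i (\<lambda>x. f x * plane_wave k x) x \<partial>cell) = 0"
  proof (rule integral_cell_partial_deriv)
    show "(\<lambda>x. f x * plane_wave k x) differentiable (at x)" for x
      using D differentiable_def by blast
    show "continuous_on UNIV (partial_deriv i (\<lambda>x. f x * plane_wave k x))"
      unfolding eq by (intro continuous_intros c cf)
    show "bloch 0 (\<lambda>x. f x * plane_wave k x)"
      using bloch_mult[OF per per'] by simp
  qed
  then show ?thesis
    unfolding eq
    by (subst (asm) Bochner_Integration.integral_add)
       (auto intro!: integrable_cell_continuous continuous_intros c cf simp: add_eq_0_iff)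
qed

text \<open>For \<open>m \<noteq> 0\<close> some partial derivative of the wave is a nonzero
  multiple of the wave, and partial derivatives of periodic functions have mean zero.\<close>

lemma integral_tw: "(\<integral>x. tw m x \<partial>cell) = (if m = 0 then 1 else 0)"
proof (cases "m = 0")
  case False
  then obtain i where i: "tk m $ i \<noteq> 0"
    by (cases m) (metis (no_types) fst_conv mult_eq_0_iff of_int_eq_0_iff pi_neq_zero snd_conv tk_nth zero_neq_numeral zero_prod_def)
  have "(\<integral>x. partial_deriv i (tw m) x \<partial>cell) = 0"
    by (rule integral_cell_partial_deriv)
       (auto intro!: smooth_differentiable smooth_continuous smooth_partial smooth_plane_wave bloch_tw)
  then show ?thesis
    using i False by (simp add: partial_deriv_plane_wave)
qed simp

lemma cnj_integral_cell: "cnj (\<integral>x. f x \<partial>cell) = (\<integral>x. cnj (f x) \<partial>cell)"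
  by simp

lemma smooth_ibp:
  assumes "smooth f" "bloch a f" "bloch (- a) (plane_wave k)"
  shows "(\<integral>x. partial_deriv i f x * plane_wave k x \<partial>cell)
       = - (\<i> * complex_of_real (k $ i)) * (\<integral>x. f x * plane_wave k x \<partial>cell)"
  using assms by (intro integral_cell_by_parts smooth_differentiable smooth_continuous smooth_partial)

lemma bloch_minus_ew: "bloch (- M_pt) (plane_wave (- M_shift m))"
  using bloch_cnj[OF bloch_ew] by (simp add: plane_wave_cnj)

lemma bloch_smooth_partial: "smooth f \<Longrightarrow> bloch a f \<Longrightarrow> bloch a (partial_deriv i f)"
  by (intro bloch_partial smooth_differentiable)

text \<open>Two integrations by parts in each coordinate against the conjugate wave, whose vector is
  \<open>- M_shift m\<close>; conjugating the result gives the form in which the weak equation is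
  tested.\<close>

lemma laplacian_ew_integral:
  assumes "smooth \<phi>" "bloch M_pt \<phi>"
  shows "(\<integral>x. cnj (laplacian \<phi> x) * ew m x \<partial>cell)
       = - complex_of_real ((norm (M_shift m))\<^sup>2) * (\<integral>x. cnj (\<phi> x) * ew m x \<partial>cell)"
proof -
  define k where "k = - M_shift m"
  have 2: "(\<integral>x. partial_deriv i (partial_deriv i \<phi>) x * plane_wave k x \<partial>cell)
      = - complex_of_real ((k $ i)\<^sup>2) * (\<integral>x. \<phi> x * plane_wave k x \<partial>cell)" for i
    using smooth_ibp[of "partial_deriv i \<phi>" M_pt k i] smooth_ibp[of \<phi> M_pt k i] assms
    by (simp add: smooth_partial bloch_smooth_partial k_def bloch_minus_ew power2_eq_square)
       (simp add: algebra_simps)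
  have int: "integrable cell (\<lambda>x. partial_deriv i (partial_deriv i \<phi>) x * plane_wave k x)" for i
    using assms by (intro integrable_cell_continuous continuous_intros smooth_continuous smooth_partial)
  have "(\<integral>x. laplacian \<phi> x * plane_wave k x \<partial>cell)
      = - complex_of_real ((norm k)\<^sup>2) * (\<integral>x. \<phi> x * plane_wave k x \<partial>cell)"
    unfolding laplacian_def sum_2 power2_norm_eq_inner inner_real2 distrib_right
    by (subst Bochner_Integration.integral_add[OF int int])
       (simp only: 2, simp add: power2_eq_square ring_distribs)
  from arg_cong[OF this, of cnj] show ?thesis
    unfolding cnj_integral_cell complex_cnj_mult
    by (simp add: k_def plane_wave_cnj cnj_integral_cell[symmetric])
qed

subsection \<open>Completeness of the exponentials\<close>

definition tw_null :: "(real^2 \<Rightarrow> complex) \<Rightarrow> bool" where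
  "tw_null h \<longleftrightarrow> integrable cell h \<and> (\<forall>k. (\<integral>x. tw k x * h x \<partial>cell) = 0)"

lemma continuous_tw: "continuous_on UNIV (tw k)"
  by (intro smooth_continuous smooth_plane_wave)

lemma tw_null_tw: "tw_null h \<Longrightarrow> tw_null (\<lambda>x. tw k x * h x)"
  unfolding tw_null_def
  by (simp add: integrable_cell_mult_continuous continuous_tw del: split_paired_All flip: tw_add mult.assoc)

lemma tw_null_cmult: "tw_null h \<Longrightarrow> tw_null (\<lambda>x. c * h x)"
  by (auto simp: tw_null_def mult.left_commute)

lemma tw_null_add: "tw_null h \<Longrightarrow> tw_null g \<Longrightarrow> tw_null (\<lambda>x. h x + g x)"
  unfolding tw_null_def by (simp add: ring_distribs integrable_cell_mult_continuous continuous_tw)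

text \<open>Turns periodic functions of the cell into functions on a compact subset of a vector
  space, where polynomial approximation is available.\<close>

definition torus_map :: "real^2 \<Rightarrow> complex \<times> complex" where
  "torus_map x = (tw (1,0) x, tw (0,1) x)"

lemma continuous_torus_map [continuous_intros]:
  "continuous_on A g \<Longrightarrow> continuous_on A (\<lambda>x. torus_map (g x))"
  unfolding torus_map_def by (intro continuous_intros)

text \<open>Serves the linear base case of the polynomial induction: composed with
  \<open>torus_map\<close>, each of \<open>z\<close>, \<open>cnj z\<close>, \<open>w\<close>,
  \<open>cnj w\<close> is an exponential.\<close>

lemma bounded_linear_complex_pair:
  fixes f :: "complex \<times> complex \<Rightarrow> real"
  assumes "bounded_linear f"
  obtains a b c d where "\<And>z w. complex_of_real (f (z, w)) = a * z + b * cnj z + c * w + d * cnj w"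
proof
  interpret bounded_linear f by fact
  fix z w :: complex
  have "(z, w) = Re z *\<^sub>R (1, 0) + Im z *\<^sub>R (\<i>, 0) + Re w *\<^sub>R (0, 1) + Im w *\<^sub>R (0, \<i>)"
    by (simp add: complex_eq_iff)
  then have "f (z, w) = Re z * f (1, 0) + Im z * f (\<i>, 0) + Re w * f (0, 1) + Im w * f (0, \<i>)"
    by (simp only: add scaleR real_scaleR_def)
  then show "complex_of_real (f (z, w)) =
      Complex (f (1, 0) / 2) (- f (\<i>, 0) / 2) * z + Complex (f (1, 0) / 2) (f (\<i>, 0) / 2) * cnj z
    + Complex (f (0, 1) / 2) (- f (0, \<i>) / 2) * w + Complex (f (0, 1) / 2) (f (0, \<i>) / 2) * cnj w"
    by (simp add: complex_eq_iff algebra_simps)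
qed

text \<open>The functions orthogonal to all exponentials form a module over the trigonometric polynomials, so
  the Stone--Weierstrass theorem on the torus in \<open>\<complex> \<times> \<complex>\<close> can be applied factor by factor.\<close>

lemma tw_null_polynomial:
  assumes "real_polynomial_function p" "tw_null h"
  shows "tw_null (\<lambda>x. complex_of_real (p (torus_map x)) * h x)"
  using assms
proof (induction p arbitrary: h rule: real_polynomial_function.induct)
  case (linear f)
  then obtain a b c d where f: "\<And>z w. complex_of_real (f (z, w)) = a * z + b * cnj z + c * w + d * cnj w"
    using bounded_linear_complex_pair by blast
  have "(\<lambda>x. complex_of_real (f (torus_map x)) * h x) =
     (\<lambda>x. a * (tw (1,0) x * h x) + b * (tw (- (1,0)) x * h x) + c * (tw (0,1) x * h x) + d * (tw (- (0,1)) x * h x))"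
    unfolding torus_map_def f plane_wave_cnj tk_minus by (simp add: fun_eq_iff algebra_simps)
  then show ?case
    using linear.prems by (auto intro!: tw_null_add tw_null_cmult tw_null_tw)
next
  case (const c)
  then show ?case by (simp add: tw_null_cmult)
next
  case (add f g)
  then show ?case by (simp add: ring_distribs tw_null_add)
next
  case (mult f g)
  have "tw_null (\<lambda>x. complex_of_real (f (torus_map x)) * (complex_of_real (g (torus_map x)) * h x))"
    using mult by blast
  then show ?case by (simp add: mult.assoc)
qed

text \<open>Real polynomials approximate \<open>G\<close> uniformly on the closed bidisc, which
  contains the range of \<open>torus_map\<close>. The polynomial contributes zero, so the integral
  is at most the approximation error times the integral of \<open>cmod (h x)\<close>.\<close>

lemma tw_null_continuous:
  assumes G: "continuous_on UNIV G" and h: "tw_null h"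
  shows "(\<integral>x. complex_of_real (G (torus_map x)) * h x \<partial>cell) = 0"
proof -
  have hi: "integrable cell h" using h by (simp add: tw_null_def)
  have Gi: "integrable cell (\<lambda>x. complex_of_real (G (torus_map x)) * h x)"
    by (intro integrable_cell_mult_continuous hi continuous_intros continuous_on_compose2[OF G]) auto
  have "cmod (\<integral>x. complex_of_real (G (torus_map x)) * h x \<partial>cell) \<le> e * (\<integral>x. cmod (h x) \<partial>cell)" if "e > 0" for e
  proof -
    have "compact (cball (0::complex) 1 \<times> cball (0::complex) 1)"
      by (intro compact_Times compact_cball)
    then obtain p where p: "real_polynomial_function p"
      "\<And>z. z \<in> cball 0 1 \<times> cball 0 1 \<Longrightarrow> \<bar>G z - p z\<bar> < e"
      using Stone_Weierstrass_real_polynomial_function[of _ G e] continuous_on_subset[OF G subset_UNIV] \<open>e > 0\<close> by metis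
    have pn: "tw_null (\<lambda>x. complex_of_real (p (torus_map x)) * h x)"
      by (rule tw_null_polynomial[OF p(1) h])
    then have p0: "(\<integral>x. complex_of_real (p (torus_map x)) * h x \<partial>cell) = 0"
      using tw_null_def by (metis (no_types, lifting) Bochner_Integration.integral_cong mult_1 plane_wave_0(1) tk_0)
    have pi: "integrable cell (\<lambda>x. complex_of_real (p (torus_map x)) * h x)"
      using pn by (simp add: tw_null_def)
    have "cmod (\<integral>x. complex_of_real (G (torus_map x)) * h x \<partial>cell)
        = cmod (\<integral>x. complex_of_real (G (torus_map x)) * h x - complex_of_real (p (torus_map x)) * h x \<partial>cell)"
      using p0 Gi pi by simp
    also have "\<dots> \<le> (\<integral>x. e * cmod (h x) \<partial>cell)"
    proof (rule order_trans[OF integral_norm_bound], rule integral_mono)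
      fix x
      have "torus_map x \<in> cball 0 1 \<times> cball 0 1"
        by (simp add: torus_map_def)
      from less_imp_le[OF p(2)[OF this]]
      show "cmod (complex_of_real (G (torus_map x)) * h x - complex_of_real (p (torus_map x)) * h x) \<le> e * cmod (h x)"
        by (simp add: norm_mult mult_right_mono flip: left_diff_distrib of_real_diff)
    qed (use Gi pi hi in auto)
    finally show ?thesis by simp
  qed note * = this
  have "cmod (\<integral>x. complex_of_real (G (torus_map x)) * h x \<partial>cell) \<le> 0"
  proof (rule field_le_epsilon)
    fix e :: real assume e: "e > 0"
    define I where "I = (\<integral>x. cmod (h x) \<partial>cell)"
    have I: "I \<ge> 0" by (simp add: I_def)
    \<comment> \<open>Dividing by \<open>I + 1\<close> instead of \<open>I\<close> covers the case
      \<open>I = 0\<close>.\<close>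
    have "e / (I + 1) * I \<le> e" using I e by (simp add: field_simps)
    then show "cmod (\<integral>x. complex_of_real (G (torus_map x)) * h x \<partial>cell) \<le> 0 + e"
      using *[of "e / (I + 1)"] e I by (simp flip: I_def)
  qed
  then show ?thesis by simp
qed

lemma exp_2pi_inj:
  fixes x y :: real
  assumes "exp (\<i> * complex_of_real (2 * pi * x)) = exp (\<i> * complex_of_real (2 * pi * y))" "\<bar>x - y\<bar> < 1"
  shows "x = y"
proof -
  obtain n :: int where "\<i> * complex_of_real (2 * pi * x) = \<i> * complex_of_real (2 * pi * y) + (of_int (2 * n) * pi) * \<i>"
    using assms(1) unfolding exp_eq by blast
  then have "2 * pi * x = 2 * pi * y + of_int (2 * n) * pi"
    by (simp add: complex_eq_iff)
  then have "pi * (x - y - of_int n) = 0"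
    by (simp add: algebra_simps)
  then have xy: "x - y = of_int n" by simp
  with assms(2) have "\<bar>n\<bar> < 1" by linarith
  with xy show ?thesis by simp
qed

text \<open>\<open>torus_map\<close> identifies opposite faces of the cell. With \<open>y\<close> in
  the open cell the coordinates of the two points differ by less than 1, hence by no nonzero
  integer.\<close>

lemma torus_map_inj:
  assumes "x \<in> unit_cell" "\<And>j. 0 < y $ j \<and> y $ j < 1" "torus_map x = torus_map y"
  shows "x = y"
proof -
  have "tk (1,0) \<bullet> z = 2 * pi * z $ 1" "tk (0,1) \<bullet> z = 2 * pi * z $ 2" for z
    by (simp_all add: inner_real2 tk_nth)
  then have "exp (\<i> * complex_of_real (2 * pi * x $ 1)) = exp (\<i> * complex_of_real (2 * pi * y $ 1))"
    "exp (\<i> * complex_of_real (2 * pi * x $ 2)) = exp (\<i> * complex_of_real (2 * pi * y $ 2))"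
    using assms(3) by (auto simp: torus_map_def plane_wave_def)
  moreover have "\<bar>x $ j - y $ j\<bar> < 1" for j
    using assms(1) assms(2)[of j] unfolding mem_unit_cell by (smt (verit))
  ultimately show ?thesis
    using exp_2pi_inj by (simp add: vec_eq_iff forall_2)
qed

text \<open>Tent functions of growing slope: continuous and with values in [0,1], so they can be fed
  to \<open>tw_null_continuous\<close> and to dominated convergence.\<close>

lemma indicator_bump:
  fixes L :: "'a::metric_space set"
  assumes "closed L" "L \<noteq> {}"
  shows "(\<lambda>n. max 0 (1 - real n * infdist z L)) \<longlonglongrightarrow> indicator L z"
proof (cases "z \<in> L")
  case True
  then show ?thesis by simp
next
  case False
  then have d: "infdist z L > 0"
    using assms by (metis in_closed_iff_infdist_zero infdist_nonneg less_eq_real_def)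
  obtain N :: nat where N: "real N * infdist z L > 1"
    using reals_Archimedean3[OF d] by blast
  have "max 0 (1 - real n * infdist z L) = 0" if "n \<ge> N" for n
  proof -
    have "real N * infdist z L \<le> real n * infdist z L"
      using that d by (intro mult_right_mono) auto
    with N show ?thesis by simp
  qed
  then have "eventually (\<lambda>n. max 0 (1 - real n * infdist z L) = 0) sequentially"
    unfolding eventually_sequentially by blast
  then show ?thesis using False by (simp add: tendsto_eventually)
qed

text \<open>Away from the faces \<open>torus_map\<close> is injective, so the indicator of
  \<open>K\<close> is the pullback of the indicator of its closed image, a limit of continuous
  functions on the torus.\<close>

lemma tw_null_compact:
  assumes K: "compact K" and Kb: "\<And>x j. x \<in> K \<Longrightarrow> 0 < x $ j \<and> x $ j < 1" and h: "tw_null h"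
  shows "(\<integral>x. indicator K x *\<^sub>R h x \<partial>cell) = 0"
proof (cases "K = {}")
  case False
  define L where "L = torus_map ` K"
  have L: "closed L" "L \<noteq> {}"
    unfolding L_def using False
    by (auto intro!: compact_imp_closed compact_continuous_image[OF _ K] continuous_intros)
  define G where "G n z = max 0 (1 - real n * infdist z L)" for n z
  have G: "continuous_on UNIV (G n)" for n
    unfolding G_def by (intro continuous_intros)
  have hi: "integrable cell h" using h by (simp add: tw_null_def)
  have "(\<lambda>n. \<integral>x. complex_of_real (G n (torus_map x)) * h x \<partial>cell) \<longlonglongrightarrow> (\<integral>x. indicator K x *\<^sub>R h x \<partial>cell)"
  proof (rule integral_dominated_convergence)
    show "integrable cell (\<lambda>x. cmod (h x))" using hi by simp
    have "K \<in> sets borel" using K by (simp add: borel_compact)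
    then have "(\<lambda>x. indicator K x :: real) \<in> borel_measurable cell"
      by (intro borel_measurable_cell) simp
    then show "(\<lambda>x. indicator K x *\<^sub>R h x) \<in> borel_measurable cell"
      using borel_measurable_integrable[OF hi] by (rule borel_measurable_scaleR)
    show "(\<lambda>x. complex_of_real (G n (torus_map x)) * h x) \<in> borel_measurable cell" for n
      by (intro borel_measurable_integrable integrable_cell_mult_continuous hi continuous_intros
          continuous_on_compose2[OF G]) auto
    show "AE x in cell. (\<lambda>n. complex_of_real (G n (torus_map x)) * h x) \<longlonglongrightarrow> indicator K x *\<^sub>R h x"
    proof (rule AE_I2)
      fix x assume "x \<in> space cell"
      then have "torus_map x \<in> L \<longleftrightarrow> x \<in> K"
        unfolding L_def using torus_map_inj Kb by fastforce
      then have "(\<lambda>n. G n (torus_map x)) \<longlonglongrightarrow> indicator K x"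
        using indicator_bump[OF L, of "torus_map x"] by (simp add: G_def indicator_def)
      then show "(\<lambda>n. complex_of_real (G n (torus_map x)) * h x) \<longlonglongrightarrow> indicator K x *\<^sub>R h x"
        unfolding scaleR_conv_of_real by (intro tendsto_intros)
    qed
    show "AE x in cell. norm (complex_of_real (G n (torus_map x)) * h x) \<le> cmod (h x)" for n
    proof (rule AE_I2)
      fix x
      have "\<bar>G n (torus_map x)\<bar> \<le> 1" by (auto simp: G_def infdist_nonneg)
      then show "norm (complex_of_real (G n (torus_map x)) * h x) \<le> cmod (h x)"
        by (simp add: norm_mult mult_left_le_one_le)
    qed
  qed
  then show ?thesis
    by (simp add: tw_null_continuous[OF G h] LIMSEQ_const_iff)
qed simp

lemma integrable_cell_indicator:
  "A \<in> sets borel \<Longrightarrow> integrable cell h \<Longrightarrow> integrable cell (\<lambda>x. indicator A x *\<^sub>R h x)"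
  for h :: "real^2 \<Rightarrow> complex"
  using integrable_cell_mult_bounded[of h "\<lambda>x. complex_of_real (indicator A x)" 1]
  by (simp add: scaleR_conv_of_real indicator_def)

text \<open>\<open>C\<close> is intersected with cells shrunk by \<open>r n\<close>, which are
  compact and avoid the faces. The limit misses only points on the faces, a null set.\<close>

lemma tw_null_closed:
  assumes C: "closed C" and h: "tw_null h"
  shows "(\<integral>x. indicator C x *\<^sub>R h x \<partial>cell) = 0"
proof -
  define r where "r n = 1 / real (Suc (Suc n))" for n
  define K where "K n = C \<inter> {x. \<forall>j. r n \<le> x $ j \<and> x $ j \<le> 1 - r n}" for n
  have hi: "integrable cell h" using h by (simp add: tw_null_def)
  have r0: "r \<longlonglongrightarrow> 0"
    using LIMSEQ_Suc[OF LIMSEQ_inverse_real_of_nat] by (simp add: r_def[abs_def] divide_inverse)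
  have rpos: "r n > 0" for n by (simp add: r_def)
  have K: "compact (K n)" for n
  proof -
    have "{x::real^2. \<forall>j. r n \<le> x $ j \<and> x $ j \<le> 1 - r n} = cbox (\<chi> j. r n) (\<chi> j. 1 - r n)"
      by (auto simp: mem_box_cart)
    then show ?thesis unfolding K_def using C by (metis closed_Int_compact compact_cbox)
  qed
  have K0: "(\<integral>x. indicator (K n) x *\<^sub>R h x \<partial>cell) = 0" for n
  proof (rule tw_null_compact[OF K _ h])
    fix x j assume "x \<in> K n"
    then have "r n \<le> x $ j \<and> x $ j \<le> 1 - r n" by (simp add: K_def)
    then show "0 < x $ j \<and> x $ j < 1" using rpos[of n] by linarith
  qed
  have "(\<lambda>n. \<integral>x. indicator (K n) x *\<^sub>R h x \<partial>cell) \<longlonglongrightarrow> (\<integral>x. indicator C x *\<^sub>R h x \<partial>cell)"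
  proof (rule integral_dominated_convergence)
    show "integrable cell (\<lambda>x. cmod (h x))" using hi by simp
    show "(\<lambda>x. indicator C x *\<^sub>R h x) \<in> borel_measurable cell"
      by (intro borel_measurable_integrable integrable_cell_indicator hi) (simp add: C)
    show "(\<lambda>x. indicator (K n) x *\<^sub>R h x) \<in> borel_measurable cell" for n
      by (intro borel_measurable_integrable integrable_cell_indicator hi borel_compact K)
    have "AE x in lborel. \<forall>j. (x::real^2) $ j \<noteq> 0 \<and> x $ j \<noteq> 1"
      unfolding forall_2 using AE_coord_neq[of 1 0] AE_coord_neq[of 1 1] AE_coord_neq[of 2 0] AE_coord_neq[of 2 1]
      by eventually_elim auto
    then have "AE x in lborel. x \<in> unit_cell \<longrightarrow> (\<lambda>n. indicator (K n) x *\<^sub>R h x) \<longlonglongrightarrow> indicator C x *\<^sub>R h x"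
    proof eventually_elim
      case (elim x)
      show ?case
      proof
        assume "x \<in> unit_cell"
        then have x: "0 < x $ j \<and> x $ j < 1" for j
          using elim unfolding mem_unit_cell by (metis order_le_less)
        have "eventually (\<lambda>n. \<forall>j. r n \<le> x $ j \<and> x $ j \<le> 1 - r n) sequentially"
        proof (rule eventually_all_finite)
          fix j
          have "min (x $ j) (1 - x $ j) > 0" using x[of j] by auto
          from order_tendstoD(2)[OF r0 this] show "\<forall>\<^sub>F n in sequentially. r n \<le> x $ j \<and> x $ j \<le> 1 - r n"
            by eventually_elim auto
        qed
        then have "eventually (\<lambda>n. indicator (K n) x *\<^sub>R h x = indicator C x *\<^sub>R h x) sequentially"
          by eventually_elim (auto simp: K_def indicator_def)
        then show "(\<lambda>n. indicator (K n) x *\<^sub>R h x) \<longlonglongrightarrow> indicator C x *\<^sub>R h x"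
          by (rule tendsto_eventually)
      qed
    qed
    then show "AE x in cell. (\<lambda>n. indicator (K n) x *\<^sub>R h x) \<longlonglongrightarrow> indicator C x *\<^sub>R h x"
      by (simp add: AE_cell_iff)
    show "AE x in cell. norm (indicator (K n) x *\<^sub>R h x) \<le> cmod (h x)" for n
      by (rule AE_I2) (auto simp: indicator_def)
  qed
  then show ?thesis
    by (simp add: K0 LIMSEQ_const_iff)
qed

text \<open>Dynkin argument: closed sets are stable under intersection and generate the Borel sets,
  and vanishing integrals survive complements and countable disjoint unions.\<close>

lemma tw_null_borel:
  assumes A: "A \<in> sets borel" and h: "tw_null h"
  shows "(\<integral>x. indicator A x *\<^sub>R h x \<partial>cell) = 0"
proof -
  have hi: "integrable cell h" using h by (simp add: tw_null_def)
  have b: "sets (borel :: (real^2) measure) = sigma_sets UNIV (Collect closed)"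
    unfolding borel_eq_closed by (rule sets_measure_of) simp
  have "Int_stable (Collect closed :: (real^2) set set)"
    by (auto simp: Int_stable_def)
  moreover have "Collect closed \<subseteq> Pow (UNIV :: (real^2) set)" by simp
  moreover have "A \<in> sigma_sets UNIV (Collect closed)" using A b by simp
  ultimately show ?thesis
  proof (induction rule: sigma_sets_induct_disjoint)
    case (basic A)
    then show ?case by (simp add: tw_null_closed h)
  next
    case (compl A)
    have "A \<in> sets borel" using compl b by simp
    then have "(\<integral>x. indicator A x *\<^sub>R h x + indicator (UNIV - A) x *\<^sub>R h x \<partial>cell)
      = (\<integral>x. indicator A x *\<^sub>R h x \<partial>cell) + (\<integral>x. indicator (UNIV - A) x *\<^sub>R h x \<partial>cell)"
      by (intro Bochner_Integration.integral_add integrable_cell_indicator hi) auto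
    moreover have "(\<lambda>x. indicator A x *\<^sub>R h x + indicator (UNIV - A) x *\<^sub>R h x) = (\<lambda>x. indicator UNIV x *\<^sub>R h x)"
      by (auto simp: indicator_def)
    ultimately show ?case
      using compl tw_null_closed[OF closed_UNIV h] by simp
  next
    case (union A)
    have Ai: "A i \<in> sets borel" for i using union b by auto
    have "(\<lambda>n. \<integral>x. indicator (\<Union>i<n. A i) x *\<^sub>R h x \<partial>cell) \<longlonglongrightarrow> (\<integral>x. indicator (\<Union>i. A i) x *\<^sub>R h x \<partial>cell)"
    proof (rule integral_dominated_convergence)
      show "integrable cell (\<lambda>x. cmod (h x))" using hi by simp
      show "(\<lambda>x. indicator (\<Union>i. A i) x *\<^sub>R h x) \<in> borel_measurable cell"
        by (intro borel_measurable_integrable integrable_cell_indicator hi sets.countable_UN) (use Ai in auto)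
      show "(\<lambda>x. indicator (\<Union>i<n. A i) x *\<^sub>R h x) \<in> borel_measurable cell" for n
        by (intro borel_measurable_integrable integrable_cell_indicator hi sets.finite_UN) (use Ai in auto)
      show "AE x in cell. (\<lambda>n. indicator (\<Union>i<n. A i) x *\<^sub>R h x) \<longlonglongrightarrow> indicator (\<Union>i. A i) x *\<^sub>R h x"
        by (intro AE_I2 tendsto_scaleR tendsto_const LIMSEQ_indicator_UN)
      show "AE x in cell. norm (indicator (\<Union>i<n. A i) x *\<^sub>R h x) \<le> cmod (h x)" for n
        by (rule AE_I2) (auto simp: indicator_def)
    qed
    moreover have "(\<integral>x. indicator (\<Union>i<n. A i) x *\<^sub>R h x \<partial>cell) = 0" for n
    proof (induction n)
      case (Suc n)
      have "A n \<inter> (\<Union>i<n. A i) = {}"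
      proof -
        have "A n \<inter> A i = {}" if "i < n" for i
          using that by (intro disjoint_family_onD[OF union(1)]) auto
        then show ?thesis by auto
      qed
      then have "(\<lambda>x. indicator (\<Union>i<Suc n. A i) x *\<^sub>R h x) =
         (\<lambda>x. indicator (A n) x *\<^sub>R h x + indicator (\<Union>i<n. A i) x *\<^sub>R h x)"
        by (auto simp: fun_eq_iff lessThan_Suc indicator_def)
      then show ?case
        using Suc union(3)[of n] Ai
        by (simp add: Bochner_Integration.integral_add integrable_cell_indicator hi sets.finite_UN)
    qed simp
    ultimately show ?case
      by (simp add: LIMSEQ_const_iff)
  qed auto
qed

text \<open>Testing with the set where \<open>g\<close> is positive makes the integral of the
  positive part vanish. The one-sided conclusion is later applied to several multiples of one
  function.\<close>

lemma AE_zero_if_integrals_zero: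
  fixes g :: "real^2 \<Rightarrow> real"
  assumes g: "g \<in> borel_measurable borel" "integrable cell g"
    and 0: "\<And>A. A \<in> sets borel \<Longrightarrow> (\<integral>x. indicator A x * g x \<partial>cell) = 0"
  shows "AE x in cell. g x \<le> 0"
proof -
  define A where "A = {x. g x > 0}"
  have A: "A \<in> sets borel" unfolding A_def using g(1) by measurable
  have eq: "(\<lambda>x. indicator A x * g x) = (\<lambda>x. max 0 (g x))"
    by (auto simp: A_def indicator_def)
  have "AE x in cell. max 0 (g x) = 0"
    using 0[OF A] g(2) unfolding eq by (subst (asm) integral_nonneg_eq_0_iff_AE) auto
  then show ?thesis by eventually_elim linarith
qed

theorem tw_null_AE:
  assumes h: "tw_null h" and hb: "h \<in> borel_measurable borel"
  shows "AE x in cell. h x = 0"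
proof -
  have hi: "integrable cell h" using h by (simp add: tw_null_def)
  \<comment> \<open>The choices \<open>c = 1, -1, \<i>, -\<i>\<close> bound the real and imaginary
    part of \<open>h\<close> from both sides.\<close>
  have *: "AE x in cell. Re (c * h x) \<le> 0" for c
  proof (rule AE_zero_if_integrals_zero)
    show "(\<lambda>x. Re (c * h x)) \<in> borel_measurable borel" using hb by measurable
    show "integrable cell (\<lambda>x. Re (c * h x))" using hi by simp
    fix A :: "(real^2) set" assume A: "A \<in> sets borel"
    have "(\<integral>x. indicator A x * Re (c * h x) \<partial>cell) = (\<integral>x. Re (indicator A x *\<^sub>R (c * h x)) \<partial>cell)"
      by simp
    also have "\<dots> = Re (\<integral>x. indicator A x *\<^sub>R (c * h x) \<partial>cell)"
      using A hi by (intro integral_Re integrable_cell_indicator) auto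
    also have "\<dots> = 0"
      using tw_null_borel[OF A tw_null_cmult[OF h]] by simp
    finally show "(\<integral>x. indicator A x * Re (c * h x) \<partial>cell) = 0" .
  qed
  show ?thesis
    using *[of 1] *[of "-1"] *[of \<i>] *[of "-\<i>"]
    by eventually_elim (auto simp: complex_eq_iff)
qed

subsection \<open>Absolutely convergent series of plane waves\<close>

context
  fixes d :: "'i \<Rightarrow> complex" and k :: "'i \<Rightarrow> real^2"
  assumes d: "(\<lambda>i. cmod (d i)) summable_on UNIV"
begin

lemma wave_summable: "(\<lambda>i. d i * plane_wave (k i) x) summable_on UNIV"
  by (rule abs_summable_summable) (use d in \<open>simp add: norm_mult\<close>)

text \<open>The bound is uniform in \<open>x\<close>, which yields continuity and termwise
  integration. Wave vectors stay arbitrary because both the periodic series of \<open>V\<close> and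
  the pseudo-periodic series of eigenfunctions are instances.\<close>

lemma wave_tail_bound:
  assumes "finite A"
  shows "cmod ((\<Sum>\<^sub>\<infinity>i. d i * plane_wave (k i) x) - (\<Sum>i\<in>A. d i * plane_wave (k i) x))
    \<le> (\<Sum>\<^sub>\<infinity>i. cmod (d i)) - (\<Sum>i\<in>A. cmod (d i))"
proof -
  have s: "(\<lambda>i. d i * plane_wave (k i) x) summable_on A" "(\<lambda>i. cmod (d i)) summable_on A"
    using assms by (auto intro: summable_on_finite)
  have "(\<Sum>\<^sub>\<infinity>i. d i * plane_wave (k i) x) - (\<Sum>i\<in>A. d i * plane_wave (k i) x)
      = (\<Sum>\<^sub>\<infinity>i\<in>UNIV - A. d i * plane_wave (k i) x)"
    using assms by (subst infsum_Diff[OF wave_summable s(1)]) auto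
  also have "cmod \<dots> \<le> (\<Sum>\<^sub>\<infinity>i\<in>UNIV - A. cmod (d i * plane_wave (k i) x))"
    using d by (intro norm_infsum_bound) (auto simp: norm_mult intro: summable_on_subset_banach)
  also have "\<dots> = (\<Sum>\<^sub>\<infinity>i\<in>UNIV - A. cmod (d i))"
    by (simp add: norm_mult)
  also have "\<dots> = (\<Sum>\<^sub>\<infinity>i. cmod (d i)) - (\<Sum>i\<in>A. cmod (d i))"
    using assms by (subst infsum_Diff[OF d s(2)]) auto
  finally show ?thesis .
qed

lemma tail_tendsto: "((\<lambda>A. (\<Sum>\<^sub>\<infinity>i. cmod (d i)) - (\<Sum>i\<in>A. cmod (d i))) \<longlongrightarrow> 0) (finite_subsets_at_top UNIV)"
proof -
  have "((\<lambda>A. (\<Sum>i\<in>A. cmod (d i))) \<longlongrightarrow> (\<Sum>\<^sub>\<infinity>i. cmod (d i))) (finite_subsets_at_top UNIV)"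
    using has_sum_infsum[OF d] by (simp add: has_sum_def)
  from tendsto_diff[OF tendsto_const[of "\<Sum>\<^sub>\<infinity>i. cmod (d i)"] this] show ?thesis by simp
qed

lemma wave_continuous: "continuous_on UNIV (\<lambda>x. \<Sum>\<^sub>\<infinity>i. d i * plane_wave (k i) x)"
proof (rule uniform_limit_theorem)
  show "\<forall>\<^sub>F A in finite_subsets_at_top UNIV. continuous_on UNIV (\<lambda>x. \<Sum>i\<in>A. d i * plane_wave (k i) x)"
    by (intro always_eventually allI continuous_intros)
  show "uniform_limit UNIV (\<lambda>A x. \<Sum>i\<in>A. d i * plane_wave (k i) x) (\<lambda>x. \<Sum>\<^sub>\<infinity>i. d i * plane_wave (k i) x)
    (finite_subsets_at_top UNIV)"
    unfolding uniform_limit_iff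
  proof (intro allI impI)
    fix e :: real assume "e > 0"
    from order_tendstoD(2)[OF tail_tendsto this] eventually_finite_subsets_at_top_weakI[of UNIV finite]
    have "\<forall>\<^sub>F A in finite_subsets_at_top UNIV. (\<Sum>\<^sub>\<infinity>i. cmod (d i)) - (\<Sum>i\<in>A. cmod (d i)) < e \<and> finite A"
      by (auto simp: eventually_conj_iff)
    then show "\<forall>\<^sub>F A in finite_subsets_at_top UNIV. \<forall>x\<in>UNIV.
        dist (\<Sum>i\<in>A. d i * plane_wave (k i) x) (\<Sum>\<^sub>\<infinity>i. d i * plane_wave (k i) x) < e"
    proof eventually_elim
      case (elim A)
      then show ?case
        using wave_tail_bound[of A] by (auto simp: dist_norm norm_minus_commute intro: le_less_trans)
    qed
  qed
qed simp

lemma wave_integral: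
  assumes w: "integrable cell w"
  shows "((\<lambda>i. d i * (\<integral>x. w x * plane_wave (k i) x \<partial>cell)) has_sum
     (\<integral>x. w x * (\<Sum>\<^sub>\<infinity>i. d i * plane_wave (k i) x) \<partial>cell)) UNIV"
  unfolding has_sum_def
proof (rule Lim_transform2[OF tendsto_const])
  define F where "F x = (\<Sum>\<^sub>\<infinity>i. d i * plane_wave (k i) x)" for x
  have Fc: "continuous_on UNIV F" unfolding F_def by (rule wave_continuous)
  have int: "integrable cell (\<lambda>x. w x * g x)" if "continuous_on UNIV g" for g
    using integrable_cell_mult_continuous[OF w that] by (simp add: mult.commute)
  have "\<forall>\<^sub>F A in finite_subsets_at_top UNIV.
      norm ((\<integral>x. w x * F x \<partial>cell) - (\<Sum>i\<in>A. d i * (\<integral>x. w x * plane_wave (k i) x \<partial>cell)))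
      \<le> ((\<Sum>\<^sub>\<infinity>i. cmod (d i)) - (\<Sum>i\<in>A. cmod (d i))) * (\<integral>x. cmod (w x) \<partial>cell)"
  proof (rule eventually_finite_subsets_at_top_weakI)
    fix A :: "'i set" assume A: "finite A"
    let ?t = "(\<Sum>\<^sub>\<infinity>i. cmod (d i)) - (\<Sum>i\<in>A. cmod (d i))"
    let ?s = "\<lambda>x. \<Sum>i\<in>A. d i * plane_wave (k i) x"
    have sc: "continuous_on UNIV ?s" by (intro continuous_intros)
    have "(\<Sum>i\<in>A. d i * (\<integral>x. w x * plane_wave (k i) x \<partial>cell)) = (\<integral>x. (\<Sum>i\<in>A. d i * (w x * plane_wave (k i) x)) \<partial>cell)"
      by (subst Bochner_Integration.integral_sum) (auto intro!: int continuous_intros)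
    also have "\<dots> = (\<integral>x. w x * ?s x \<partial>cell)"
      by (simp add: sum_distrib_left mult_ac)
    finally have "(\<integral>x. w x * F x \<partial>cell) - (\<Sum>i\<in>A. d i * (\<integral>x. w x * plane_wave (k i) x \<partial>cell))
      = (\<integral>x. w x * (F x - ?s x) \<partial>cell)"
      using int[OF Fc] int[OF sc] by (simp add: right_diff_distrib)
    also have "norm \<dots> \<le> (\<integral>x. ?t * cmod (w x) \<partial>cell)"
    proof (rule order_trans[OF integral_norm_bound], rule integral_mono)
      show "integrable cell (\<lambda>x. cmod (w x * (F x - ?s x)))"
        by (intro integrable_norm int continuous_intros Fc sc)
      show "cmod (w x * (F x - ?s x)) \<le> ?t * cmod (w x)" for x
        using wave_tail_bound[OF A, of x] unfolding norm_mult mult.commute[of ?t] F_def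
        by (intro mult_left_mono) auto
    qed (use w in auto)
    finally show "norm ((\<integral>x. w x * F x \<partial>cell) - (\<Sum>i\<in>A. d i * (\<integral>x. w x * plane_wave (k i) x \<partial>cell)))
      \<le> ?t * (\<integral>x. cmod (w x) \<partial>cell)" by simp
  qed
  moreover have "((\<lambda>A. ((\<Sum>\<^sub>\<infinity>i. cmod (d i)) - (\<Sum>i\<in>A. cmod (d i))) * (\<integral>x. cmod (w x) \<partial>cell)) \<longlongrightarrow> 0) (finite_subsets_at_top UNIV)"
    using tendsto_mult_right[OF tail_tendsto] by fastforce
  ultimately show "((\<lambda>A. (\<integral>x. w x * (\<Sum>\<^sub>\<infinity>i. d i * plane_wave (k i) x) \<partial>cell) - (\<Sum>i\<in>A. d i * (\<integral>x. w x * plane_wave (k i) x \<partial>cell))) \<longlongrightarrow> 0) (finite_subsets_at_top UNIV)"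
    unfolding F_def by (rule Lim_null_comparison)
qed

end

subsection \<open>Pseudo-periodic functions\<close>

lemma mem_L2_M:
  "f \<in> L2_M \<longleftrightarrow> f \<in> L2_loc \<and> (\<forall>v\<in>Lambda. AE x in lborel. f (x + v) = plane_wave M_pt v * f x)"
proof -
  have "plane_wave (- M_pt) (x + v) * f (x + v) = plane_wave (- M_pt) x * f x
      \<longleftrightarrow> f (x + v) = plane_wave M_pt v * f x" for x v
  proof -
    have "plane_wave (- M_pt) (x + v) * f (x + v) = plane_wave (- M_pt) x * f x
      \<longleftrightarrow> plane_wave M_pt v * plane_wave M_pt x * (plane_wave (- M_pt) x * plane_wave (- M_pt) v * f (x + v))
         = plane_wave M_pt v * plane_wave M_pt x * (plane_wave (- M_pt) x * f x)"
      by (simp add: plane_wave_add_right)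
    also have "plane_wave M_pt v * plane_wave M_pt x * (plane_wave (- M_pt) x * plane_wave (- M_pt) v * f (x + v))
       = (plane_wave M_pt v * plane_wave (- M_pt) v) * (plane_wave M_pt x * plane_wave (- M_pt) x) * f (x + v)"
      by (simp only: mult_ac)
    also have "plane_wave M_pt v * plane_wave M_pt x * (plane_wave (- M_pt) x * f x)
       = (plane_wave M_pt x * plane_wave (- M_pt) x) * (plane_wave M_pt v * f x)"
      by (simp only: mult_ac)
    finally show ?thesis by simp
  qed
  then show ?thesis unfolding L2_M_def by simp
qed

lemma L2_loc_borel: "f \<in> L2_loc \<Longrightarrow> f \<in> borel_measurable borel"
  by (simp add: L2_loc_def)

lemma L2_M_borel: "f \<in> L2_M \<Longrightarrow> f \<in> borel_measurable borel"
  by (simp add: L2_M_def L2_loc_borel)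

lemma set_integrable_bound_borel:
  fixes f g :: "real^2 \<Rightarrow> real"
  assumes "set_integrable lborel K g" "f \<in> borel_measurable borel" "K \<in> sets borel"
    "\<And>x. x \<in> K \<Longrightarrow> \<bar>f x\<bar> \<le> g x"
  shows "set_integrable lborel K f"
proof (rule set_integrable_bound[OF assms(1)])
  show "set_borel_measurable lborel K f"
    using assms(2,3) by (simp add: set_borel_measurable_def)
  show "AE x in lborel. x \<in> K \<longrightarrow> norm (f x) \<le> norm (g x)"
    using assms(4) by (auto intro!: AE_I2) (smt (verit))
qed

lemma L2_loc_add: 
  assumes "f \<in> L2_loc" "g \<in> L2_loc"
  shows "(\<lambda>x. f x + g x) \<in> L2_loc"
proof -
  have m: "f \<in> borel_measurable borel" "g \<in> borel_measurable borel"
    using assms by (auto simp: L2_loc_def)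
  have "set_integrable lborel K (\<lambda>x. (cmod (f x + g x))\<^sup>2)" if K: "compact K" for K
  proof (rule set_integrable_bound_borel)
    show "set_integrable lborel K (\<lambda>x. 2 * (cmod (f x))\<^sup>2 + 2 * (cmod (g x))\<^sup>2)"
      using assms K by (auto intro!: set_integral_add simp: L2_loc_def)
    show "\<bar>(cmod (f x + g x))\<^sup>2\<bar> \<le> 2 * (cmod (f x))\<^sup>2 + 2 * (cmod (g x))\<^sup>2" for x
    proof -
      have "(cmod (f x + g x))\<^sup>2 \<le> (cmod (f x) + cmod (g x))\<^sup>2"
        by (intro power_mono norm_triangle_ineq) auto
      also have "\<dots> \<le> 2 * (cmod (f x))\<^sup>2 + 2 * (cmod (g x))\<^sup>2"
        using sum_squares_ge_zero[of "cmod (f x) - cmod (g x)" 0] by (simp add: power2_eq_square algebra_simps)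
      finally show ?thesis by simp
    qed
  qed (use m K borel_compact in auto)
  then show ?thesis using m by (simp add: L2_loc_def)
qed

lemma L2_loc_mult:
  assumes "f \<in> L2_loc" "continuous_on UNIV w"
  shows "(\<lambda>x. w x * f x) \<in> L2_loc"
proof -
  have m: "f \<in> borel_measurable borel" "w \<in> borel_measurable borel"
    using assms by (auto simp: L2_loc_def intro: continuous_borel)
  have "set_integrable lborel K (\<lambda>x. (cmod (w x * f x))\<^sup>2)" if K: "compact K" for K
  proof -
    have "compact (w ` K)"
      by (rule compact_continuous_image[OF continuous_on_subset[OF assms(2) subset_UNIV] K])
    then obtain B where B: "\<forall>y\<in>w ` K. norm y \<le> B"
      using bounded_pos compact_imp_bounded by metis
    show ?thesis
    proof (rule set_integrable_bound_borel)
      show "set_integrable lborel K (\<lambda>x. B\<^sup>2 * (cmod (f x))\<^sup>2)"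
        using assms K by (auto simp: L2_loc_def)
      show "\<bar>(cmod (w x * f x))\<^sup>2\<bar> \<le> B\<^sup>2 * (cmod (f x))\<^sup>2" if "x \<in> K" for x
        using B that by (auto simp: norm_mult power_mult_distrib intro!: mult_right_mono power_mono)
    qed (use m K borel_compact in auto)
  qed
  then show ?thesis using m by (simp add: L2_loc_def)
qed

lemma L2_loc_continuous:
  assumes "continuous_on UNIV w"
  shows "w \<in> L2_loc"
proof -
  have "(\<lambda>x. 1) \<in> L2_loc"
    using borel_integrable_compact[of _ "\<lambda>x. 1::real"] by (auto simp: L2_loc_def set_integrable_def)
  from L2_loc_mult[OF this assms] show ?thesis by simp
qed

lemma L2_M_add: "f \<in> L2_M \<Longrightarrow> g \<in> L2_M \<Longrightarrow> (\<lambda>x. f x + g x) \<in> L2_M"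
  unfolding mem_L2_M
proof (elim conjE, intro conjI ballI L2_loc_add)
  fix v assume "\<forall>v\<in>Lambda. AE x in lborel. f (x + v) = plane_wave M_pt v * f x"
    "\<forall>v\<in>Lambda. AE x in lborel. g (x + v) = plane_wave M_pt v * g x" "v \<in> Lambda"
  then have "AE x in lborel. f (x + v) = plane_wave M_pt v * f x" "AE x in lborel. g (x + v) = plane_wave M_pt v * g x"
    by blast+
  then show "AE x in lborel. f (x + v) + g (x + v) = plane_wave M_pt v * (f x + g x)"
    by eventually_elim (simp add: ring_distribs)
qed

lemma L2_M_mult: 
  assumes "f \<in> L2_M" "continuous_on UNIV w" "bloch 0 w"
  shows "(\<lambda>x. w x * f x) \<in> L2_M"
  unfolding mem_L2_M
proof (intro conjI ballI)
  show "(\<lambda>x. w x * f x) \<in> L2_loc"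
    using assms by (simp add: L2_loc_mult mem_L2_M)
  fix v assume "v \<in> Lambda"
  then have "AE x in lborel. f (x + v) = plane_wave M_pt v * f x" "\<And>x. w (x + v) = w x"
    using assms by (auto simp: mem_L2_M bloch_def)
  then show "AE x in lborel. w (x + v) * f (x + v) = plane_wave M_pt v * (w x * f x)"
    by auto
qed

lemma L2_M_cmult: "f \<in> L2_M \<Longrightarrow> (\<lambda>x. c * f x) \<in> L2_M"
  by (rule L2_M_mult) (auto simp: bloch_def)

lemma L2_M_diff: "f \<in> L2_M \<Longrightarrow> g \<in> L2_M \<Longrightarrow> (\<lambda>x. f x - g x) \<in> L2_M"
  using L2_M_add[OF _ L2_M_cmult[of g "-1"], of f] by simp

lemma L2_M_continuous: "continuous_on UNIV w \<Longrightarrow> bloch M_pt w \<Longrightarrow> w \<in> L2_M"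
  by (simp add: mem_L2_M L2_loc_continuous bloch_def)

lemma L2_M_integrable:
  assumes "f \<in> L2_M"
  shows "integrable cell f"
proof (rule Bochner_Integration.integrable_bound)
  have "set_integrable lborel unit_cell (\<lambda>x. (cmod (f x))\<^sup>2)"
    using assms compact_unit_cell by (simp add: mem_L2_M L2_loc_def)
  then have "integrable cell (\<lambda>x. (cmod (f x))\<^sup>2)"
    by (simp add: set_integrable_cell)
  then show "integrable cell (\<lambda>x. 1 + (cmod (f x))\<^sup>2)"
    by (intro Bochner_Integration.integrable_add integrable_cell_continuous[of "\<lambda>x. 1"]) auto
  show "f \<in> borel_measurable cell"
    using assms L2_M_borel borel_measurable_cell by blast
  show "AE x in cell. norm (f x) \<le> norm (1 + (cmod (f x))\<^sup>2)"
  proof (rule AE_I2)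
    fix x
    have "0 \<le> (cmod (f x) - 1)\<^sup>2" by simp
    then show "norm (f x) \<le> norm (1 + (cmod (f x))\<^sup>2)"
      by (simp add: power2_eq_square algebra_simps) (smt (verit) norm_ge_zero)
  qed
qed

lemma AE_lborel_shift: "AE x in lborel. P x \<Longrightarrow> AE x in lborel. P (x + c)" for c :: "real^2"
proof -
  assume "AE x in lborel. P x"
  then have "AE x in distr lborel borel ((+) c). P x" unfolding lborel_distr_plus .
  from AE_distrD[OF _ this] have "AE x in lborel. P (c + x)" by simp
  then show ?thesis by (simp add: add.commute)
qed

lemma countable_Lambda: "countable Lambda"
proof -
  have "Lambda \<subseteq> (\<lambda>(a, b). vector [of_int a, of_int b]) ` (UNIV :: (int \<times> int) set)"
  proof
    fix v :: "real^2" assume "v \<in> Lambda"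
    then have "v $ 1 \<in> \<int>" "v $ 2 \<in> \<int>" by (auto simp: Lambda_def)
    then obtain a b where "v $ 1 = of_int a" "v $ 2 = of_int b" by (auto elim!: Ints_cases)
    then have "v = vector [of_int a, of_int b]" by (simp add: vec_eq_iff forall_2)
    then show "v \<in> (\<lambda>(a, b). vector [of_int a, of_int b]) ` (UNIV :: (int \<times> int) set)" by force
  qed
  then show ?thesis by (rule countable_subset) (intro countable_image countableI_type)
qed

text \<open>Countably many lattice vectors have a common exceptional null set. Any other point is
  carried into the cell by subtracting the integer parts of its coordinates, and the phase picked up
  is nonzero.\<close>

lemma L2_M_AE_zero:
  assumes g: "g \<in> L2_M" and 0: "AE x in cell. g x = 0"
  shows "AE x in lborel. g x = 0"
proof -
  have "AE x in lborel. \<forall>v\<in>Lambda. x + v \<in> unit_cell \<longrightarrow> g (x + v) = 0"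
    using AE_lborel_shift[OF 0[unfolded AE_cell_iff]]
    by (subst AE_ball_countable[OF countable_Lambda]) blast
  moreover have "AE x in lborel. \<forall>v\<in>Lambda. g (x + v) = plane_wave M_pt v * g x"
    using g by (simp add: AE_ball_countable countable_Lambda mem_L2_M)
  ultimately show ?thesis
  proof eventually_elim
    case (elim x)
    define v :: "real^2" where "v = (\<chi> j. - of_int \<lfloor>x $ j\<rfloor>)"
    have "v \<in> Lambda" by (simp add: v_def Lambda_def)
    moreover have "x + v \<in> unit_cell"
      unfolding mem_unit_cell v_def by simp (smt (verit) of_int_floor_le real_of_int_floor_add_one_gt)
    ultimately have "plane_wave M_pt v * g x = 0" using elim by metis
    then show ?case by simp
  qed
qed

lemma continuous_AE_eq:
  fixes f g :: "real^2 \<Rightarrow> complex"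
  assumes "continuous_on UNIV f" "continuous_on UNIV g" "AE x in lborel. f x = g x"
  shows "f x = g x"
proof -
  define U where "U = {x. f x \<noteq> g x}"
  have U: "open U" unfolding U_def by (intro open_Collect_neq assms)
  then have "U \<in> sets lborel" by simp
  then have "U \<in> null_sets lborel"
    using assms(3) AE_iff_null_sets[of U lborel] by (simp add: U_def)
  then have "negligible U"
    using \<open>U \<in> sets lborel\<close> by (simp add: negligible_iff_null_sets null_sets_completion_iff)
  then have "U = {}" using U open_not_negligible by blast
  then show ?thesis by (auto simp: U_def)
qed

text \<open>Test functions are pseudo-periodic by definition only almost everywhere; continuity
  upgrades this to every point, the form used by integration by parts.\<close>

lemma bloch_of_L2_M:
  assumes "f \<in> L2_M" "continuous_on UNIV f"
  shows "bloch M_pt f"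
  unfolding bloch_def
proof (intro ballI allI)
  fix v x assume "v \<in> Lambda"
  then have "AE x in lborel. f (x + v) = plane_wave M_pt v * f x"
    using assms by (simp add: mem_L2_M)
  then show "f (x + v) = plane_wave M_pt v * f x"
    by (rule continuous_AE_eq[rotated 2])
       (intro continuous_intros continuous_on_compose2[OF assms(2)] assms(2); simp)+
qed

section \<open>Fourier coefficients and series of pseudo-periodic functions\<close>

definition coef :: "(real^2 \<Rightarrow> complex) \<Rightarrow> int \<times> int \<Rightarrow> complex" where
  "coef f m = (\<integral>x. cnj (ew m x) * f x \<partial>cell)"

definition pser :: "(int \<times> int \<Rightarrow> complex) \<Rightarrow> real^2 \<Rightarrow> complex" where
  "pser d x = (\<Sum>\<^sub>\<infinity>m. d m * ew m x)"

lemma continuous_cnj_ew: "continuous_on UNIV (\<lambda>x. cnj (ew m x))"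
  by (intro continuous_intros)

lemma coef_bound: 
  assumes "integrable cell f"
  shows "cmod (coef f m) \<le> (\<integral>x. cmod (f x) \<partial>cell)"
proof -
  have "cmod (coef f m) \<le> (\<integral>x. cmod (cnj (ew m x) * f x) \<partial>cell)"
    unfolding coef_def by (rule integral_norm_bound)
  then show ?thesis by (simp add: norm_mult)
qed

lemma coef_add: "f \<in> L2_M \<Longrightarrow> g \<in> L2_M \<Longrightarrow> coef (\<lambda>x. f x + g x) m = coef f m + coef g m"
  unfolding coef_def
  by (simp add: ring_distribs integrable_cell_mult_continuous[OF L2_M_integrable continuous_cnj_ew])

lemma coef_cmult: "coef (\<lambda>x. c * f x) m = c * coef f m"
  unfolding coef_def by (simp add: mult.left_commute)

lemma coef_cong_AE:
  assumes "f \<in> L2_M" "g \<in> L2_M" "AE x in lborel. f x = g x"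
  shows "coef f m = coef g m"
  unfolding coef_def
proof (rule integral_cong_AE)
  show "AE x in cell. cnj (ew m x) * f x = cnj (ew m x) * g x"
    using AE_cell[OF assms(3)] by eventually_elim simp
qed (rule borel_measurable_integrable integrable_cell_mult_continuous L2_M_integrable continuous_cnj_ew assms)+

lemma continuous_pser: "(\<lambda>m. cmod (d m)) summable_on UNIV \<Longrightarrow> continuous_on UNIV (pser d)"
  unfolding pser_def[abs_def] by (rule wave_continuous)

lemma bloch_pser: "bloch M_pt (pser d)"
proof -
  have "pser d (x + v) = plane_wave M_pt v * pser d x" if "v \<in> Lambda" for x v
  proof -
    have "ew m (x + v) = plane_wave M_pt v * ew m x" for m
      using bloch_ew that by (simp add: bloch_def)
    then have "pser d (x + v) = (\<Sum>\<^sub>\<infinity>m. plane_wave M_pt v * (d m * ew m x))"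
      unfolding pser_def by (simp add: mult_ac)
    then show ?thesis by (simp add: pser_def infsum_cmult_right')
  qed
  then show ?thesis by (simp add: bloch_def)
qed

lemma pser_L2_M: "(\<lambda>m. cmod (d m)) summable_on UNIV \<Longrightarrow> pser d \<in> L2_M"
  by (intro L2_M_continuous continuous_pser bloch_pser)

lemma pser_integral:
  assumes "(\<lambda>m. cmod (d m)) summable_on UNIV" "integrable cell w"
  shows "((\<lambda>m. d m * (\<integral>x. w x * ew m x \<partial>cell)) has_sum (\<integral>x. w x * pser d x \<partial>cell)) UNIV"
  unfolding pser_def using wave_integral[OF assms] .

text \<open>Termwise integration leaves a single nonzero term by orthogonality of the waves.\<close>

lemma coef_pser:
  assumes "(\<lambda>m. cmod (d m)) summable_on UNIV"
  shows "coef (pser d) n = d n"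
proof -
  have "((\<lambda>m. d m * (\<integral>x. cnj (ew n x) * ew m x \<partial>cell)) has_sum coef (pser d) n) UNIV"
    unfolding coef_def by (intro pser_integral assms integrable_cell_continuous continuous_cnj_ew)
  moreover have "((\<lambda>m. d m * (\<integral>x. cnj (ew n x) * ew m x \<partial>cell)) has_sum d n) UNIV"
    unfolding cnj_ew_ew integral_tw
    using has_sum_finite_neutralI[of "{n}" UNIV "\<lambda>m. d m * (if m - n = 0 then 1 else 0)"] by auto
  ultimately show ?thesis by (rule has_sum_unique)
qed

text \<open>Eigenfunctions turn out to have absolutely summable coefficients, so no \<open>L\<^sup>2\<close> convergence theorem is needed:
  uniqueness of the coefficients suffices.\<close>

theorem L2_M_eq_pser:
  assumes f: "f \<in> L2_M" and s: "(\<lambda>m. cmod (d m)) summable_on UNIV" and d: "\<And>m. coef f m = d m"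
  shows "AE x in lborel. f x = pser d x"
proof -
  define g where "g x = f x - pser d x" for x
  have g: "g \<in> L2_M" unfolding g_def using f pser_L2_M[OF s] by (rule L2_M_diff)
  have cg: "coef g m = 0" for m
  proof -
    have "coef g m = coef f m + coef (\<lambda>x. (-1) * pser d x) m"
      unfolding g_def using coef_add[OF f L2_M_cmult[OF pser_L2_M[OF s]], of "-1" m] by simp
    then show ?thesis by (simp only: coef_cmult coef_pser[OF s] d) simp
  qed
  \<comment> \<open>Removing the phase of \<open>M_pt\<close> reduces the claim to periodic
    exponentials; frequency \<open>k\<close> corresponds to the coefficient at
    \<open>- k\<close>.\<close>
  define h where "h x = plane_wave (- M_pt) x * g x" for x
  have "tw_null h"
    unfolding tw_null_def
  proof (intro conjI allI)
    show "integrable cell h"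
      unfolding h_def using g by (intro integrable_cell_mult_continuous L2_M_integrable continuous_intros)
    fix k
    have "tw k x * h x = cnj (ew (- k) x) * g x" for x
      by (simp add: h_def plane_wave_cnj M_shift_tk tk_minus mult.assoc flip: plane_wave_add)
    then show "(\<integral>x. tw k x * h x \<partial>cell) = 0"
      using cg[of "- k"] by (simp add: coef_def)
  qed
  moreover have "h \<in> borel_measurable borel"
    unfolding h_def using L2_M_borel[OF g] continuous_borel[OF continuous_plane_wave[OF continuous_on_id]] by simp
  ultimately have "AE x in cell. h x = 0" by (rule tw_null_AE)
  then have "AE x in cell. g x = 0" by (simp add: h_def)
  from L2_M_AE_zero[OF g this] show ?thesis by (simp add: g_def)
qed

subsection \<open>Rapidly decreasing coefficients\<close>

text \<open>A product rather than a norm: its inverse square sums as a product of two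
  one-dimensional series, it is submultiplicative, and one derivative in each coordinate of a smooth
  function pays for one power of it.\<close>

definition wt :: "int \<times> int \<Rightarrow> real" where
  "wt m = (1 + real_of_int \<bar>fst m\<bar>) * (1 + real_of_int \<bar>snd m\<bar>)"

lemma wt_ge_1: "1 \<le> wt m"
  unfolding wt_def using mult_mono[of 1 "1 + real_of_int \<bar>fst m\<bar>" 1 "1 + real_of_int \<bar>snd m\<bar>"] by simp

lemma wt_pos [simp]: "0 < wt m" "0 \<le> wt m" "wt m \<noteq> 0"
  using wt_ge_1[of m] by auto

lemma wt_submult: "wt m \<le> wt k * wt (m - k)"
proof -
  have 1: "1 + real_of_int \<bar>a\<bar> \<le> (1 + real_of_int \<bar>b\<bar>) * (1 + real_of_int \<bar>a - b\<bar>)" for a b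
  proof -
    have "real_of_int \<bar>a\<bar> \<le> real_of_int \<bar>b\<bar> + real_of_int \<bar>a - b\<bar>" by linarith
    moreover have "0 \<le> real_of_int \<bar>b\<bar> * real_of_int \<bar>a - b\<bar>" by simp
    moreover have "(1 + B) * (1 + D) = 1 + B + D + B * D" for B D :: real
      by (simp add: ring_distribs)
    ultimately show ?thesis by (simp only:)
  qed
  have "wt m \<le> ((1 + real_of_int \<bar>fst k\<bar>) * (1 + real_of_int \<bar>fst m - fst k\<bar>)) *
    ((1 + real_of_int \<bar>snd k\<bar>) * (1 + real_of_int \<bar>snd m - snd k\<bar>))"
    unfolding wt_def by (intro mult_mono 1) auto
  then show ?thesis by (simp add: wt_def mult_ac)
qed

lemma summable_int_inverse_square: "(\<lambda>n::int. 1 / (1 + real_of_int \<bar>n\<bar>)^2) summable_on UNIV"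
proof -
  have "summable (\<lambda>n::nat. inverse (real (Suc n) ^ 2))"
    using inverse_power_summable[of 2, where 'a = real] by (subst summable_Suc_iff) simp
  then have s: "(\<lambda>n::nat. 1 / (1 + real n)^2) summable_on UNIV"
    by (intro norm_summable_imp_summable_on) (simp add: inverse_eq_divide add.commute power_abs)
  have "(\<lambda>n::int. 1 / (1 + real_of_int \<bar>n\<bar>)^2) summable_on range int"
    by (subst summable_on_reindex) (use s in \<open>auto simp: o_def\<close>)
  moreover have "(\<lambda>n::int. 1 / (1 + real_of_int \<bar>n\<bar>)^2) summable_on range (\<lambda>n. - int n)"
    by (subst summable_on_reindex) (use s in \<open>auto simp: o_def inj_on_def\<close>)
  then have "(\<lambda>n::int. 1 / (1 + real_of_int \<bar>n\<bar>)^2) summable_on (range (\<lambda>n. - int n) - range int)"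
    by (rule summable_on_subset_banach) auto
  ultimately have "(\<lambda>n::int. 1 / (1 + real_of_int \<bar>n\<bar>)^2) summable_on (range int \<union> (range (\<lambda>n. - int n) - range int))"
    by (rule summable_on_Un_disjoint) auto
  moreover have "range int \<union> (range (\<lambda>n. - int n) - range int) = UNIV"
  proof -
    have "n \<in> range int \<or> n \<in> range (\<lambda>n. - int n)" for n
      by (cases n rule: int_cases2) auto
    then show ?thesis by blast
  qed
  ultimately show ?thesis by simp
qed

lemma summable_inverse_wt: "(\<lambda>m. 1 / (wt m)^2) summable_on UNIV"
proof -
  let ?f = "\<lambda>n::int. 1 / (1 + real_of_int \<bar>n\<bar>)^2"
  have "(\<lambda>(a, b). ?f a * ?f b) summable_on (UNIV \<times> UNIV)"
  proof (rule summable_on_SigmaI)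
    show "((\<lambda>b. case (a, b) of (a, b) \<Rightarrow> ?f a * ?f b) has_sum (?f a * (\<Sum>\<^sub>\<infinity>b. ?f b))) UNIV" for a
      unfolding prod.case by (rule has_sum_cmult_right[OF has_sum_infsum[OF summable_int_inverse_square]])
    show "(\<lambda>a. ?f a * (\<Sum>\<^sub>\<infinity>b. ?f b)) summable_on UNIV"
      by (rule summable_on_cmult_left[OF summable_int_inverse_square])
  qed auto
  moreover have "(\<lambda>(a, b). ?f a * ?f b) = (\<lambda>m. 1 / (wt m)^2)"
    by (auto simp: wt_def power_mult_distrib)
  ultimately show ?thesis by simp
qed

lemma summable_wt_decay:
  assumes "\<And>m. \<bar>f m\<bar> * (wt m)^2 \<le> C"
  shows "(\<lambda>m. \<bar>f m\<bar>) summable_on UNIV"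
proof (rule summable_on_comparison_test)
  show "(\<lambda>m. C * (1 / (wt m)^2)) summable_on UNIV"
    by (rule summable_on_cmult_right[OF summable_inverse_wt])
  show "\<bar>f m\<bar> \<le> C * (1 / (wt m)^2)" for m
    using assms[of m] by (simp add: pos_le_divide_eq)
qed auto

section \<open>Decay of the Fourier coefficients of smooth periodic functions\<close>

definition fcoef :: "(real^2 \<Rightarrow> complex) \<Rightarrow> int \<times> int \<Rightarrow> complex" where
  "fcoef W m = (\<integral>x. W x * tw (- m) x \<partial>cell)"

lemma fourier_coeff_fcoef: "fourier_coeff V m = fcoef (\<lambda>x. complex_of_real (V x)) m"
proof -
  have "exp (- (2 * pi * \<i> * complex_of_real (of_int (fst m) * x $ 1 + of_int (snd m) * x $ 2))) = tw (- m) x" for x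
    by (simp add: plane_wave_def inner_real2 tk_nth algebra_simps)
  then show ?thesis
    by (simp add: fourier_coeff_def fcoef_def LINT_cell)
qed

lemma fcoef_partial:
  assumes "smooth W" "bloch 0 W"
  shows "fcoef (partial_deriv i W) m = \<i> * complex_of_real (tk m $ i) * fcoef W m"
  unfolding fcoef_def using smooth_ibp[OF assms, of "tk (- m)" i] bloch_tw[of "- m"] by (simp add: tk_minus)

text \<open>Induction on the total exponent with \<open>W\<close> arbitrary. One factor is traded
  for a derivative in the matching coordinate, which is again smooth and periodic; this is why the
  two exponents are kept apart.\<close>

lemma fcoef_decay:
  assumes "smooth W" "bloch 0 W"
  shows "\<exists>C. \<forall>m. (1 + real_of_int \<bar>fst m\<bar>) ^ a * (1 + real_of_int \<bar>snd m\<bar>) ^ b * cmod (fcoef W m) \<le> C"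
  using assms
proof (induction "a + b" arbitrary: a b W)
  case 0
  have "cmod (fcoef W m) \<le> (\<integral>x. cmod (W x) \<partial>cell)" for m
    unfolding fcoef_def using integral_norm_bound[of cell "\<lambda>x. W x * tw (- m) x"] by (simp add: norm_mult)
  then show ?case using 0 by auto
next
  case (Suc n)
  \<comment> \<open>The last term is the coefficient of a partial derivative, \<open>c\<close> being
    that of the function itself; \<open>2 * pi \<ge> 1\<close> absorbs the constant.\<close>
  have le: "(1 + real_of_int \<bar>j\<bar>) * cmod c \<le> cmod c + cmod (\<i> * complex_of_real (2 * pi * of_int j) * c)" for j c
  proof -
    have "real_of_int \<bar>j\<bar> \<le> 2 * pi * \<bar>of_int j\<bar>"
      using pi_ge_two mult_right_mono[of 1 "2 * pi" "\<bar>of_int j\<bar>"] by simp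
    then have "real_of_int \<bar>j\<bar> * cmod c \<le> (2 * pi * \<bar>of_int j\<bar>) * cmod c"
      by (intro mult_right_mono) auto
    then show ?thesis by (simp add: norm_mult abs_mult ring_distribs)
  qed
  show ?case
  proof (cases a)
    case (Suc a')
    obtain C where C: "\<forall>m. (1 + real_of_int \<bar>fst m\<bar>) ^ a' * (1 + real_of_int \<bar>snd m\<bar>) ^ b * cmod (fcoef W m) \<le> C"
      using Suc.hyps(1)[of a' b W] Suc.hyps(2) Suc.prems \<open>a = Suc a'\<close> by auto
    obtain C' where C': "\<forall>m. (1 + real_of_int \<bar>fst m\<bar>) ^ a' * (1 + real_of_int \<bar>snd m\<bar>) ^ b * cmod (fcoef (partial_deriv 1 W) m) \<le> C'"
      using Suc.hyps(1)[of a' b "partial_deriv 1 W"] Suc.hyps(2) Suc.prems \<open>a = Suc a'\<close>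
      by (auto simp: smooth_partial bloch_smooth_partial)
    have "(1 + real_of_int \<bar>fst m\<bar>) ^ a * (1 + real_of_int \<bar>snd m\<bar>) ^ b * cmod (fcoef W m) \<le> C + C'" for m
    proof -
      let ?X = "(1 + real_of_int \<bar>fst m\<bar>) ^ a' * (1 + real_of_int \<bar>snd m\<bar>) ^ b"
      have "(1 + real_of_int \<bar>fst m\<bar>) ^ a * (1 + real_of_int \<bar>snd m\<bar>) ^ b * cmod (fcoef W m)
         = ?X * ((1 + real_of_int \<bar>fst m\<bar>) * cmod (fcoef W m))"
        by (simp add: Suc mult_ac)
      also have "\<dots> \<le> ?X * (cmod (fcoef W m) + cmod (fcoef (partial_deriv 1 W) m))"
        unfolding fcoef_partial[OF Suc.prems] tk_nth by (intro mult_left_mono le) auto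
      also have "\<dots> \<le> C + C'"
        unfolding distrib_left by (intro add_mono C[rule_format] C'[rule_format])
      finally show ?thesis .
    qed
    then show ?thesis by blast
  next
    case 0
    then obtain b' where b': "b = Suc b'" using Suc.hyps(2) by (cases b) auto
    obtain C where C: "\<forall>m. (1 + real_of_int \<bar>fst m\<bar>) ^ a * (1 + real_of_int \<bar>snd m\<bar>) ^ b' * cmod (fcoef W m) \<le> C"
      using Suc.hyps(1)[of a b' W] Suc.hyps(2) Suc.prems b' by auto
    obtain C' where C': "\<forall>m. (1 + real_of_int \<bar>fst m\<bar>) ^ a * (1 + real_of_int \<bar>snd m\<bar>) ^ b' * cmod (fcoef (partial_deriv 2 W) m) \<le> C'"
      using Suc.hyps(1)[of a b' "partial_deriv 2 W"] Suc.hyps(2) Suc.prems b'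
      by (auto simp: smooth_partial bloch_smooth_partial)
    have "(1 + real_of_int \<bar>fst m\<bar>) ^ a * (1 + real_of_int \<bar>snd m\<bar>) ^ b * cmod (fcoef W m) \<le> C + C'" for m
    proof -
      let ?X = "(1 + real_of_int \<bar>fst m\<bar>) ^ a * (1 + real_of_int \<bar>snd m\<bar>) ^ b'"
      have "(1 + real_of_int \<bar>fst m\<bar>) ^ a * (1 + real_of_int \<bar>snd m\<bar>) ^ b * cmod (fcoef W m)
         = ?X * ((1 + real_of_int \<bar>snd m\<bar>) * cmod (fcoef W m))"
        by (simp add: b' mult_ac)
      also have "\<dots> \<le> ?X * (cmod (fcoef W m) + cmod (fcoef (partial_deriv 2 W) m))"
        unfolding fcoef_partial[OF Suc.prems] tk_nth by (intro mult_left_mono le) auto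
      also have "\<dots> \<le> C + C'"
        unfolding distrib_left by (intro add_mono C[rule_format] C'[rule_format])
      finally show ?thesis .
    qed
    then show ?thesis by blast
  qed
qed

text \<open>The linear part of the affine map \<open>rot_index\<close>: it acts on the frequencies
  of \<open>V\<close>, whereas \<open>rot_index\<close> acts on those of pseudo-periodic
  functions.\<close>

definition rk :: "int \<times> int \<Rightarrow> int \<times> int" where
  "rk m = (snd m, - fst m)"

lemma R_mat_tk: "R_mat *v tk m = tk (rk m)"
  by (simp add: vec_eq_iff forall_2 rot_nth tk_nth rk_def)

lemma bij_rk: "bij rk"
  by (rule bij_betw_byWitness[where f' = "\<lambda>m. (- snd m, fst m)"]) (auto simp: rk_def)

lemma bij_rot_index: "bij rot_index"
  by (rule bij_betw_byWitness[where f' = "\<lambda>m. (- 1 - snd m, fst m)"]) (auto simp: rot_index_def)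

lemma rot_index_diff: "rot_index (m - k) = rot_index m - rk k"
  by (simp add: rot_index_def rk_def)

abbreviation ksq :: "int \<times> int \<Rightarrow> real" where
  "ksq m \<equiv> (norm (M_shift m))\<^sup>2"

lemma ksq_eq: "ksq m = pi\<^sup>2 * ((2 * of_int (fst m) + 1)\<^sup>2 + (2 * of_int (snd m) + 1)\<^sup>2)"
  by (simp add: power2_norm_eq_inner inner_real2 M_shift_nth) (simp add: power2_eq_square algebra_simps)

lemma ksq_rot: "ksq (rot_index m) = ksq m"
  by (simp add: ksq_eq rot_index_def) (simp add: power2_eq_square algebra_simps)

text \<open>The Laplacian costs two powers of the weight. Since inverse squares of the weight are
  summable, decay of order four makes both a function and its Laplacian absolutely convergent
  series.\<close>

lemma ksq_le_wt: "ksq m \<le> 8 * pi\<^sup>2 * (wt m)\<^sup>2"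
proof -
  have 1: "(2 * of_int a + 1)\<^sup>2 \<le> 4 * (1 + real_of_int \<bar>a\<bar>)\<^sup>2" for a
  proof -
    have "\<bar>2 * real_of_int a + 1\<bar> \<le> 2 * (1 + real_of_int \<bar>a\<bar>)" using abs_triangle_ineq[of "2 * real_of_int a" 1] by (simp add: abs_mult)
    from power_mono[OF this, of 2] show ?thesis unfolding power_mult_distrib by simp
  qed
  have 2: "(1 + real_of_int \<bar>a\<bar>)\<^sup>2 \<le> (1 + real_of_int \<bar>a\<bar>)\<^sup>2 * (1 + real_of_int \<bar>b\<bar>)\<^sup>2" for a b
    using mult_left_mono[of 1 "(1 + real_of_int \<bar>b\<bar>)\<^sup>2" "(1 + real_of_int \<bar>a\<bar>)\<^sup>2"] one_le_power[of "1 + real_of_int \<bar>b\<bar>" 2] by simp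
  have "(2 * of_int (fst m) + 1)\<^sup>2 + (2 * of_int (snd m) + 1)\<^sup>2 \<le> 8 * (wt m)\<^sup>2"
    using 1[of "fst m"] 1[of "snd m"] 2[of "fst m" "snd m"] 2[of "snd m" "fst m"]
    by (simp add: wt_def power_mult_distrib mult.commute)
  from mult_left_mono[OF this, of "pi\<^sup>2"] show ?thesis
    by (simp add: ksq_eq mult_ac)
qed

subsection \<open>The eigenvalue equation in Fourier space\<close>

locale admissible_potential =
  fixes V :: "real^2 \<Rightarrow> real"
  assumes adm: "admissible V"
begin

abbreviation Vc :: "real^2 \<Rightarrow> complex" where "Vc x \<equiv> complex_of_real (V x)"
abbreviation Vh :: "int \<times> int \<Rightarrow> complex" where "Vh \<equiv> fourier_coeff V"

text \<open>The Wiener norm of \<open>V\<close>; it bounds the norm of \<open>conv\<close> on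
  bounded sequences, and all smallness conditions are expressed through it.\<close>

definition Vsum :: real where "Vsum = (\<Sum>\<^sub>\<infinity>k. cmod (Vh k))"

definition conv :: "(int \<times> int \<Rightarrow> complex) \<Rightarrow> int \<times> int \<Rightarrow> complex" where
  "conv c m = (\<Sum>\<^sub>\<infinity>k. Vh k * c (m - k))"

lemma smooth_Vc: "smooth Vc" and bloch_Vc: "bloch 0 Vc" and continuous_Vc: "continuous_on UNIV Vc"
  using adm by (auto simp: admissible_def bloch_def intro!: smooth_of_real smooth_continuous)

lemma Vh_decay: "\<exists>C. \<forall>k. cmod (Vh k) * wt k ^ s \<le> C"
  using fcoef_decay[OF smooth_Vc bloch_Vc, of s s]
  by (simp add: fourier_coeff_fcoef wt_def power_mult_distrib mult_ac)

text \<open>Two of \<open>s + 2\<close> available powers of the weight are spent on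
  summability.\<close>

lemma Vh_wt_summable: "(\<lambda>k. cmod (Vh k) * wt k ^ s) summable_on UNIV"
proof -
  obtain C where C: "\<And>k. cmod (Vh k) * wt k ^ (s + 2) \<le> C" using Vh_decay by blast
  have "\<bar>cmod (Vh k) * wt k ^ s\<bar> * (wt k)\<^sup>2 \<le> C" for k
    using C[of k] by (simp add: abs_mult power_add mult_ac power2_eq_square)
  from summable_wt_decay[OF this] show ?thesis by (simp add: abs_mult)
qed

lemma Vh_summable: "(\<lambda>k. cmod (Vh k)) summable_on UNIV"
  using Vh_wt_summable[of 0] by simp

lemma Vsum_nonneg: "0 \<le> Vsum"
  unfolding Vsum_def by (rule infsum_nonneg) simp

lemma conv_summable:
  assumes "\<And>m. cmod (c m) \<le> B"
  shows "(\<lambda>k. Vh k * c (m - k)) summable_on UNIV"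
proof (rule abs_summable_summable, rule Infinite_Sum.abs_summable_on_comparison_test')
  show "(\<lambda>k. B * cmod (Vh k)) summable_on UNIV"
    by (rule summable_on_cmult_right[OF Vh_summable])
  show "cmod (Vh k * c (m - k)) \<le> B * cmod (Vh k)" for k
    using assms by (simp add: norm_mult mult.commute[of B] mult_left_mono)
qed

lemma conv_bound:
  assumes "\<And>m. cmod (c m) \<le> B"
  shows "cmod (conv c m) \<le> Vsum * B"
  unfolding conv_def
proof (rule norm_infsum_le)
  show "((\<lambda>k. Vh k * c (m - k)) has_sum (\<Sum>\<^sub>\<infinity>k. Vh k * c (m - k))) UNIV"
    by (rule has_sum_infsum[OF conv_summable[OF assms]])
  show "((\<lambda>k. cmod (Vh k) * B) has_sum Vsum * B) UNIV"
    unfolding Vsum_def by (rule has_sum_cmult_left[OF has_sum_infsum[OF Vh_summable]])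
  show "cmod (Vh k * c (m - k)) \<le> cmod (Vh k) * B" for k
    using assms by (simp add: norm_mult mult_left_mono)
qed

lemma conv_cmult: "conv (\<lambda>m. a * c m) m = a * conv c m"
  by (simp add: conv_def mult.left_commute infsum_cmult_right')

lemma conv_add:
  assumes "\<And>m. cmod (c m) \<le> B" "\<And>m. cmod (c' m) \<le> B'"
  shows "conv (\<lambda>m. c m + c' m) m = conv c m + conv c' m"
  unfolding conv_def ring_distribs by (rule infsum_add) (rule conv_summable assms)+

lemma conv_diff:
  assumes "\<And>m. cmod (c m) \<le> B" "\<And>m. cmod (c' m) \<le> B'"
  shows "conv (\<lambda>m. c m - c' m) m = conv c m - conv c' m"
  using conv_add[where c = c and c' = "\<lambda>m. (-1) * c' m" and B = B and B' = B' and m = m] assms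
    conv_cmult[of "-1" c' m] by simp

text \<open>Submultiplicativity splits the weight at \<open>m\<close> into weights at
  \<open>k\<close> and \<open>m - k\<close>. The first is absorbed by the rapid decay of
  \<open>Vh\<close>, the second by the assumption on \<open>c\<close>, so no order of decay is
  lost.\<close>

lemma conv_decay:
  assumes "\<And>m. cmod (c m) * wt m ^ s \<le> C"
  shows "\<exists>C'. \<forall>m. cmod (conv c m) * wt m ^ s \<le> C'"
proof (intro exI allI)
  fix m
  have C0: "0 \<le> C"
    using assms[of 0] by (meson mult_nonneg_nonneg norm_ge_zero order_trans wt_pos(2) zero_le_power)
  have cb: "cmod (c m) \<le> C" for m
  proof -
    have "cmod (c m) * 1 \<le> cmod (c m) * wt m ^ s"
      by (intro mult_left_mono one_le_power wt_ge_1) auto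
    then show ?thesis using assms[of m] by simp
  qed
  have "cmod (of_real (wt m ^ s) * conv c m) \<le> C * (\<Sum>\<^sub>\<infinity>k. cmod (Vh k) * wt k ^ s)"
    unfolding conv_def
  proof (rule norm_infsum_le)
    show "((\<lambda>k. of_real (wt m ^ s) * (Vh k * c (m - k))) has_sum (of_real (wt m ^ s) * (\<Sum>\<^sub>\<infinity>k. Vh k * c (m - k)))) UNIV"
      by (intro has_sum_cmult_right has_sum_infsum conv_summable[OF cb])
    show "((\<lambda>k. C * (cmod (Vh k) * wt k ^ s)) has_sum C * (\<Sum>\<^sub>\<infinity>k. cmod (Vh k) * wt k ^ s)) UNIV"
      by (intro has_sum_cmult_right has_sum_infsum Vh_wt_summable)
    fix k
    have "cmod (of_real (wt m ^ s) * (Vh k * c (m - k))) = cmod (Vh k) * (cmod (c (m - k)) * wt m ^ s)"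
      by (simp add: norm_mult norm_power mult_ac)
    also have "\<dots> \<le> cmod (Vh k) * (cmod (c (m - k)) * (wt k * wt (m - k)) ^ s)"
      by (intro mult_left_mono power_mono wt_submult) auto
    also have "\<dots> = (cmod (Vh k) * wt k ^ s) * (cmod (c (m - k)) * wt (m - k) ^ s)"
      by (simp add: power_mult_distrib mult_ac)
    also have "\<dots> \<le> (cmod (Vh k) * wt k ^ s) * C"
      by (intro mult_left_mono assms) auto
    finally show "cmod (of_real (wt m ^ s) * (Vh k * c (m - k))) \<le> C * (cmod (Vh k) * wt k ^ s)"
      by (simp add: mult.commute)
  qed
  then show "cmod (conv c m) * wt m ^ s \<le> C * (\<Sum>\<^sub>\<infinity>k. cmod (Vh k) * wt k ^ s)"
    by (simp add: norm_mult norm_power mult.commute)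
qed

lemma Vc_L2_M: "(\<lambda>x. Vc x * ew 0 x) \<in> L2_M"
  by (rule L2_M_mult[OF _ continuous_Vc bloch_Vc])
     (intro L2_M_continuous bloch_ew continuous_intros)

lemma coef_Vc: "coef (\<lambda>x. Vc x * ew 0 x) m = Vh m"
proof -
  have *: "cnj (ew m x) * (Vc x * ew 0 x) = Vc x * tw (- m) x" for x
  proof -
    have "cnj (ew m x) * (Vc x * ew 0 x) = Vc x * (cnj (ew m x) * ew 0 x)"
      by (simp only: mult_ac)
    then show ?thesis unfolding cnj_ew_ew by simp
  qed
  show ?thesis by (simp only: coef_def fourier_coeff_fcoef fcoef_def *)
qed

text \<open>The expansion theorem concerns pseudo-periodic functions, so it is applied to
  \<open>V\<close> times \<open>ew 0\<close> and the factor is divided out; continuity turns the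
  almost-everywhere identity into a pointwise one.\<close>

lemma Vc_series: "Vc x = (\<Sum>\<^sub>\<infinity>k. Vh k * tw k x)"
proof -
  have "AE x in lborel. Vc x * ew 0 x = pser Vh x"
    by (rule L2_M_eq_pser[OF Vc_L2_M Vh_summable coef_Vc])
  then have "Vc x * ew 0 x = pser Vh x"
    by (rule continuous_AE_eq[rotated 2])
       (intro continuous_intros continuous_Vc continuous_pser Vh_summable)+
  also have "\<dots> = (\<Sum>\<^sub>\<infinity>k. ew 0 x * (Vh k * tw k x))"
    unfolding pser_def by (simp add: ew_tw mult_ac)
  also have "\<dots> = ew 0 x * (\<Sum>\<^sub>\<infinity>k. Vh k * tw k x)"
    by (rule infsum_cmult_right')
  finally show ?thesis by (simp add: mult.commute)
qed

text \<open>Comparing coefficients in the series of \<open>V\<close> avoids rotating the unit cell.\<close>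

lemma Vh_rk: "Vh (rk k) = Vh k"
proof -
  \<comment> \<open>These are the coefficients of the rotated potential; since that is
    \<open>V\<close> again, uniqueness of coefficients will give \<open>Vh = g\<close>.\<close>
  define g where "g k = Vh (inv rk k)" for k
  have g_rk: "g (rk k) = Vh k" for k
    unfolding g_def using bij_rk by (simp add: bij_is_inj)
  have gs: "(\<lambda>k. cmod (g k)) summable_on UNIV"
    using summable_on_reindex_bij_betw[OF bij_rk, of "\<lambda>k. cmod (g k)"] Vh_summable by (simp add: g_rk)
  have "Vc x * ew 0 x = pser g x" for x
  proof -
    have "Vc x = Vc (transpose R_mat *v x)"
      using adm by (simp add: admissible_def)
    also have "\<dots> = (\<Sum>\<^sub>\<infinity>k. g (rk k) * tw (rk k) x)"
      by (subst Vc_series) (simp only: plane_wave_rot R_mat_tk g_rk)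
    also have "\<dots> = (\<Sum>\<^sub>\<infinity>k. g k * tw k x)"
      by (rule infsum_reindex_bij_betw[OF bij_rk])
    finally have "Vc x * ew 0 x = ew 0 x * (\<Sum>\<^sub>\<infinity>k. g k * tw k x)" by (simp add: mult.commute)
    also have "\<dots> = (\<Sum>\<^sub>\<infinity>k. ew 0 x * (g k * tw k x))"
      by (rule infsum_cmult_right'[symmetric])
    also have "\<dots> = pser g x"
      unfolding pser_def by (simp add: ew_tw mult_ac)
    finally show ?thesis .
  qed
  then have "(\<lambda>x. Vc x * ew 0 x) = pser g" by blast
  then have "Vh m = g m" for m
    using coef_Vc[of m] coef_pser[OF gs, of m] by simp
  then show ?thesis using g_rk by metis
qed

text \<open>Two quarter turns are a reflection in the origin:
  \<open>rk (rk k) = - k\<close>.\<close>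

lemma Vh_minus: "Vh (- k) = Vh k"
  using Vh_rk[of "rk k"] Vh_rk[of k] by (cases k) (simp add: rk_def)

lemma Vh_real: "cnj (Vh k) = Vh k"
proof -
  have "cnj (Vh k) = Vh (- k)"
    unfolding fourier_coeff_fcoef fcoef_def cnj_integral_cell
    by (simp add: plane_wave_cnj tk_minus)
  then show ?thesis by (simp add: Vh_minus)
qed

lemma conv_rot: "conv c (rot_index m) = conv (\<lambda>m. c (rot_index m)) m"
proof -
  have "conv c (rot_index m) = (\<Sum>\<^sub>\<infinity>k. Vh (rk k) * c (rot_index m - rk k))"
    unfolding conv_def by (rule infsum_reindex_bij_betw[OF bij_rk, symmetric])
  then show ?thesis by (simp add: conv_def Vh_rk rot_index_diff)
qed

lemma conv_cnj: "conv (\<lambda>m. cnj (c m)) m = cnj (conv c m)"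
proof -
  have "cnj (conv c m) = (\<Sum>\<^sub>\<infinity>k. cnj (Vh k * c (m - k)))"
    unfolding conv_def by (rule infsum_cnj[symmetric])
  then show ?thesis by (simp add: conv_def Vh_real)
qed

text \<open>The absolutely convergent series of \<open>V\<close> is integrated term by term against
  the integrable function \<open>cnj (ew m x) * f x\<close>; the factor \<open>tw k\<close> shifts
  the index to \<open>m - k\<close>.\<close>

lemma coef_V_mult:
  assumes f: "integrable cell f"
  shows "coef (\<lambda>x. Vc x * f x) m = conv (coef f) m"
proof -
  define w where "w x = cnj (ew m x) * f x" for x
  have w: "integrable cell w"
    unfolding w_def by (rule integrable_cell_mult_continuous[OF f continuous_cnj_ew])
  have "w x * tw k x = cnj (ew (m - k) x) * f x" for k x
  proof -
    have "plane_wave (- M_shift m) x * tw k x = plane_wave (- M_shift (m - k)) x"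
      unfolding plane_wave_add[symmetric] by (simp add: M_shift_tk tk_diff algebra_simps)
    then show ?thesis by (simp add: w_def plane_wave_cnj mult_ac)
  qed
  then have "(\<integral>x. w x * tw k x \<partial>cell) = coef f (m - k)" for k
    by (simp add: coef_def)
  then have "((\<lambda>k. Vh k * coef f (m - k)) has_sum (\<integral>x. w x * Vc x \<partial>cell)) UNIV"
    using wave_integral[OF Vh_summable w, of tk] Vc_series by simp
  then have "conv (coef f) m = (\<integral>x. w x * Vc x \<partial>cell)"
    unfolding conv_def by (rule infsumI)
  then show ?thesis by (simp add: w_def coef_def mult_ac)
qed

section \<open>Passage from eigenfunctions to sequences and back\<close>

definition eigen_seq :: "real \<Rightarrow> real \<Rightarrow> (int \<times> int \<Rightarrow> complex) \<Rightarrow> bool" where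
  "eigen_seq \<epsilon> \<mu> c \<longleftrightarrow> (\<forall>m. complex_of_real (ksq m - \<mu>) * c m + complex_of_real \<epsilon> * conv c m = 0)"

lemma eigenspace_L2_M: "f \<in> eigenspace V \<epsilon> \<mu> \<Longrightarrow> f \<in> L2_M"
  by (auto simp: eigenspace_def H_graph_def weak_laplacian_def)

lemma cell_inner_eq: "cell_inner f g = (\<integral>x. cnj (f x) * g x \<partial>cell)"
  by (simp add: cell_inner_def LINT_cell)

lemma coef_Vmu:
  assumes f: "f \<in> L2_M"
  shows "coef (\<lambda>x. complex_of_real (\<epsilon> * V x - \<mu>) * f x) m = complex_of_real \<epsilon> * conv (coef f) m - complex_of_real \<mu> * coef f m"
proof -
  have 1: "(\<lambda>x. complex_of_real \<epsilon> * (Vc x * f x)) \<in> L2_M"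
    by (intro L2_M_cmult L2_M_mult f continuous_Vc bloch_Vc)
  have 2: "(\<lambda>x. (- complex_of_real \<mu>) * f x) \<in> L2_M"
    by (intro L2_M_cmult f)
  have "(\<lambda>x. complex_of_real (\<epsilon> * V x - \<mu>) * f x) = (\<lambda>x. complex_of_real \<epsilon> * (Vc x * f x) + (- complex_of_real \<mu>) * f x)"
    by (simp add: fun_eq_iff algebra_simps)
  then have "coef (\<lambda>x. complex_of_real (\<epsilon> * V x - \<mu>) * f x) m
      = coef (\<lambda>x. complex_of_real \<epsilon> * (Vc x * f x)) m + coef (\<lambda>x. (- complex_of_real \<mu>) * f x) m"
    using coef_add[OF 1 2, of m] by simp
  then show ?thesis unfolding coef_cmult coef_V_mult[OF L2_M_integrable[OF f]] by simp
qed

text \<open>Each \<open>ew m\<close> is itself an admissible test function and an eigenfunction of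
  the Laplacian; testing with it gives the equation at \<open>m\<close>.\<close>

lemma eigenspace_coef:
  assumes f: "f \<in> eigenspace V \<epsilon> \<mu>"
  shows "eigen_seq \<epsilon> \<mu> (coef f)"
  unfolding eigen_seq_def
proof
  fix m
  obtain g where g: "weak_laplacian f g" and ae: "AE x in lborel. complex_of_real \<mu> * f x = - g x + complex_of_real (\<epsilon> * V x) * f x"
    using f by (auto simp: eigenspace_def H_graph_def)
  have fL: "f \<in> L2_M" and gL: "g \<in> L2_M" using g by (auto simp: weak_laplacian_def)
  have ewL: "ew m \<in> L2_M" by (intro L2_M_continuous bloch_ew continuous_intros)
  have "cell_inner (laplacian (ew m)) f = cell_inner (ew m) g"
    using g ewL smooth_plane_wave by (auto simp: weak_laplacian_def)
  then have 1: "coef g m = - complex_of_real (ksq m) * coef f m"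
    unfolding cell_inner_eq laplacian_plane_wave[abs_def] coef_def by (simp add: mult.assoc)
  have gL': "(\<lambda>x. complex_of_real (\<epsilon> * V x - \<mu>) * f x) \<in> L2_M"
    by (rule L2_M_mult[OF fL]) (use continuous_Vc bloch_Vc in \<open>auto intro!: continuous_intros simp: bloch_def\<close>)
  have "coef g m = coef (\<lambda>x. complex_of_real (\<epsilon> * V x - \<mu>) * f x) m"
    by (rule coef_cong_AE[OF gL gL'])
       (use ae in \<open>eventually_elim, simp add: algebra_simps\<close>)
  note this[unfolded coef_Vmu[OF fL]]
  then show "complex_of_real (ksq m - \<mu>) * coef f m + complex_of_real \<epsilon> * conv (coef f) m = 0"
    using 1 by (simp add: algebra_simps)
qed

lemma integral_cell_cong_AE:
  assumes "AE x in lborel. f x = (g x :: complex)" "integrable cell w" "integrable cell f" "integrable cell g"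
    "continuous_on UNIV w"
  shows "(\<integral>x. w x * f x \<partial>cell) = (\<integral>x. w x * g x \<partial>cell)"
proof (rule integral_cong_AE)
  show "AE x in cell. w x * f x = w x * g x"
    using AE_cell[OF assms(1)] by eventually_elim simp
qed (intro borel_measurable_integrable integrable_cell_mult_continuous assms)+

text \<open>The weak equation is tested mode by mode: only \<open>f\<close> and \<open>\<Delta>f\<close> are expanded, never the test function.\<close>

lemma eigenspaceI:
  assumes d: "\<And>m. cmod (d m) * wt m ^ 4 \<le> C" and eq: "eigen_seq \<epsilon> \<mu> d"
    and f: "f \<in> L2_M" and fd: "AE x in lborel. f x = pser d x"
  shows "f \<in> eigenspace V \<epsilon> \<mu>"
proof -
  \<comment> \<open>The candidate for the Laplacian of \<open>f\<close> dictated by the eigenvalue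
    equation. By \<open>eigen_seq\<close> its coefficients are \<open>d'\<close>, those of the
    formally differentiated series.\<close>
  define g where "g x = complex_of_real (\<epsilon> * V x - \<mu>) * f x" for x
  define d' where "d' m = - complex_of_real (ksq m) * d m" for m
  have "\<bar>cmod (d m)\<bar> * (wt m)\<^sup>2 \<le> C" for m
  proof -
    have "cmod (d m) * (wt m)\<^sup>2 \<le> cmod (d m) * wt m ^ 4"
      by (intro mult_left_mono power_increasing wt_ge_1) auto
    then show ?thesis using d[of m] by simp
  qed
  from summable_wt_decay[OF this] have ds: "(\<lambda>m. cmod (d m)) summable_on UNIV" by simp
  have "\<bar>cmod (d' m)\<bar> * (wt m)\<^sup>2 \<le> 8 * pi\<^sup>2 * C" for m
  proof -
    have "cmod (d' m) * (wt m)\<^sup>2 = ksq m * (cmod (d m) * (wt m)\<^sup>2)"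
      by (simp add: d'_def norm_mult norm_power mult_ac)
    also have "\<dots> \<le> (8 * pi\<^sup>2 * (wt m)\<^sup>2) * (cmod (d m) * (wt m)\<^sup>2)"
      by (intro mult_right_mono ksq_le_wt) auto
    also have "\<dots> = 8 * pi\<^sup>2 * (cmod (d m) * wt m ^ 4)"
      by (simp add: power2_eq_square power4_eq_xxxx mult_ac)
    also have "\<dots> \<le> 8 * pi\<^sup>2 * C" by (intro mult_left_mono d) auto
    finally show ?thesis by simp
  qed
  from summable_wt_decay[OF this] have d's: "(\<lambda>m. cmod (d' m)) summable_on UNIV" by simp
  have gL: "g \<in> L2_M"
    unfolding g_def
    by (rule L2_M_mult[OF f]) (use continuous_Vc bloch_Vc in \<open>auto intro!: continuous_intros simp: bloch_def\<close>)
  have cf: "coef f m = d m" for m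
    using coef_cong_AE[OF f pser_L2_M[OF ds] fd] coef_pser[OF ds] by simp
  then have cf': "coef f = d" by blast
  have "coef g m = d' m" for m
  proof -
    have "complex_of_real (ksq m - \<mu>) * d m + complex_of_real \<epsilon> * conv d m = 0"
      using eq unfolding eigen_seq_def by blast
    then have "complex_of_real \<epsilon> * conv d m - complex_of_real \<mu> * d m = - complex_of_real (ksq m) * d m"
      by (simp add: algebra_simps add_eq_0_iff)
    then show ?thesis unfolding g_def coef_Vmu[OF f] cf' d'_def .
  qed
  from L2_M_eq_pser[OF gL d's this] have gd: "AE x in lborel. g x = pser d' x" .
  have "weak_laplacian f g"
    unfolding weak_laplacian_def
  proof (intro conjI f gL allI impI)
    fix \<phi> assume \<phi>: "smooth \<phi> \<and> \<phi> \<in> L2_M"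
    then have b: "bloch M_pt \<phi>" by (intro bloch_of_L2_M smooth_continuous) auto
    have c1: "continuous_on UNIV (\<lambda>x. cnj (\<phi> x))"
      using \<phi> by (intro continuous_intros smooth_continuous) auto
    have c2: "continuous_on UNIV (\<lambda>x. cnj (laplacian \<phi> x))"
      unfolding laplacian_def sum_2 using \<phi> by (intro continuous_intros smooth_continuous smooth_partial) auto
    have "cell_inner (laplacian \<phi>) f = (\<integral>x. cnj (laplacian \<phi> x) * pser d x \<partial>cell)"
      unfolding cell_inner_eq
      by (intro integral_cell_cong_AE[OF fd] integrable_cell_continuous c2 L2_M_integrable f pser_L2_M ds)
    moreover have "((\<lambda>m. d m * (\<integral>x. cnj (laplacian \<phi> x) * ew m x \<partial>cell)) has_sum (\<integral>x. cnj (laplacian \<phi> x) * pser d x \<partial>cell)) UNIV"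
      by (intro pser_integral ds integrable_cell_continuous c2)
    moreover have "cell_inner \<phi> g = (\<integral>x. cnj (\<phi> x) * pser d' x \<partial>cell)"
      unfolding cell_inner_eq
      by (intro integral_cell_cong_AE[OF gd] integrable_cell_continuous c1 L2_M_integrable gL pser_L2_M d's)
    moreover have "((\<lambda>m. d' m * (\<integral>x. cnj (\<phi> x) * ew m x \<partial>cell)) has_sum (\<integral>x. cnj (\<phi> x) * pser d' x \<partial>cell)) UNIV"
      by (intro pser_integral d's integrable_cell_continuous c1)
    moreover have "d m * (\<integral>x. cnj (laplacian \<phi> x) * ew m x \<partial>cell) = d' m * (\<integral>x. cnj (\<phi> x) * ew m x \<partial>cell)" for m
      using \<phi> b by (simp add: laplacian_ew_integral d'_def)
    ultimately show "cell_inner (laplacian \<phi>) f = cell_inner \<phi> g"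
      using has_sum_unique by (metis (no_types, lifting) has_sum_cong)
  qed
  moreover have "AE x in lborel. complex_of_real \<mu> * f x = - g x + complex_of_real (\<epsilon> * V x) * f x"
    by (rule AE_I2) (simp add: g_def algebra_simps)
  ultimately show ?thesis by (auto simp: eigenspace_def H_graph_def)
qed

end

subsection \<open>Lyapunov--Schmidt reduction in a rotation sector\<close>

declare split_paired_All [simp del]

text \<open>The four indices with \<open>\<bar>M\<^sup>m\<bar> = \<bar>M\<bar>\<close>; they form a single rotation orbit.\<close>

definition res :: "(int \<times> int) set" where
  "res = {(0,0), (0,-1), (-1,-1), (-1,0)}"

lemma rot_index_res: "rot_index m \<in> res \<longleftrightarrow> m \<in> res"
  by (cases m) (auto simp: res_def rot_index_def)

lemma ksq_res: "m \<in> res \<Longrightarrow> ksq m = 2 * pi\<^sup>2"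
  by (auto simp: res_def ksq_eq)

lemma ksq_zero: "ksq 0 = 2 * pi\<^sup>2"
  by (rule ksq_res) (simp add: res_def zero_prod_def)

lemma pi_sq_ge: "9 \<le> pi\<^sup>2"
  using power_mono[of 3 pi 2] pi_gt3 by simp

text \<open>Each factor \<open>1 + \<bar>a\<bar>\<close> is at most twice the odd number's modulus,
  the product of two moduli is at most half their sum of squares, and \<open>pi\<^sup>2\<close>
  exceeds 4. Linear growth in \<open>wt\<close> is what makes each division gain a power of
  decay.\<close>

lemma ksq_ge_wt: "2 * wt m \<le> ksq m"
proof -
  have 1: "1 + real_of_int \<bar>a\<bar> \<le> 2 * \<bar>2 * real_of_int a + 1\<bar>" for a
  proof -
    have "1 + \<bar>a\<bar> \<le> 2 * \<bar>2 * a + 1\<bar>" by presburger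
    then have "real_of_int (1 + \<bar>a\<bar>) \<le> real_of_int (2 * \<bar>2 * a + 1\<bar>)" by (simp only: of_int_le_iff)
    then show ?thesis by simp
  qed
  let ?A = "\<bar>2 * real_of_int (fst m) + 1\<bar>" and ?B = "\<bar>2 * real_of_int (snd m) + 1\<bar>"
  have "wt m \<le> (2 * ?A) * (2 * ?B)"
    unfolding wt_def by (intro mult_mono 1) auto
  also have "\<dots> \<le> 2 * (?A\<^sup>2 + ?B\<^sup>2)"
    using zero_le_power2[of "?A - ?B"] by (simp add: power2_diff)
  finally have "2 * wt m \<le> 4 * (?A\<^sup>2 + ?B\<^sup>2)" by simp
  also have "\<dots> \<le> pi\<^sup>2 * (?A\<^sup>2 + ?B\<^sup>2)"
    using pi_sq_ge by (intro mult_right_mono) auto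
  finally show ?thesis by (simp add: ksq_eq)
qed

text \<open>Squares of odd integers are 1 or at least 9; off \<open>res\<close> one of the two is at
  least 9, whence 1 + 9.\<close>

lemma ksq_nonres:
  assumes "m \<notin> res"
  shows "10 * pi\<^sup>2 \<le> ksq m"
proof -
  have 1: "(2 * of_int a + 1)\<^sup>2 \<ge> (1::real)" for a
  proof -
    have "1 \<le> \<bar>2 * a + 1\<bar>" by presburger
    then have "1 \<le> \<bar>real_of_int (2 * a + 1)\<bar>" by linarith
    from power_mono[OF this, of 2] show ?thesis by simp
  qed
  have 9: "(2 * of_int a + 1)\<^sup>2 \<ge> (9::real)" if "a \<noteq> 0" "a \<noteq> -1" for a
  proof -
    have "3 \<le> \<bar>2 * a + 1\<bar>" using that by presburger
    then have "3 \<le> \<bar>real_of_int (2 * a + 1)\<bar>" by linarith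
    from power_mono[OF this, of 2] show ?thesis by simp
  qed
  obtain a b where m: "m = (a, b)" by (cases m)
  have "(a \<noteq> 0 \<and> a \<noteq> -1) \<or> (b \<noteq> 0 \<and> b \<noteq> -1)"
    using assms m by (auto simp: res_def)
  then have "10 \<le> (2 * of_int a + 1)\<^sup>2 + (2 * of_int b + 1 :: real)\<^sup>2"
    using 1[of a] 1[of b] 9[of a] 9[of b] by linarith
  from mult_left_mono[OF this, of "pi\<^sup>2"] show ?thesis
    by (simp add: ksq_eq m mult.commute)
qed

text \<open>The spectral gap: off resonance \<open>\<mu>\<close> uses up at most half of
  \<open>ksq m\<close>, and the other half already dominates the weight.\<close>

lemma ksq_minus_ge_wt:
  assumes "m \<notin> res" "\<bar>\<mu> - 2 * pi\<^sup>2\<bar> \<le> 1"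
  shows "wt m \<le> ksq m - \<mu>"
proof -
  have "\<mu> \<le> 2 * pi\<^sup>2 + 1" using assms(2) by linarith
  also have "\<dots> \<le> 5 * pi\<^sup>2" using pi_sq_ge by linarith
  also have "\<dots> \<le> ksq m / 2" using ksq_nonres[OF assms(1)] by linarith
  finally show ?thesis using ksq_ge_wt[of m] by linarith
qed

text \<open>The unperturbed eigenvector of the sector, normalised at index 0. The powers are those
  of the inverse of \<sigma> along the rotation orbit, rewritten with exponent four equal to
  one.\<close>

definition c0 :: "complex \<Rightarrow> int \<times> int \<Rightarrow> complex" where
  "c0 \<sigma> m = (if m = (0,0) then 1 else if m = (0,-1) then \<sigma>^3 else if m = (-1,-1) then \<sigma>^2
     else if m = (-1,0) then \<sigma> else 0)"

text \<open>The coefficient form of the rotation symmetry with factor \<sigma>: rotating the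
  argument replaces \<open>ew m\<close> by \<open>ew (rot_index m)\<close>, see
  \<open>pser_rot\<close>.\<close>

definition sector :: "complex \<Rightarrow> (int \<times> int \<Rightarrow> complex) \<Rightarrow> bool" where
  "sector \<sigma> c \<longleftrightarrow> (\<forall>m. c m = \<sigma> * c (rot_index m))"

lemma sector_res:
  assumes "sector \<sigma> c" "m \<in> res"
  shows "c m = c 0 * c0 \<sigma> m"
proof -
  have *: "c m = \<sigma> * c (rot_index m)" for m using assms(1) unfolding sector_def by blast
  have 1: "c (-1,0) = \<sigma> * c 0" using *[of "(-1,0)"] by (simp add: rot_index_def zero_prod_def)
  have 2: "c (-1,-1) = \<sigma> * c (-1,0)" using *[of "(-1,-1)"] by (simp add: rot_index_def)
  have 3: "c (0,-1) = \<sigma> * c (-1,-1)" using *[of "(0,-1)"] by (simp add: rot_index_def)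
  show ?thesis
    using assms(2) 1 2 3 by (auto simp: res_def c0_def zero_prod_def power2_eq_square power3_eq_cube)
qed

lemma c0_nonres: "m \<notin> res \<Longrightarrow> c0 \<sigma> m = 0"
  by (auto simp: c0_def res_def)

lemma sector_c0:
  assumes "\<sigma>^4 = 1"
  shows "sector \<sigma> (c0 \<sigma>)"
  unfolding sector_def
proof
  fix m
  have p: "\<sigma> * \<sigma>^3 = 1" "\<sigma> * \<sigma>^2 = \<sigma>^3" "\<sigma> * \<sigma> = \<sigma>^2"
    using assms by (simp_all add: power2_eq_square power3_eq_cube power4_eq_xxxx mult.assoc)
  consider "m = (0,0)" | "m = (0,-1)" | "m = (-1,-1)" | "m = (-1,0)" | "m \<notin> res"
    unfolding res_def by blast
  then show "c0 \<sigma> m = \<sigma> * c0 \<sigma> (rot_index m)"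
  proof cases
    case 5
    then have "c0 \<sigma> m = 0" "c0 \<sigma> (rot_index m) = 0"
      by (simp_all add: c0_nonres rot_index_res)
    then show ?thesis by simp
  qed (simp_all add: rot_index_def c0_def p)
qed

lemma c0_bound: "cmod \<sigma> = 1 \<Longrightarrow> cmod (c0 \<sigma> m) \<le> 1"
  by (simp add: c0_def norm_power)

lemma c0_zero: "c0 \<sigma> 0 = 1"
  by (simp add: c0_def zero_prod_def)

text \<open>The index set is discrete, so the bounded continuous functions on it are all bounded
  sequences.\<close>

lemma int_pair_continuous: "continuous_on UNIV (f :: int \<times> int \<Rightarrow> complex)"
proof -
  have "open {x}" for x :: "int \<times> int"
    using open_Times[of "{fst x}" "{snd x}"] by (simp add: open_discrete)
  then have "open S" for S :: "(int \<times> int) set"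
    using open_UN[of S "\<lambda>x. {x}"] by simp
  then show ?thesis by (simp add: continuous_on_open_vimage)
qed

lemma bcontfun_ex:
  fixes f :: "int \<times> int \<Rightarrow> complex"
  assumes "\<And>m. cmod (f m) \<le> B"
  shows "\<exists>g. apply_bcontfun g = f"
proof -
  have "f \<in> bcontfun" using assms int_pair_continuous by (rule bcontfun_normI[rotated])
  then show ?thesis using Bcontfun_inverse by blast
qed

text \<open>The library proves completeness of \<open>bcontfun\<close> only over a metric domain, and \<open>int\<close> carries no metric.\<close>

lemma closed_imp_complete_bcontfun:
  fixes K :: "((int \<times> int) \<Rightarrow>\<^sub>C complex) set"
  assumes "closed K"
  shows "complete K"
  unfolding complete_def
proof (intro allI impI)
  fix f assume f: "(\<forall>n. f n \<in> K) \<and> Cauchy f"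
  then have "uniformly_Cauchy_on UNIV (\<lambda>n. apply_bcontfun (f n))"
    unfolding Cauchy_def uniformly_Cauchy_on_def by (metis dist_bounded order_le_less_trans)
  then obtain l where "uniform_limit UNIV (\<lambda>n. apply_bcontfun (f n)) l sequentially"
    using Cauchy_uniformly_convergent uniformly_convergent_on_def by blast
  from uniform_limit_bcontfunE[OF this sequentially_bot] obtain l' where "f \<longlonglongrightarrow> l'" by metis
  then show "\<exists>l\<in>K. f \<longlonglongrightarrow> l"
    using f closed_sequentially[OF assms] by blast
qed

section \<open>The fixed-point problem and its solution\<close>

context admissible_potential
begin

definition mu :: "real \<Rightarrow> (int \<times> int \<Rightarrow> complex) \<Rightarrow> real" where
  "mu \<epsilon> c = 2 * pi\<^sup>2 + \<epsilon> * Re (conv c 0)"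

text \<open>Fixed points solve the nonresonant equations, with \<open>\<mu>\<close> eliminated by means of the real part of the
  resonant one. The imaginary part is recovered in \<open>sol_conv_real\<close> from the fact that
  \<open>\<integral> V \<bar>f\<bar>\<^sup>2\<close> is real.\<close>

definition step :: "real \<Rightarrow> (int \<times> int \<Rightarrow> complex) \<Rightarrow> int \<times> int \<Rightarrow> complex" where
  "step \<epsilon> c m = (if m \<in> res then c m
     else - complex_of_real \<epsilon> * conv c m / complex_of_real (ksq m - mu \<epsilon> c))"

text \<open>Under the normalisation the resonant entries are powers of \<sigma>, so for unimodular
  \<sigma> the bound 1 is the smallest possible; the same bound makes solutions automatically
  elements of the complete space.\<close>

definition is_sol :: "real \<Rightarrow> complex \<Rightarrow> (int \<times> int \<Rightarrow> complex) \<Rightarrow> bool" where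
  "is_sol \<epsilon> \<sigma> c \<longleftrightarrow> (\<forall>m. cmod (c m) \<le> 1) \<and> c 0 = 1 \<and> sector \<sigma> c \<and> (\<forall>m. step \<epsilon> c m = c m)"

lemma mu_bound:
  assumes "\<And>m. cmod (c m) \<le> 1"
  shows "\<bar>mu \<epsilon> c - 2 * pi\<^sup>2\<bar> \<le> \<bar>\<epsilon>\<bar> * Vsum"
proof -
  have "\<bar>Re (conv c 0)\<bar> \<le> Vsum * 1"
    using conv_bound[of c 1 0] assms abs_Re_le_cmod order_trans by blast
  then show ?thesis by (simp add: mu_def abs_mult mult_left_mono)
qed

lemma conv_sector:
  assumes "sector \<sigma> c"
  shows "sector \<sigma> (conv c)"
  unfolding sector_def
proof
  fix m
  have "c = (\<lambda>m. \<sigma> * c (rot_index m))"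
    using assms unfolding sector_def by (intro ext) blast
  then have "conv c m = conv (\<lambda>m. \<sigma> * c (rot_index m)) m"
    by (rule arg_cong[of _ _ "\<lambda>c. conv c m"])
  also have "\<dots> = \<sigma> * conv c (rot_index m)"
    by (simp add: conv_cmult conv_rot)
  finally show "conv c m = \<sigma> * conv c (rot_index m)" .
qed

lemma step_sector:
  assumes "sector \<sigma> c"
  shows "sector \<sigma> (step \<epsilon> c)"
  unfolding sector_def
proof
  fix m
  have "conv c m = \<sigma> * conv c (rot_index m)" "c m = \<sigma> * c (rot_index m)"
    using assms conv_sector[OF assms] unfolding sector_def by blast+
  then show "step \<epsilon> c m = \<sigma> * step \<epsilon> c (rot_index m)"
    by (simp add: step_def rot_index_res ksq_rot)
qed

lemma step_zero: "step \<epsilon> c 0 = c 0"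
  by (simp add: step_def res_def zero_prod_def)

context
  fixes \<epsilon> :: real
  assumes small: "\<bar>\<epsilon>\<bar> * Vsum \<le> 1/4"
begin

lemma mu_near:
  assumes "\<And>m. cmod (c m) \<le> 1"
  shows "\<bar>mu \<epsilon> c - 2 * pi\<^sup>2\<bar> \<le> 1/4"
  using mu_bound[of c \<epsilon>, OF assms] small by linarith

lemma step_nonres_bound:
  assumes "\<And>m. cmod (c m) \<le> B" "m \<notin> res" "\<bar>\<mu> - 2 * pi\<^sup>2\<bar> \<le> 1"
  shows "cmod (complex_of_real \<epsilon> * conv c m / complex_of_real (ksq m - \<mu>)) \<le> \<bar>\<epsilon>\<bar> * Vsum * B / wt m"
proof -
  have p: "wt m \<le> ksq m - \<mu>" by (rule ksq_minus_ge_wt[OF assms(2,3)])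
  have B: "0 \<le> B" using assms(1)[of 0] norm_ge_zero order_trans by blast
  have "cmod (complex_of_real \<epsilon> * conv c m / complex_of_real (ksq m - \<mu>)) = \<bar>\<epsilon>\<bar> * cmod (conv c m) / (ksq m - \<mu>)"
    using p wt_pos(1)[of m] by (simp only: norm_divide norm_mult norm_of_real)
  also have "\<dots> \<le> \<bar>\<epsilon>\<bar> * (Vsum * B) / wt m"
    using p wt_pos(1)[of m] Vsum_nonneg B by (intro frac_le mult_left_mono conv_bound assms(1)) auto
  finally show ?thesis by (simp add: mult.assoc)
qed

lemma step_bound:
  assumes "\<And>m. cmod (c m) \<le> 1"
  shows "cmod (step \<epsilon> c m) \<le> 1"
proof (cases "m \<in> res")
  case False
  have "cmod (complex_of_real \<epsilon> * conv c m / complex_of_real (ksq m - mu \<epsilon> c)) \<le> \<bar>\<epsilon>\<bar> * Vsum * 1 / wt m"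
    by (rule step_nonres_bound[OF assms False]) (use mu_near[of c, OF assms] in linarith)
  also have "\<dots> \<le> 1"
    using small wt_ge_1[of m] by (simp add: pos_divide_le_eq)
  finally show ?thesis using False by (simp add: step_def norm_divide norm_mult)
qed (use assms in \<open>simp add: step_def\<close>)

text \<open>The difference of quotients is split into a change of numerator and a change of
  denominator, the latter entering through \<open>mu\<close>; both denominators are at least 1. With
  q = \<open>\<bar>\<epsilon>\<bar> * Vsum\<close> the constant is q + q^2, at most 5/16 for q up to
  1/4.\<close>

lemma step_lipschitz:
  assumes c: "\<And>m. cmod (c m) \<le> 1" and c': "\<And>m. cmod (c' m) \<le> 1"
    and D: "\<And>m. cmod (c m - c' m) \<le> D" and eq: "\<And>m. m \<in> res \<Longrightarrow> c m = c' m"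
  shows "cmod (step \<epsilon> c m - step \<epsilon> c' m) \<le> D / 2"
proof (cases "m \<in> res")
  case True
  then show ?thesis using D[of m] eq by (simp add: step_def) 
next
  case False
  define x where "x = conv c m"
  define x' where "x' = conv c' m"
  define p where "p = ksq m - mu \<epsilon> c"
  define p' where "p' = ksq m - mu \<epsilon> c'"
  have D0: "0 \<le> D" using D[of 0] norm_ge_zero order_trans by blast
  have "\<bar>mu \<epsilon> c - 2 * pi\<^sup>2\<bar> \<le> 1" "\<bar>mu \<epsilon> c' - 2 * pi\<^sup>2\<bar> \<le> 1"
    using mu_near[of c, OF c] mu_near[of c', OF c'] by linarith+
  then have p1: "1 \<le> p" "1 \<le> p'"
    using ksq_minus_ge_wt[OF False] wt_ge_1[of m] unfolding p_def p'_def by (meson order_trans)+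
  have cd: "cmod (conv c n - conv c' n) \<le> Vsum * D" for n
    using conv_bound[of "\<lambda>m. c m - c' m" D n] D conv_diff[of c 1 c' 1 n] c c' by simp
  have xx: "cmod (x - x') \<le> Vsum * D" unfolding x_def x'_def by (rule cd)
  have x': "cmod x' \<le> Vsum" unfolding x'_def using conv_bound[of c' 1 m] c' by simp
  have "p' - p = \<epsilon> * Re (conv c 0 - conv c' 0)"
    by (simp add: p_def p'_def mu_def algebra_simps)
  then have pp: "\<bar>p' - p\<bar> \<le> \<bar>\<epsilon>\<bar> * (Vsum * D)"
    using cd[of 0] abs_Re_le_cmod[of "conv c 0 - conv c' 0"] by (simp add: abs_mult mult_left_mono)
  have e: "x / of_real p - x' / of_real p' = (x - x') / of_real p + x' * of_real (p' - p) / of_real (p * p')"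
    using p1 by (simp add: field_simps)
  have "cmod (x / of_real p - x' / of_real p') \<le> cmod ((x - x') / of_real p) + cmod (x' * of_real (p' - p) / of_real (p * p'))"
    unfolding e by (rule norm_triangle_ineq)
  also have "cmod ((x - x') / of_real p) \<le> Vsum * D"
  proof -
    have "cmod (x - x') / p \<le> cmod (x - x') / 1" using p1 by (intro divide_left_mono) auto
    then show ?thesis using xx p1 by (simp add: norm_divide)
  qed
  also have "cmod (x' * of_real (p' - p) / of_real (p * p')) \<le> Vsum * (\<bar>\<epsilon>\<bar> * (Vsum * D))"
  proof -
    have pp1: "1 \<le> p * p'" using mult_mono[of 1 p 1 p'] p1 by simp
    have "cmod (x' * of_real (p' - p) / of_real (p * p')) = cmod x' * \<bar>p' - p\<bar> / (p * p')"
      using p1 by (simp only: norm_divide norm_mult norm_of_real) (simp add: abs_mult)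
    also have "\<dots> \<le> cmod x' * \<bar>p' - p\<bar> / 1"
      using pp1 by (intro divide_left_mono) auto
    also have "\<dots> \<le> Vsum * (\<bar>\<epsilon>\<bar> * (Vsum * D))"
      using x' pp Vsum_nonneg by (simp add: mult_mono)
    finally show ?thesis .
  qed
  finally have "\<bar>\<epsilon>\<bar> * cmod (x / of_real p - x' / of_real p') \<le> \<bar>\<epsilon>\<bar> * (Vsum * D + Vsum * (\<bar>\<epsilon>\<bar> * (Vsum * D)))"
    by (intro mult_left_mono) auto
  also have "\<dots> = (\<bar>\<epsilon>\<bar> * Vsum + (\<bar>\<epsilon>\<bar> * Vsum) * (\<bar>\<epsilon>\<bar> * Vsum)) * D"
    by (simp add: algebra_simps)
  also have "\<dots> \<le> (1/4 + 1/4 * (1/4)) * D"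
    using small Vsum_nonneg D0 by (intro mult_right_mono add_mono mult_mono) auto
  also have "\<dots> \<le> D / 2" using D0 by simp
  finally have *: "\<bar>\<epsilon>\<bar> * cmod (x / of_real p - x' / of_real p') \<le> D / 2" .
  have "step \<epsilon> c m - step \<epsilon> c' m = of_real \<epsilon> * - (x / of_real p - x' / of_real p')"
    using False by (simp add: step_def x_def x'_def p_def p'_def algebra_simps)
  then show ?thesis using * by (simp only: norm_mult norm_of_real norm_minus_cancel)
qed

text \<open>Banach's theorem on the closed set \<open>K\<close>, nonempty because it contains
  \<open>c0\<close>. Any sequence satisfying \<open>is_sol\<close> is bounded by 1 and so comes from
  an element of \<open>K\<close>, which transfers uniqueness to plain functions.\<close>

lemma ex1_sol:
  assumes \<sigma>: "cmod \<sigma> = 1" "\<sigma>^4 = 1"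
  shows "\<exists>!c. is_sol \<epsilon> \<sigma> c"
proof -
  define K where "K = {c :: (int \<times> int) \<Rightarrow>\<^sub>C complex. (\<forall>m. cmod (c m) \<le> 1) \<and> c 0 = 1 \<and> sector \<sigma> c}"
  define F where "F c = Bcontfun (step \<epsilon> (apply_bcontfun c))" for c :: "(int \<times> int) \<Rightarrow>\<^sub>C complex"
  have F: "apply_bcontfun (F c) = step \<epsilon> c" if "c \<in> K" for c
  proof -
    have "step \<epsilon> c \<in> bcontfun"
      by (rule bcontfun_normI[OF int_pair_continuous, of _ 1]) (use that in \<open>auto simp: K_def intro!: step_bound\<close>)
    then show ?thesis unfolding F_def by (rule Bcontfun_inverse)
  qed
  have cont: "continuous_on UNIV (\<lambda>c :: (int \<times> int) \<Rightarrow>\<^sub>C complex. c m)" for m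
  proof (rule continuous_onI)
    fix c :: "(int \<times> int) \<Rightarrow>\<^sub>C complex" and e :: real
    assume "e > 0"
    then show "\<exists>d>0. \<forall>c'\<in>UNIV. dist c' c < d \<longrightarrow> dist (c' m) (c m) \<le> e"
      by (intro exI[of _ e] conjI ballI impI order_trans[OF dist_bounded less_imp_le])
  qed
  have "closed K"
    unfolding K_def sector_def
    by (intro closed_Collect_conj closed_Collect_all closed_Collect_le closed_Collect_eq continuous_intros cont)
  then have comp: "complete K" by (rule closed_imp_complete_bcontfun)
  obtain g where "apply_bcontfun g = c0 \<sigma>"
    using bcontfun_ex c0_bound[OF \<sigma>(1)] by blast
  then have "g \<in> K"
    using c0_bound[OF \<sigma>(1)] sector_c0[OF \<sigma>(2)] c0_zero by (simp add: K_def)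
  then have ne: "K \<noteq> {}" by blast
  have FK: "F ` K \<subseteq> K"
    using F by (auto simp: K_def step_zero intro!: step_bound step_sector)
  have lip: "dist (F c) (F c') \<le> 1/2 * dist c c'" if "c \<in> K" "c' \<in> K" for c c'
  proof (rule dist_bound)
    fix m
    have "cmod (step \<epsilon> c m - step \<epsilon> c' m) \<le> dist c c' / 2"
    proof (rule step_lipschitz)
      show "cmod (c m - c' m) \<le> dist c c'" for m
        using dist_bounded[of c m c'] by (simp add: dist_norm)
      \<comment> \<open>\<open>step\<close> leaves resonant entries untouched and could not contract
        there; within \<open>K\<close> they are prescribed by the sector and the value at 0.\<close>
      show "c m = c' m" if "m \<in> res" for m
        using sector_res[OF _ that, of \<sigma> c] sector_res[OF _ that, of \<sigma> c'] \<open>c \<in> K\<close> \<open>c' \<in> K\<close>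
        by (simp add: K_def)
    qed (use that in \<open>auto simp: K_def\<close>)
    then show "dist (F c m) (F c' m) \<le> 1/2 * dist c c'"
      using F that by (simp add: dist_norm)
  qed
  have ex1: "\<exists>!c. c \<in> K \<and> F c = c"
    using Banach_fix[OF comp ne, of "1/2" F] FK lip by auto
  have iff: "is_sol \<epsilon> \<sigma> c \<longleftrightarrow> c \<in> K \<and> F c = c" for c :: "(int \<times> int) \<Rightarrow>\<^sub>C complex"
  proof -
    have "F c = c \<longleftrightarrow> (\<forall>m. step \<epsilon> c m = c m)" if "c \<in> K"
      using F[OF that] by (metis bcontfun_eqI)
    then show ?thesis by (auto simp: is_sol_def K_def)
  qed
  from ex1 obtain c where c: "c \<in> K \<and> F c = c" "\<And>c'. c' \<in> K \<and> F c' = c' \<Longrightarrow> c' = c" by blast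
  show ?thesis
  proof (rule ex1I)
    show "is_sol \<epsilon> \<sigma> c" using c(1) iff by blast
    fix d assume d: "is_sol \<epsilon> \<sigma> d"
    then obtain g where g: "apply_bcontfun g = d"
      using bcontfun_ex[of d 1] by (auto simp: is_sol_def)
    then have "g = c" using c(2) d iff by metis
    then show "d = apply_bcontfun c" using g by simp
  qed
qed

text \<open>Each use of the equation gains one power of the weight.\<close>

lemma sol_decay:
  assumes "is_sol \<epsilon> \<sigma> c"
  shows "\<exists>C. \<forall>m. cmod (c m) * wt m ^ s \<le> C"
proof (induction s)
  case 0
  show ?case using assms by (auto simp: is_sol_def)
next
  case (Suc s)
  then obtain C where C: "\<And>m. cmod (c m) * wt m ^ s \<le> C" by blast
  obtain C' where C': "\<And>m. cmod (conv c m) * wt m ^ s \<le> C'" using conv_decay[OF C] by blast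
  have b: "\<And>m. cmod (c m) \<le> 1" using assms by (simp add: is_sol_def)
  have mu1: "\<bar>mu \<epsilon> c - 2 * pi\<^sup>2\<bar> \<le> 1" using mu_near[of c, OF b] by linarith
  \<comment> \<open>On \<open>res\<close> the equation gives no gain, but there the weight is at
    most 4, the value at \<open>(-1,-1)\<close>.\<close>
  have "cmod (c m) * wt m ^ Suc s \<le> max (4 ^ Suc s) (\<bar>\<epsilon>\<bar> * C')" for m
  proof (cases "m \<in> res")
    case True
    then have "wt m \<le> 4" by (auto simp: res_def wt_def)
    then have "cmod (c m) * wt m ^ Suc s \<le> 1 * 4 ^ Suc s"
      by (intro mult_mono b power_mono) auto
    then show ?thesis by simp
  next
    case False
    have p: "wt m \<le> ksq m - mu \<epsilon> c" by (rule ksq_minus_ge_wt[OF False mu1])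
    have "c m = - complex_of_real \<epsilon> * conv c m / complex_of_real (ksq m - mu \<epsilon> c)"
      using assms False unfolding is_sol_def step_def by metis
    then have "cmod (c m) = \<bar>\<epsilon>\<bar> * cmod (conv c m) / (ksq m - mu \<epsilon> c)"
      using p wt_pos(1)[of m] by (simp only: norm_divide norm_mult norm_of_real norm_minus_cancel)
    also have "\<dots> \<le> \<bar>\<epsilon>\<bar> * cmod (conv c m) / wt m"
    proof (intro divide_left_mono p mult_pos_pos)
      show "0 < ksq m - mu \<epsilon> c" using p wt_pos(1)[of m] by linarith
    qed auto
    finally have "cmod (c m) * wt m ^ Suc s \<le> \<bar>\<epsilon>\<bar> * cmod (conv c m) / wt m * wt m ^ Suc s"
      by (intro mult_right_mono) auto
    also have "\<dots> = \<bar>\<epsilon>\<bar> * (cmod (conv c m) * wt m ^ s)" by simp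
    also have "\<dots> \<le> \<bar>\<epsilon>\<bar> * C'" by (intro mult_left_mono C') auto
    finally show ?thesis by simp
  qed
  then show ?case by blast
qed

lemma sol_summable:
  assumes "is_sol \<epsilon> \<sigma> c"
  shows "(\<lambda>m. cmod (c m)) summable_on UNIV"
proof -
  obtain C where C: "\<And>m. cmod (c m) * wt m ^ 2 \<le> C" using sol_decay[OF assms] by blast
  from summable_wt_decay[of "\<lambda>m. cmod (c m)" C] C show ?thesis by simp
qed

text \<open>The sum of \<open>c m * cnj (conv c m)\<close> is the integral of V times the squared
  modulus of the series, hence real. Nonresonant terms are real by the equation, and the four
  resonant terms are equal by rotation invariance, so four times the imaginary part at 0
  vanishes.\<close>

lemma sol_conv_real:
  assumes sol: "is_sol \<epsilon> \<sigma> c" and \<sigma>: "cmod \<sigma> = 1"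
  shows "\<epsilon> * Im (conv c 0) = 0"
proof -
  have s: "(\<lambda>m. cmod (c m)) summable_on UNIV" by (rule sol_summable[OF sol])
  have sec: "sector \<sigma> c" and c1: "c 0 = 1" and b: "\<And>m. cmod (c m) \<le> 1"
    using sol by (auto simp: is_sol_def)
  have F: "pser c \<in> L2_M" by (rule pser_L2_M[OF s])
  define w where "w x = Vc x * cnj (pser c x)" for x
  have w: "integrable cell w"
    unfolding w_def by (intro integrable_cell_continuous continuous_intros continuous_Vc continuous_pser s)
  have "(\<integral>x. w x * ew m x \<partial>cell) = cnj (conv c m)" for m
  proof -
    have "conv c m = coef (\<lambda>x. Vc x * pser c x) m"
      using coef_V_mult[OF L2_M_integrable[OF F]] coef_pser[OF s] by presburger
    moreover have "w x * ew m x = cnj (cnj (ew m x) * (Vc x * pser c x))" for x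
      by (simp add: w_def mult_ac)
    ultimately show ?thesis by (simp only: coef_def cnj_integral_cell)
  qed
  then have "((\<lambda>m. c m * cnj (conv c m)) has_sum (\<integral>x. w x * pser c x \<partial>cell)) UNIV"
    using pser_integral[OF s w] by simp
  then have 1: "((\<lambda>m. Im (c m * cnj (conv c m))) has_sum Im (\<integral>x. w x * pser c x \<partial>cell)) UNIV"
    by (rule has_sum_Im)
  have "w x * pser c x = complex_of_real (V x * (cmod (pser c x))\<^sup>2)" for x
    unfolding of_real_mult complex_norm_square w_def by (simp add: mult_ac)
  then have "(\<integral>x. w x * pser c x \<partial>cell) = complex_of_real (\<integral>x. V x * (cmod (pser c x))\<^sup>2 \<partial>cell)"
    by (simp only: integral_complex_of_real)
  then have im0: "Im (\<integral>x. w x * pser c x \<partial>cell) = 0" by simp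
  have mm: "c m * cnj (conv c m) = c (rot_index m) * cnj (conv c (rot_index m))" for m
  proof -
    have 1: "c m = \<sigma> * c (rot_index m)" "conv c m = \<sigma> * conv c (rot_index m)"
      using sec conv_sector[OF sec] unfolding sector_def by blast+
    have "c m * cnj (conv c m) = (\<sigma> * cnj \<sigma>) * (c (rot_index m) * cnj (conv c (rot_index m)))"
      unfolding 1 by (simp only: complex_cnj_mult mult_ac)
    then show ?thesis using \<sigma> by (simp flip: complex_norm_square)
  qed
  have r: "Im (c m * cnj (conv c m)) = (if m \<in> res then - Im (conv c 0) else 0)" if "\<epsilon> \<noteq> 0" for m
  proof (cases "m \<in> res")
    case True
    have "c m * cnj (conv c m) = c 0 * cnj (conv c 0)" if "m \<in> res" for m
      using that mm[of "(0,0)"] mm[of "(0,-1)"] mm[of "(-1,-1)"] mm[of "(-1,0)"]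
      by (auto simp: res_def rot_index_def zero_prod_def)
    from this[OF True] show ?thesis using True c1 by simp
  next
    case False
    have "c m = - complex_of_real \<epsilon> * conv c m / complex_of_real (ksq m - mu \<epsilon> c)"
      using sol False unfolding is_sol_def step_def by metis
    then have "c m * cnj (conv c m) = complex_of_real (- \<epsilon> / (ksq m - mu \<epsilon> c)) * (conv c m * cnj (conv c m))"
      by simp
    also have "\<dots> = complex_of_real (- \<epsilon> / (ksq m - mu \<epsilon> c) * (cmod (conv c m))\<^sup>2)"
      by (simp only: of_real_mult complex_norm_square)
    finally show ?thesis using False by (simp only: Im_complex_of_real if_False)
  qed
  show ?thesis
  proof (cases "\<epsilon> = 0")
    case False
    have "((\<lambda>m. if m \<in> res then - Im (conv c 0) else 0) has_sum (\<Sum>m\<in>res. - Im (conv c 0))) UNIV"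
      by (rule has_sum_finite_neutralI[where B = res]) (auto simp: res_def)
    moreover have "((\<lambda>m. if m \<in> res then - Im (conv c 0) else 0) has_sum 0) UNIV"
      using 1 im0 r[OF False] by simp
    ultimately have "(\<Sum>m\<in>res. - Im (conv c 0)) = 0" by (rule has_sum_unique)
    then show ?thesis by (simp add: res_def)
  qed simp
qed

text \<open>At index 0 the real part holds by the choice of \<open>mu\<close> and the imaginary part
  by \<open>sol_conv_real\<close>; rotation carries the equation to the other three resonant
  indices.\<close>

lemma sol_eigen_seq:
  assumes sol: "is_sol \<epsilon> \<sigma> c" and \<sigma>: "cmod \<sigma> = 1"
  shows "eigen_seq \<epsilon> (mu \<epsilon> c) c"
  unfolding eigen_seq_def
proof
  fix m
  let ?e = "\<lambda>m. complex_of_real (ksq m - mu \<epsilon> c) * c m + complex_of_real \<epsilon> * conv c m"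
  have sec: "sector \<sigma> c" and c1: "c 0 = 1" and b: "\<And>m. cmod (c m) \<le> 1"
    using sol by (auto simp: is_sol_def)
  show "?e m = 0"
  proof (cases "m \<in> res")
    case True
    have e0: "?e 0 = 0"
      unfolding ksq_zero mu_def using sol_conv_real[OF assms] c1 by (simp add: complex_eq_iff)
    have er: "?e (rot_index m) = 0" if "?e m = 0" for m
    proof -
      have 1: "c m = \<sigma> * c (rot_index m)" "conv c m = \<sigma> * conv c (rot_index m)"
        using sec conv_sector[OF sec] unfolding sector_def by blast+
      have "?e m = \<sigma> * ?e (rot_index m)"
        unfolding 1 ksq_rot by (simp add: ring_distribs mult_ac)
      moreover have "\<sigma> \<noteq> 0" using \<sigma> by auto
      ultimately show ?thesis using that by simp
    qed
    have "?e (0,0) = 0" using e0 by (simp only: zero_prod_def)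
    moreover from er[OF this] have "?e (0,-1) = 0" unfolding rot_index_def by simp
    moreover from er[OF this] have "?e (-1,-1) = 0" unfolding rot_index_def by simp
    moreover from er[OF this] have "?e (-1,0) = 0" unfolding rot_index_def by simp
    ultimately show ?thesis using True unfolding res_def by blast
  next
    case False
    have p: "wt m \<le> ksq m - mu \<epsilon> c"
      by (rule ksq_minus_ge_wt[OF False]) (use mu_near[of c, OF b] in linarith)
    define P where "P = complex_of_real (ksq m - mu \<epsilon> c)"
    have "ksq m - mu \<epsilon> c \<noteq> 0" using p wt_pos(1)[of m] by linarith
    then have "P \<noteq> 0" unfolding P_def of_real_eq_0_iff .
    moreover have "c m = - complex_of_real \<epsilon> * conv c m / complex_of_real (ksq m - mu \<epsilon> c)"
      using sol False unfolding is_sol_def step_def by metis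
    ultimately have "c m * P = - complex_of_real \<epsilon> * conv c m"
      unfolding P_def[symmetric] by (metis nonzero_eq_divide_eq)
    then show ?thesis unfolding P_def[symmetric] by (simp add: mult.commute)
  qed
qed

text \<open>A maximum principle: off resonance the equation bounds entries by a quarter of the
  supremum \<open>s\<close>, so \<open>s \<le> max t (s / 4)\<close> and the supremum is controlled
  by the resonant entries.\<close>

lemma bounded_solution:
  assumes bd: "\<And>m. cmod (c m) \<le> B" and \<mu>: "\<bar>\<mu> - 2 * pi\<^sup>2\<bar> \<le> 1"
    and eq: "\<And>m. m \<notin> res \<Longrightarrow> complex_of_real (ksq m - \<mu>) * c m + complex_of_real \<epsilon> * conv c m = 0"
    and r: "\<And>m. m \<in> res \<Longrightarrow> cmod (c m) \<le> t" and t: "0 \<le> t"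
  shows "cmod (c m) \<le> t" and "m \<notin> res \<Longrightarrow> c m = - complex_of_real \<epsilon> * conv c m / complex_of_real (ksq m - \<mu>)"
proof -
  show eq': "c m = - complex_of_real \<epsilon> * conv c m / complex_of_real (ksq m - \<mu>)" if "m \<notin> res" for m
  proof -
    have "ksq m - \<mu> \<noteq> 0" using ksq_minus_ge_wt[OF that \<mu>] wt_pos(1)[of m] by linarith
    then have "complex_of_real (ksq m - \<mu>) \<noteq> 0" by (simp only: of_real_eq_0_iff) simp
    moreover have "complex_of_real (ksq m - \<mu>) * c m = - complex_of_real \<epsilon> * conv c m"
      using eq[OF that] by (simp only: add_eq_0_iff2 mult_minus_left)
    ultimately show ?thesis by (metis nonzero_mult_div_cancel_left)
  qed
  define s where "s = (SUP m. cmod (c m))"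
  have bdd: "bdd_above (range (\<lambda>m. cmod (c m)))" using bd by (rule bdd_aboveI2)
  have le_s: "cmod (c m) \<le> s" for m unfolding s_def by (rule cSUP_upper[OF UNIV_I bdd])
  have "cmod (c m) \<le> max t (s / 4)" for m
  proof (cases "m \<in> res")
    case False
    have s0: "0 \<le> s" using le_s[of 0] norm_ge_zero order_trans by blast
    have "cmod (c m) = cmod (complex_of_real \<epsilon> * conv c m / complex_of_real (ksq m - \<mu>))"
      by (subst eq'[OF False]) (simp only: norm_divide norm_mult norm_minus_cancel)
    also have "\<dots> \<le> \<bar>\<epsilon>\<bar> * Vsum * s / wt m"
      by (rule step_nonres_bound[OF le_s False \<mu>])
    also have "\<dots> \<le> \<bar>\<epsilon>\<bar> * Vsum * s / 1"
      using wt_ge_1[of m] s0 Vsum_nonneg by (intro divide_left_mono) auto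
    also have "\<dots> \<le> 1/4 * s" unfolding div_by_1 using small s0 by (intro mult_right_mono) auto
    finally show ?thesis by simp
  next
    case True
    from r[OF True] show ?thesis by simp
  qed
  then have "s \<le> max t (s / 4)" unfolding s_def by (intro cSUP_least) auto
  then have "s \<le> t" using t by linarith
  then show "cmod (c m) \<le> t" using le_s[of m] by linarith
qed

definition sol :: "complex \<Rightarrow> int \<times> int \<Rightarrow> complex" where
  "sol \<sigma> = (THE c. is_sol \<epsilon> \<sigma> c)"

lemma is_sol_sol: "cmod \<sigma> = 1 \<Longrightarrow> \<sigma>^4 = 1 \<Longrightarrow> is_sol \<epsilon> \<sigma> (sol \<sigma>)"
  unfolding sol_def by (rule theI'[OF ex1_sol])

lemma sol_unique: "cmod \<sigma> = 1 \<Longrightarrow> \<sigma>^4 = 1 \<Longrightarrow> is_sol \<epsilon> \<sigma> c \<Longrightarrow> c = sol \<sigma>"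
  using ex1_sol is_sol_sol by blast

text \<open>After division by a nonzero \<open>c 0\<close>, membership in the unit ball, as demanded
  by \<open>is_sol\<close>, comes from \<open>bounded_solution\<close> with bound 1, and the
  equation at index 0 identifies \<mu>. For \<open>c 0 = 0\<close> the same lemma is used with bound
  0.\<close>

lemma eigen_seq_sector:
  assumes \<sigma>: "cmod \<sigma> = 1" "\<sigma>^4 = 1" and bd: "\<And>m. cmod (c m) \<le> B"
    and \<mu>: "\<bar>\<mu> - 2 * pi\<^sup>2\<bar> \<le> 1" and e: "eigen_seq \<epsilon> \<mu> c" and sec: "sector \<sigma> c"
  shows "c m = c 0 * sol \<sigma> m" and "c 0 \<noteq> 0 \<Longrightarrow> \<mu> = mu \<epsilon> (sol \<sigma>)"
proof -
  have eq: "complex_of_real (ksq m - \<mu>) * c m + complex_of_real \<epsilon> * conv c m = 0" for m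
    using e unfolding eigen_seq_def by blast
  have main: "c = (\<lambda>m. c 0 * sol \<sigma> m) \<and> \<mu> = mu \<epsilon> (sol \<sigma>)" if "c 0 \<noteq> 0"
  proof -
    define b where "b m = inverse (c 0) * c m" for m
    have cb: "conv b m = inverse (c 0) * conv c m" for m
      unfolding b_def by (rule conv_cmult)
    have b1: "cmod (b m) \<le> cmod (inverse (c 0)) * B" for m
      unfolding b_def norm_mult by (intro mult_left_mono bd) auto
    have beq: "complex_of_real (ksq m - \<mu>) * b m + complex_of_real \<epsilon> * conv b m = 0" for m
    proof -
      have "complex_of_real (ksq m - \<mu>) * b m + complex_of_real \<epsilon> * conv b m
        = inverse (c 0) * (complex_of_real (ksq m - \<mu>) * c m + complex_of_real \<epsilon> * conv c m)"
        unfolding cb b_def by (simp only: distrib_left mult_ac)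
      then show ?thesis by (simp only: eq mult_zero_right)
    qed
    have bsec: "sector \<sigma> b"
      unfolding sector_def b_def using sec sector_def mult.left_commute by metis
    have b0: "b 0 = 1" using that by (simp add: b_def)
    have br: "cmod (b m) \<le> 1" if "m \<in> res" for m
      using sector_res[OF bsec that] b0 c0_bound[OF \<sigma>(1)] by simp
    have ble: "cmod (b m) \<le> 1" for m
      by (rule bounded_solution(1)[where \<mu> = \<mu>, OF b1 \<mu> beq br]) auto
    have \<mu>b: "\<mu> = mu \<epsilon> b"
    proof -
      have "complex_of_real (2 * pi\<^sup>2 - \<mu>) + complex_of_real \<epsilon> * conv b 0 = 0"
        using beq[of 0] unfolding b0 ksq_zero by simp
      from arg_cong[OF this, of Re] show ?thesis by (simp add: mu_def)
    qed
    have "is_sol \<epsilon> \<sigma> b"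
      unfolding is_sol_def
    proof (intro conjI allI ble b0 bsec)
      fix m
      have "b m = - complex_of_real \<epsilon> * conv b m / complex_of_real (ksq m - \<mu>)" if "m \<notin> res"
        by (rule bounded_solution(2)[where \<mu> = \<mu>, OF b1 \<mu> beq br _ that]) auto
      then show "step \<epsilon> b m = b m" unfolding step_def \<mu>b by metis
    qed
    then have bs: "b = sol \<sigma>" by (rule sol_unique[OF \<sigma>])
    have "c m = c 0 * sol \<sigma> m" for m unfolding bs[symmetric] using that by (simp add: b_def)
    then have "c = (\<lambda>m. c 0 * sol \<sigma> m)" by (rule ext)
    then show ?thesis using \<mu>b[unfolded bs] by (rule conjI)
  qed
  show "c 0 \<noteq> 0 \<Longrightarrow> \<mu> = mu \<epsilon> (sol \<sigma>)" using main by blast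
  show "c m = c 0 * sol \<sigma> m"
  proof (cases "c 0 = 0")
    case True
    have "cmod (c m) \<le> 0"
      by (rule bounded_solution(1)[where \<mu> = \<mu>, OF bd \<mu> eq])
         (use True sector_res[OF sec] in auto)
    then show ?thesis using True by simp
  next
    case False
    then show ?thesis using main by metis
  qed
qed

text \<open>One use of the equation shows that the solution differs from \<open>c0\<close> by at
  most \<open>\<bar>\<epsilon>\<bar> * Vsum\<close>; convolution and the factor \<epsilon> in
  \<open>mu\<close> contribute another such factor.\<close>

lemma mu_expansion:
  assumes \<sigma>: "cmod \<sigma> = 1" "\<sigma>^4 = 1"
  shows "\<bar>mu \<epsilon> (sol \<sigma>) - (2 * pi\<^sup>2 + \<epsilon> * Re (conv (c0 \<sigma>) 0))\<bar> \<le> Vsum\<^sup>2 * \<epsilon>\<^sup>2"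
proof -
  have s: "is_sol \<epsilon> \<sigma> (sol \<sigma>)" by (rule is_sol_sol[OF \<sigma>])
  have b: "\<And>m. cmod (sol \<sigma> m) \<le> 1" and sec: "sector \<sigma> (sol \<sigma>)" and s0: "sol \<sigma> 0 = 1"
    using s by (auto simp: is_sol_def)
  have d: "cmod (sol \<sigma> m - c0 \<sigma> m) \<le> \<bar>\<epsilon>\<bar> * Vsum" for m
  proof (cases "m \<in> res")
    case True
    then show ?thesis using sector_res[OF sec True] s0 Vsum_nonneg by simp
  next
    case False
    have "sol \<sigma> m = - complex_of_real \<epsilon> * conv (sol \<sigma>) m / complex_of_real (ksq m - mu \<epsilon> (sol \<sigma>))"
      using s False unfolding is_sol_def step_def by metis
    then have "cmod (sol \<sigma> m) = cmod (complex_of_real \<epsilon> * conv (sol \<sigma>) m / complex_of_real (ksq m - mu \<epsilon> (sol \<sigma>)))"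
      by (simp only: norm_divide norm_mult norm_minus_cancel)
    also have "\<dots> \<le> \<bar>\<epsilon>\<bar> * Vsum * 1 / wt m"
      by (rule step_nonres_bound[OF b False]) (use mu_near[of "sol \<sigma>", OF b] in linarith)
    also have "\<dots> \<le> \<bar>\<epsilon>\<bar> * Vsum * 1 / 1"
      using wt_ge_1[of m] Vsum_nonneg by (intro divide_left_mono) auto
    finally show ?thesis using c0_nonres[OF False] by simp
  qed
  have "cmod (conv (sol \<sigma>) 0 - conv (c0 \<sigma>) 0) \<le> Vsum * (\<bar>\<epsilon>\<bar> * Vsum)"
    using conv_bound[of "\<lambda>m. sol \<sigma> m - c0 \<sigma> m", OF d, of 0] conv_diff[of "sol \<sigma>" 1 "c0 \<sigma>" 1 0, OF b c0_bound[OF \<sigma>(1)]] by simp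
  then have "\<bar>Re (conv (sol \<sigma>) 0) - Re (conv (c0 \<sigma>) 0)\<bar> \<le> Vsum * (\<bar>\<epsilon>\<bar> * Vsum)"
    using abs_Re_le_cmod[of "conv (sol \<sigma>) 0 - conv (c0 \<sigma>) 0"] by simp
  then have "\<bar>\<epsilon>\<bar> * \<bar>Re (conv (sol \<sigma>) 0) - Re (conv (c0 \<sigma>) 0)\<bar> \<le> \<bar>\<epsilon>\<bar> * (Vsum * (\<bar>\<epsilon>\<bar> * Vsum))"
    by (intro mult_left_mono) auto
  also have "\<dots> = Vsum\<^sup>2 * \<epsilon>\<^sup>2"
    by (simp add: power2_eq_square mult_ac flip: abs_mult)
  finally show ?thesis by (simp add: mu_def algebra_simps flip: abs_mult)
qed

text \<open>\<open>Vh\<close> and \<open>mu\<close> are real, so \<open>step\<close> commutes with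
  conjugation, which therefore maps solutions of one sector to solutions of the conjugate one;
  uniqueness identifies them.\<close>

lemma sol_cnj:
  assumes \<sigma>: "cmod \<sigma> = 1" "\<sigma>^4 = 1"
  shows "sol (cnj \<sigma>) = (\<lambda>m. cnj (sol \<sigma> m))" and "mu \<epsilon> (sol (cnj \<sigma>)) = mu \<epsilon> (sol \<sigma>)"
proof -
  let ?c = "\<lambda>m. cnj (sol \<sigma> m)"
  have s: "is_sol \<epsilon> \<sigma> (sol \<sigma>)" by (rule is_sol_sol[OF \<sigma>])
  have mu: "mu \<epsilon> ?c = mu \<epsilon> (sol \<sigma>)" by (simp add: mu_def conv_cnj)
  have "is_sol \<epsilon> (cnj \<sigma>) ?c"
    unfolding is_sol_def
  proof (intro conjI allI)
    show "cmod (?c m) \<le> 1" for m using s by (simp add: is_sol_def)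
    show "?c 0 = 1" using s by (simp add: is_sol_def)
    show "sector (cnj \<sigma>) ?c" using s unfolding is_sol_def sector_def by (metis complex_cnj_mult)
    fix m
    have "step \<epsilon> (sol \<sigma>) m = sol \<sigma> m" using s by (simp add: is_sol_def)
    moreover have "step \<epsilon> ?c m = cnj (step \<epsilon> (sol \<sigma>) m)"
      by (simp add: step_def mu conv_cnj)
    ultimately show "step \<epsilon> ?c m = ?c m" by simp
  qed
  moreover have "cmod (cnj \<sigma>) = 1" "cnj \<sigma> ^ 4 = 1"
    using \<sigma> by (simp_all flip: complex_cnj_power)
  ultimately show "sol (cnj \<sigma>) = ?c" using sol_unique by metis
  then show "mu \<epsilon> (sol (cnj \<sigma>)) = mu \<epsilon> (sol \<sigma>)" using mu by simp
qed

end

text \<open>Only frequencies whose negatives are resonant contribute; rotation invariance merges the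
  coefficients at (1,0) and (0,1).\<close>

lemma conv_c0: "conv (c0 \<sigma>) 0 = Vh (0,0) + Vh (0,1) * \<sigma>^3 + Vh (1,1) * \<sigma>^2 + Vh (0,1) * \<sigma>"
proof -
  have V10: "Vh (1,0) = Vh (0,1)" using Vh_rk[of "(0,1)"] by (simp add: rk_def)
  let ?R = "{(0,0), (0,1), (1,1), (1,0)} :: (int \<times> int) set"
  have "((\<lambda>k. Vh k * c0 \<sigma> (0 - k)) has_sum (\<Sum>k\<in>?R. Vh k * c0 \<sigma> (0 - k))) UNIV"
  proof (rule has_sum_finite_neutralI[where B = ?R])
    fix k assume "k \<in> UNIV - ?R"
    then have "0 - k \<notin> res"
      by (cases k) (auto simp: res_def zero_prod_def)
    then show "Vh k * c0 \<sigma> (0 - k) = 0" by (simp add: c0_nonres)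
  qed auto
  then have "conv (c0 \<sigma>) 0 = (\<Sum>k\<in>?R. Vh k * c0 \<sigma> (0 - k))"
    unfolding conv_def by (rule infsumI)
  then show ?thesis by (simp add: c0_def V10)
qed

end

subsection \<open>Decomposition into rotation sectors\<close>

definition Sig :: "complex set" where
  "Sig = {1, -1, \<i>, -\<i>}"

lemma Sig_unit: "\<sigma> \<in> Sig \<Longrightarrow> cmod \<sigma> = 1" "\<sigma> \<in> Sig \<Longrightarrow> \<sigma>^4 = 1"
  by (auto simp: Sig_def power4_eq_xxxx)

lemma finite_Sig [simp]: "finite Sig"
  by (simp add: Sig_def)

lemma Sig_distinct: "\<i> \<noteq> - \<i>" "- \<i> \<noteq> \<i>" "\<i> \<noteq> 1" "\<i> \<noteq> -1" "- \<i> \<noteq> 1" "- \<i> \<noteq> -1"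
  "1 \<noteq> \<i>" "-1 \<noteq> \<i>" "1 \<noteq> -\<i>" "-1 \<noteq> -\<i>" "(1::complex) \<noteq> -1" "(-1::complex) \<noteq> 1"
  by (simp_all add: complex_eq_iff)

lemma sum_Sig: "(\<Sum>\<sigma>\<in>Sig. f \<sigma>) = f 1 + f (-1) + f \<i> + f (-\<i>)" for f :: "complex \<Rightarrow> complex"
  unfolding Sig_def using Sig_distinct by simp

lemma rot_index_4: "rot_index (rot_index (rot_index (rot_index m))) = m"
  by (simp add: rot_index_def)

text \<open>The projection onto the sector \<open>\<tau>\<close> along the action \<open>c \<mapsto> c \<circ> rot_index\<close> of the cyclic group of order four.\<close>

definition proj :: "complex \<Rightarrow> (int \<times> int \<Rightarrow> complex) \<Rightarrow> int \<times> int \<Rightarrow> complex" where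
  "proj \<tau> c m = (1/4) * (c m + \<tau> * c (rot_index m) + \<tau>^2 * c (rot_index (rot_index m))
     + \<tau>^3 * c (rot_index (rot_index (rot_index m))))"

lemma sector_proj:
  assumes "\<tau>^4 = 1"
  shows "sector \<tau> (proj \<tau> c)"
  unfolding sector_def
proof
  fix m
  have "\<tau> * \<tau>^3 = 1" using assms by (simp add: power3_eq_cube power4_eq_xxxx mult.assoc)
  then have *: "\<tau> * (\<tau>^3 * c m) = c m" by (simp flip: mult.assoc)
  have "\<tau> * proj \<tau> c (rot_index m) = (1/4) * (\<tau> * c (rot_index m) + \<tau>^2 * c (rot_index (rot_index m))
     + \<tau>^3 * c (rot_index (rot_index (rot_index m))) + \<tau> * (\<tau>^3 * c m))"
    unfolding proj_def rot_index_4 by (simp add: algebra_simps power2_eq_square power3_eq_cube)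
  then show "proj \<tau> c m = \<tau> * proj \<tau> c (rot_index m)"
    unfolding * by (simp add: proj_def algebra_simps)
qed

text \<open>The first, second and third powers each sum to zero over the fourth roots of
  unity.\<close>

lemma sum_proj: "(\<Sum>\<tau>\<in>Sig. proj \<tau> c m) = c m"
  unfolding sum_Sig proj_def distrib_left[symmetric] by (simp add: power2_eq_square power3_eq_cube)

text \<open>Orthogonality of characters: on the sector of \<sigma> rotation multiplies by the
  inverse \<open>\<sigma>^3\<close>, leaving a geometric sum that is 4 or 0.\<close>

lemma proj_sector:
  assumes "sector \<sigma> c" "\<sigma> \<in> Sig" "\<tau> \<in> Sig"
  shows "proj \<tau> c m = (if \<tau> = \<sigma> then c m else 0)"
proof -
  have r: "c (rot_index m) = \<sigma>^3 * c m" for m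
  proof -
    have "\<sigma>^3 * c m = \<sigma>^3 * (\<sigma> * c (rot_index m))"
      using assms(1) unfolding sector_def by metis
    also have "\<dots> = \<sigma>^4 * c (rot_index m)"
      by (simp add: power3_eq_cube power4_eq_xxxx)
    finally show ?thesis using Sig_unit(2)[OF assms(2)] by simp
  qed
  have A: "proj \<tau> c m = (1/4) * (1 + \<tau> * \<sigma>^3 + \<tau>^2 * \<sigma>^3 * \<sigma>^3 + \<tau>^3 * \<sigma>^3 * \<sigma>^3 * \<sigma>^3) * c m"
    unfolding proj_def r by (simp add: algebra_simps)
  have B: "1 + \<tau> * \<sigma>^3 + \<tau>^2 * \<sigma>^3 * \<sigma>^3 + \<tau>^3 * \<sigma>^3 * \<sigma>^3 * \<sigma>^3 = (if \<tau> = \<sigma> then 4 else 0)"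
    using assms(2,3) unfolding Sig_def
    by (elim insertE emptyE) (simp_all add: power2_eq_square power3_eq_cube Sig_distinct)
  show ?thesis unfolding A B by simp
qed

lemma proj_sum:
  "proj \<tau> (\<lambda>m. \<Sum>i\<in>I. a i * c i m) m = (\<Sum>i\<in>I. a i * proj \<tau> (c i) m)"
  unfolding proj_def sum_distrib_left sum.distrib[symmetric] by (intro sum.cong) (auto simp: algebra_simps)

lemma proj_bound:
  assumes "cmod \<tau> = 1" "\<And>m. cmod (c m) \<le> B"
  shows "cmod (proj \<tau> c m) \<le> B"
proof -
  let ?x = "c m" and ?y = "\<tau> * c (rot_index m)" and ?z = "\<tau>^2 * c (rot_index (rot_index m))"
    and ?w = "\<tau>^3 * c (rot_index (rot_index (rot_index m)))"
  have "cmod (?x + ?y + ?z + ?w) \<le> cmod ?x + cmod ?y + cmod ?z + cmod ?w"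
    by (intro norm_triangle_mono order_refl)
  also have "\<dots> \<le> B + B + B + B"
    using assms by (intro add_mono) (auto simp: norm_mult norm_power)
  finally show ?thesis unfolding proj_def by (simp add: norm_mult)
qed

lemma L2_M_zero: "(\<lambda>x. 0) \<in> L2_M"
  by (rule L2_M_continuous) (auto simp: bloch_def)

lemma L2_M_sum:
  assumes "finite I" "\<And>i. i \<in> I \<Longrightarrow> g i \<in> L2_M"
  shows "(\<lambda>x. \<Sum>i\<in>I. g i x) \<in> L2_M \<and> coef (\<lambda>x. \<Sum>i\<in>I. g i x) m = (\<Sum>i\<in>I. coef (g i) m)"
  using assms
proof (induction I rule: finite_induct)
  case empty
  then show ?case by (simp add: L2_M_zero coef_def)
next
  case (insert i I)
  then show ?case
    using L2_M_add[of "g i" "\<lambda>x. \<Sum>i\<in>I. g i x"] coef_add[of "g i" "\<lambda>x. \<Sum>i\<in>I. g i x" m] by simp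
qed

text \<open>Linear maps send negligible sets to negligible sets; the image is enclosed in a Borel
  null set again.\<close>

lemma AE_lborel_rot:
  assumes "AE x in lborel. P (x :: real^2)"
  shows "AE x in lborel. P (transpose R_mat *v x)"
proof -
  obtain N where N: "N \<in> null_sets lborel" "{x. \<not> P x} \<subseteq> N"
    using assms by (auto elim!: AE_E simp: null_sets_def)
  have "N \<in> sets lborel" using N(1) by auto
  then have "N \<in> null_sets lebesgue"
    using N(1) by (subst null_sets_completion_iff) auto
  then have "negligible N" by (simp add: negligible_iff_null_sets)
  then have "negligible ((\<lambda>x. R_mat *v x) ` N)"
    by (intro negligible_differentiable_image_negligible linear_imp_differentiable_on matrix_vector_mul_linear) auto
  then obtain N' where N': "N' \<in> null_sets lborel" "(\<lambda>x. R_mat *v x) ` N \<subseteq> N'"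
    unfolding negligible_iff_null_sets null_sets_completion_iff2 by blast
  have RR: "R_mat *v (transpose R_mat *v x) = x" for x
    unfolding vec_eq_iff forall_2 rot_nth by simp
  have "{x \<in> space lborel. \<not> P (transpose R_mat *v x)} \<subseteq> N'"
  proof
    fix x assume "x \<in> {x \<in> space lborel. \<not> P (transpose R_mat *v x)}"
    then have "transpose R_mat *v x \<in> N" using N(2) by blast
    then have "R_mat *v (transpose R_mat *v x) \<in> N'" using N'(2) by blast
    then show "x \<in> N'" by (simp only: RR)
  qed
  with N'(1) show ?thesis by (rule AE_I')
qed

lemma pser_rot:
  assumes "sector \<sigma> d"
  shows "pser d (transpose R_mat *v x) = \<sigma> * pser d x"
proof -
  have "d m = \<sigma> * d (rot_index m)" for m
    using assms unfolding sector_def by blast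
  then have "d m * ew m (transpose R_mat *v x) = \<sigma> * (d (rot_index m) * ew (rot_index m) x)" for m
    unfolding plane_wave_rot R_mat_M_shift by (metis mult.assoc)
  then have "pser d (transpose R_mat *v x) = (\<Sum>\<^sub>\<infinity>m. \<sigma> * (d (rot_index m) * ew (rot_index m) x))"
    unfolding pser_def by presburger
  also have "\<dots> = \<sigma> * (\<Sum>\<^sub>\<infinity>m. d (rot_index m) * ew (rot_index m) x)"
    by (rule infsum_cmult_right')
  also have "(\<Sum>\<^sub>\<infinity>m. d (rot_index m) * ew (rot_index m) x) = pser d x"
    unfolding pser_def by (rule infsum_reindex_bij_betw[OF bij_rot_index])
  finally show ?thesis .
qed

lemma pser_cnj: "pser (\<lambda>m. cnj (d m)) x = cnj (pser d (- x))"
proof -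
  have "cnj (pser d (- x)) = (\<Sum>\<^sub>\<infinity>m. cnj (d m * ew m (- x)))"
    unfolding pser_def by (rule infsum_cnj[symmetric])
  then show ?thesis by (simp add: pser_def plane_wave_minus_right plane_wave_cnj)
qed

context admissible_potential
begin

text \<open>\<open>conv\<close> commutes with the index rotation; the four summands are collected
  one at a time, with a bound at each stage that keeps the series convergent.\<close>

lemma conv_proj:
  assumes b: "\<And>m. cmod (c m) \<le> B"
  shows "conv (proj \<tau> c) m = proj \<tau> (conv c) m"
proof -
  let ?r = "\<lambda>m. c (rot_index m)" and ?r2 = "\<lambda>m. c (rot_index (rot_index m))"
    and ?r3 = "\<lambda>m. c (rot_index (rot_index (rot_index m)))"
  have b': "cmod (a * c x) \<le> cmod a * B" for a x
    unfolding norm_mult by (intro mult_left_mono b) auto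
  have 1: "conv ?r m = conv c (rot_index m)" for m by (rule conv_rot[symmetric])
  have 2: "conv ?r2 m = conv c (rot_index (rot_index m))" for m
    using conv_rot[of ?r m] conv_rot[of c "rot_index m"] by simp
  have 3: "conv ?r3 m = conv c (rot_index (rot_index (rot_index m)))" for m
    using conv_rot[of ?r2 m] conv_rot[of ?r "rot_index m"] conv_rot[of c "rot_index (rot_index m)"] by simp
  have s1: "conv (\<lambda>m. c m + \<tau> * ?r m) m = conv c m + \<tau> * conv ?r m"
    unfolding conv_cmult[symmetric] by (rule conv_add[where B = B and B' = "cmod \<tau> * B"]) (rule b b')+
  have b1: "cmod (c m + \<tau> * ?r m) \<le> B + cmod \<tau> * B" for m
    by (rule norm_triangle_mono[OF b b'])
  have s2: "conv (\<lambda>m. (c m + \<tau> * ?r m) + \<tau>^2 * ?r2 m) m = conv c m + \<tau> * conv ?r m + \<tau>^2 * conv ?r2 m"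
    unfolding s1[symmetric] unfolding conv_cmult[symmetric]
    by (rule conv_add[where B = "B + cmod \<tau> * B" and B' = "cmod (\<tau>^2) * B"]) (rule b1 b')+
  have b2: "cmod ((c m + \<tau> * ?r m) + \<tau>^2 * ?r2 m) \<le> (B + cmod \<tau> * B) + cmod (\<tau>^2) * B" for m
    by (rule norm_triangle_mono[OF b1 b'])
  have s3: "conv (\<lambda>m. ((c m + \<tau> * ?r m) + \<tau>^2 * ?r2 m) + \<tau>^3 * ?r3 m) m
      = conv c m + \<tau> * conv ?r m + \<tau>^2 * conv ?r2 m + \<tau>^3 * conv ?r3 m"
    unfolding s2[symmetric] unfolding conv_cmult[symmetric]
    by (rule conv_add[where B = "(B + cmod \<tau> * B) + cmod (\<tau>^2) * B" and B' = "cmod (\<tau>^3) * B"]) (rule b2 b')+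
  show ?thesis
    unfolding proj_def[abs_def] conv_cmult s3 1 2 3 ..
qed

lemma eigen_seq_proj:
  assumes b: "\<And>m. cmod (c m) \<le> B" and e: "eigen_seq \<epsilon> \<mu> c"
  shows "eigen_seq \<epsilon> \<mu> (proj \<tau> c)"
  unfolding eigen_seq_def
proof
  fix m
  have eq: "complex_of_real (ksq m - \<mu>) * c m + complex_of_real \<epsilon> * conv c m = 0" for m
    using e unfolding eigen_seq_def by blast
  have "complex_of_real (ksq m - \<mu>) * proj \<tau> c m + complex_of_real \<epsilon> * conv (proj \<tau> c) m
    = proj \<tau> (\<lambda>m. complex_of_real (ksq m - \<mu>) * c m + complex_of_real \<epsilon> * conv c m) m"
    unfolding conv_proj[of c, OF b] unfolding proj_def ksq_rot by (simp only: algebra_simps)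
  also have "\<dots> = 0" unfolding eq by (simp add: proj_def)
  finally show "complex_of_real (ksq m - \<mu>) * proj \<tau> c m + complex_of_real \<epsilon> * conv (proj \<tau> c) m = 0" .
qed

lemma conv_sum:
  assumes "finite I" "\<And>i. i \<in> I \<Longrightarrow> (\<And>m. cmod (c i m) \<le> 1)"
  shows "conv (\<lambda>m. \<Sum>i\<in>I. a i * c i m) m = (\<Sum>i\<in>I. a i * conv (c i) m)"
    and "cmod (\<Sum>i\<in>I. a i * c i m) \<le> (\<Sum>i\<in>I. cmod (a i))"
proof -
  have bd: "cmod (\<Sum>i\<in>J. a i * c i m) \<le> (\<Sum>i\<in>J. cmod (a i))" if "J \<subseteq> I" for J m
  proof (rule order_trans[OF norm_sum], rule sum_mono)
    fix i assume "i \<in> J"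
    then have "cmod (c i m) \<le> 1" using that assms(2) by blast
    then show "cmod (a i * c i m) \<le> cmod (a i)"
      by (simp add: norm_mult mult_left_le)
  qed
  show "cmod (\<Sum>i\<in>I. a i * c i m) \<le> (\<Sum>i\<in>I. cmod (a i))" by (rule bd) simp
  have "conv (\<lambda>m. \<Sum>i\<in>J. a i * c i m) m = (\<Sum>i\<in>J. a i * conv (c i) m)" if "finite J" "J \<subseteq> I" for J
    using that
  proof (induction J rule: finite_induct)
    case empty
    show ?case using conv_cmult[of 0 "\<lambda>_. 0" m] by simp
  next
    case (insert i J)
    have J: "J \<subseteq> I" and i: "{i} \<subseteq> I" using insert.prems by auto
    have "conv (\<lambda>m. a i * c i m + (\<Sum>i\<in>J. a i * c i m)) m = conv (\<lambda>m. a i * c i m) m + conv (\<lambda>m. \<Sum>i\<in>J. a i * c i m) m"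
      by (rule conv_add[where B = "cmod (a i)" and B' = "\<Sum>i\<in>J. cmod (a i)"]) (use bd[OF J] bd[OF i] in auto)
    then show ?case using insert by (simp add: conv_cmult)
  qed
  from this[OF assms(1)] show "conv (\<lambda>m. \<Sum>i\<in>I. a i * c i m) m = (\<Sum>i\<in>I. a i * conv (c i) m)" by simp
qed

section \<open>Eigenspaces described through the four sector solutions\<close>

definition ev :: "real \<Rightarrow> complex \<Rightarrow> real" where
  "ev \<epsilon> \<sigma> = mu \<epsilon> (sol \<epsilon> \<sigma>)"

definition Phi :: "real \<Rightarrow> complex \<Rightarrow> real^2 \<Rightarrow> complex" where
  "Phi \<epsilon> \<sigma> = pser (sol \<epsilon> \<sigma>)"

definition comb :: "real \<Rightarrow> (complex \<Rightarrow> complex) \<Rightarrow> real^2 \<Rightarrow> complex" where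
  "comb \<epsilon> a x = (\<Sum>\<sigma>\<in>Sig. a \<sigma> * Phi \<epsilon> \<sigma> x)"

context
  fixes \<epsilon> :: real
  assumes small: "\<bar>\<epsilon>\<bar> * Vsum \<le> 1/4"
begin

lemma sol_Sig: "\<sigma> \<in> Sig \<Longrightarrow> is_sol \<epsilon> \<sigma> (sol \<epsilon> \<sigma>)"
  by (intro is_sol_sol[OF small] Sig_unit)

lemma sol_Sig_summable: "\<sigma> \<in> Sig \<Longrightarrow> (\<lambda>m. cmod (sol \<epsilon> \<sigma> m)) summable_on UNIV"
  by (rule sol_summable[OF small sol_Sig])

lemma sol_Sig_sector: "\<sigma> \<in> Sig \<Longrightarrow> sector \<sigma> (sol \<epsilon> \<sigma>)"
  using sol_Sig is_sol_def by blast

lemma sol_Sig_0: "\<sigma> \<in> Sig \<Longrightarrow> sol \<epsilon> \<sigma> 0 = 1"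
  using sol_Sig is_sol_def by blast

lemma sol_Sig_bound: "\<sigma> \<in> Sig \<Longrightarrow> cmod (sol \<epsilon> \<sigma> m) \<le> 1"
  using sol_Sig unfolding is_sol_def by blast

lemma ev_near: "\<sigma> \<in> Sig \<Longrightarrow> \<bar>ev \<epsilon> \<sigma> - 2 * pi\<^sup>2\<bar> \<le> 1/4"
  unfolding ev_def using mu_near[OF small, of "sol \<epsilon> \<sigma>"] sol_Sig_bound by blast

lemma Phi_L2_M: "\<sigma> \<in> Sig \<Longrightarrow> Phi \<epsilon> \<sigma> \<in> L2_M"
  unfolding Phi_def by (intro pser_L2_M sol_Sig_summable)

lemma coef_Phi: "\<sigma> \<in> Sig \<Longrightarrow> coef (Phi \<epsilon> \<sigma>) m = sol \<epsilon> \<sigma> m"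
  unfolding Phi_def by (intro coef_pser sol_Sig_summable)

lemma Phi_rot: "\<sigma> \<in> Sig \<Longrightarrow> Phi \<epsilon> \<sigma> (transpose R_mat *v x) = \<sigma> * Phi \<epsilon> \<sigma> x"
  unfolding Phi_def by (intro pser_rot sol_Sig_sector)

lemma comb_L2_M: "comb \<epsilon> a \<in> L2_M"
  and coef_comb: "coef (comb \<epsilon> a) m = (\<Sum>\<sigma>\<in>Sig. a \<sigma> * sol \<epsilon> \<sigma> m)"
proof -
  have "(\<lambda>x. a \<sigma> * Phi \<epsilon> \<sigma> x) \<in> L2_M" if "\<sigma> \<in> Sig" for \<sigma>
    by (intro L2_M_cmult Phi_L2_M that)
  from L2_M_sum[of Sig "\<lambda>\<sigma> x. a \<sigma> * Phi \<epsilon> \<sigma> x", OF finite_Sig this]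
  show "comb \<epsilon> a \<in> L2_M" "coef (comb \<epsilon> a) m = (\<Sum>\<sigma>\<in>Sig. a \<sigma> * sol \<epsilon> \<sigma> m)"
    by (simp_all add: comb_def[abs_def] coef_cmult coef_Phi)
qed

lemma coef_AE_comb:
  assumes "f \<in> L2_M" "AE x in lborel. f x = comb \<epsilon> a x"
  shows "coef f m = (\<Sum>\<sigma>\<in>Sig. a \<sigma> * sol \<epsilon> \<sigma> m)"
  using coef_cong_AE[OF assms(1) comb_L2_M assms(2)] coef_comb by simp

text \<open>Since every sector solution equals 1 at index 0, the projected coefficient there is the
  amplitude itself. This is the linear independence of the four functions.\<close>

lemma comb_extract:
  assumes "f \<in> L2_M" "AE x in lborel. f x = comb \<epsilon> a x" "\<tau> \<in> Sig"
  shows "proj \<tau> (coef f) 0 = a \<tau>"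
proof -
  have "proj \<tau> (coef f) 0 = proj \<tau> (\<lambda>m. \<Sum>\<sigma>\<in>Sig. a \<sigma> * sol \<epsilon> \<sigma> m) 0"
    unfolding proj_def coef_AE_comb[OF assms(1,2)] ..
  also have "\<dots> = (\<Sum>\<sigma>\<in>Sig. if \<tau> = \<sigma> then a \<sigma> else 0)"
    unfolding proj_sum
    by (intro sum.cong refl) (simp add: proj_sector[OF sol_Sig_sector _ assms(3)] sol_Sig_0)
  finally show ?thesis using assms(3) by simp
qed

lemma coef_decomposition:
  assumes b: "\<And>m. cmod (c m) \<le> B" and \<mu>: "\<bar>\<mu> - 2 * pi\<^sup>2\<bar> \<le> 1" and e: "eigen_seq \<epsilon> \<mu> c"
  shows "c m = (\<Sum>\<sigma>\<in>Sig. proj \<sigma> c 0 * sol \<epsilon> \<sigma> m)"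
    and "\<sigma> \<in> Sig \<Longrightarrow> proj \<sigma> c 0 \<noteq> 0 \<Longrightarrow> \<mu> = ev \<epsilon> \<sigma>"
proof -
  have pb: "cmod (proj \<sigma> c m) \<le> B" if "\<sigma> \<in> Sig" for \<sigma> m
    by (rule proj_bound[OF Sig_unit(1)[OF that] b])
  note * = eigen_seq_sector[OF small Sig_unit _ \<mu> eigen_seq_proj[OF b e] sector_proj[OF Sig_unit(2)]]
  have "proj \<sigma> c m = proj \<sigma> c 0 * sol \<epsilon> \<sigma> m" if "\<sigma> \<in> Sig" for \<sigma>
    by (rule *(1)) (rule that pb)+
  then show "c m = (\<Sum>\<sigma>\<in>Sig. proj \<sigma> c 0 * sol \<epsilon> \<sigma> m)"
    using sum_proj[of c m] by simp
  show "\<mu> = ev \<epsilon> \<sigma>" if "\<sigma> \<in> Sig" "proj \<sigma> c 0 \<noteq> 0"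
    unfolding ev_def by (rule *(2)) (rule that pb)+
qed

text \<open>\<open>f\<close> and the combination have the same absolutely summable coefficients, so
  both agree almost everywhere with the same series. An amplitude can be nonzero only in a sector
  whose eigenvalue is \<mu>.\<close>

lemma eigenspace_comb:
  assumes f: "f \<in> eigenspace V \<epsilon> \<mu>" and \<mu>: "\<bar>\<mu> - 2 * pi\<^sup>2\<bar> \<le> 1"
  shows "AE x in lborel. f x = comb \<epsilon> (\<lambda>\<sigma>. proj \<sigma> (coef f) 0) x"
    and "\<sigma> \<in> Sig \<Longrightarrow> proj \<sigma> (coef f) 0 \<noteq> 0 \<Longrightarrow> \<mu> = ev \<epsilon> \<sigma>"
proof -
  have fL: "f \<in> L2_M" by (rule eigenspace_L2_M[OF f])
  have b: "cmod (coef f m) \<le> (\<integral>x. cmod (f x) \<partial>cell)" for m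
    by (rule coef_bound[OF L2_M_integrable[OF fL]])
  have e: "eigen_seq \<epsilon> \<mu> (coef f)" by (rule eigenspace_coef[OF f])
  show "\<sigma> \<in> Sig \<Longrightarrow> proj \<sigma> (coef f) 0 \<noteq> 0 \<Longrightarrow> \<mu> = ev \<epsilon> \<sigma>"
    by (rule coef_decomposition(2)[OF b \<mu> e])
  define a where "a \<sigma> = proj \<sigma> (coef f) 0" for \<sigma>
  define d where "d m = (\<Sum>\<sigma>\<in>Sig. a \<sigma> * sol \<epsilon> \<sigma> m)" for m
  have ds: "(\<lambda>m. cmod (d m)) summable_on UNIV"
  proof (rule Infinite_Sum.abs_summable_on_comparison_test')
    show "(\<lambda>m. \<Sum>\<sigma>\<in>Sig. cmod (a \<sigma>) * cmod (sol \<epsilon> \<sigma> m)) summable_on UNIV"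
    proof -
      have "(\<lambda>m. \<Sum>\<sigma>\<in>J. cmod (a \<sigma>) * cmod (sol \<epsilon> \<sigma> m)) summable_on UNIV" if "finite J" "J \<subseteq> Sig" for J
        using that
      proof (induction J rule: finite_induct)
        case (insert \<sigma> J)
        have "(\<lambda>m. cmod (a \<sigma>) * cmod (sol \<epsilon> \<sigma> m)) summable_on UNIV"
          by (rule summable_on_cmult_right[OF sol_Sig_summable]) (use insert in auto)
        then show ?case using insert by (simp add: summable_on_add)
      qed simp
      from this[OF finite_Sig] show ?thesis by simp
    qed
    show "cmod (d m) \<le> (\<Sum>\<sigma>\<in>Sig. cmod (a \<sigma>) * cmod (sol \<epsilon> \<sigma> m))" for m
      unfolding d_def by (rule order_trans[OF norm_sum]) (simp add: norm_mult)
  qed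
  have "coef f m = d m" for m
    unfolding d_def a_def by (rule coef_decomposition(1)[OF b \<mu> e])
  from L2_M_eq_pser[OF fL ds this] have 1: "AE x in lborel. f x = pser d x" .
  have "coef (comb \<epsilon> a) m = d m" for m unfolding d_def by (rule coef_comb)
  from L2_M_eq_pser[OF comb_L2_M ds this] have "AE x in lborel. comb \<epsilon> a x = pser d x" .
  with 1 have "AE x in lborel. f x = comb \<epsilon> a x" by eventually_elim simp
  then show "AE x in lborel. f x = comb \<epsilon> (\<lambda>\<sigma>. proj \<sigma> (coef f) 0) x"
    unfolding a_def .
qed

text \<open>The converse of \<open>eigenspace_comb\<close>, for any representative of the
  combination, as eigenspaces contain all of them.\<close>

lemma comb_eigenspace:
  assumes f: "f \<in> L2_M" and fa: "AE x in lborel. f x = comb \<epsilon> a x"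
    and a: "\<And>\<sigma>. \<sigma> \<in> Sig \<Longrightarrow> a \<sigma> \<noteq> 0 \<Longrightarrow> \<mu> = ev \<epsilon> \<sigma>"
  shows "f \<in> eigenspace V \<epsilon> \<mu>"
proof -
  define d where "d m = (\<Sum>\<sigma>\<in>Sig. a \<sigma> * sol \<epsilon> \<sigma> m)" for m
  have "\<forall>\<sigma>\<in>Sig. \<exists>C. \<forall>m. cmod (sol \<epsilon> \<sigma> m) * wt m ^ 4 \<le> C"
    using sol_decay[OF small sol_Sig] by blast
  then obtain C where C: "\<And>\<sigma> m. \<sigma> \<in> Sig \<Longrightarrow> cmod (sol \<epsilon> \<sigma> m) * wt m ^ 4 \<le> C \<sigma>"
    by metis
  have decay: "cmod (d m) * wt m ^ 4 \<le> (\<Sum>\<sigma>\<in>Sig. cmod (a \<sigma>) * C \<sigma>)" for m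
  proof -
    have "cmod (d m) * wt m ^ 4 \<le> (\<Sum>\<sigma>\<in>Sig. cmod (a \<sigma> * sol \<epsilon> \<sigma> m)) * wt m ^ 4"
      unfolding d_def by (intro mult_right_mono norm_sum) auto
    also have "\<dots> = (\<Sum>\<sigma>\<in>Sig. cmod (a \<sigma>) * (cmod (sol \<epsilon> \<sigma> m) * wt m ^ 4))"
      unfolding sum_distrib_right norm_mult by (simp only: mult.assoc)
    also have "\<dots> \<le> (\<Sum>\<sigma>\<in>Sig. cmod (a \<sigma>) * C \<sigma>)"
      by (intro sum_mono mult_left_mono C) auto
    finally show ?thesis .
  qed
  have "\<bar>cmod (d m)\<bar> * (wt m)\<^sup>2 \<le> (\<Sum>\<sigma>\<in>Sig. cmod (a \<sigma>) * C \<sigma>)" for m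
  proof -
    have "cmod (d m) * (wt m)\<^sup>2 \<le> cmod (d m) * wt m ^ 4"
      by (intro mult_left_mono power_increasing wt_ge_1) auto
    then show ?thesis using decay[of m] by simp
  qed
  from summable_wt_decay[OF this] have ds: "(\<lambda>m. cmod (d m)) summable_on UNIV" by simp
  have "coef f m = d m" for m unfolding d_def by (rule coef_AE_comb[OF f fa])
  from L2_M_eq_pser[OF f ds this] have fd: "AE x in lborel. f x = pser d x" .
  have "eigen_seq \<epsilon> \<mu> d"
    unfolding eigen_seq_def
  proof
    fix m
    have cd: "conv d m = (\<Sum>\<sigma>\<in>Sig. a \<sigma> * conv (sol \<epsilon> \<sigma>) m)"
      unfolding d_def by (rule conv_sum(1)[OF finite_Sig sol_Sig_bound])
    have "complex_of_real (ksq m - \<mu>) * d m + complex_of_real \<epsilon> * conv d m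
      = (\<Sum>\<sigma>\<in>Sig. a \<sigma> * (complex_of_real (ksq m - \<mu>) * sol \<epsilon> \<sigma> m + complex_of_real \<epsilon> * conv (sol \<epsilon> \<sigma>) m))"
      unfolding cd d_def sum_distrib_left distrib_left sum.distrib by (simp only: mult.left_commute)
    also have "\<dots> = (\<Sum>\<sigma>\<in>Sig. 0)"
    proof (rule sum.cong[OF refl])
      fix \<sigma> assume \<sigma>: "\<sigma> \<in> Sig"
      have "complex_of_real (ksq m - ev \<epsilon> \<sigma>) * sol \<epsilon> \<sigma> m + complex_of_real \<epsilon> * conv (sol \<epsilon> \<sigma>) m = 0"
        using sol_eigen_seq[OF small sol_Sig[OF \<sigma>] Sig_unit(1)[OF \<sigma>]] unfolding ev_def eigen_seq_def by blast
      then show "a \<sigma> * (complex_of_real (ksq m - \<mu>) * sol \<epsilon> \<sigma> m + complex_of_real \<epsilon> * conv (sol \<epsilon> \<sigma>) m) = 0"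
        using a[OF \<sigma>] by (cases "a \<sigma> = 0") auto
    qed
    finally show "complex_of_real (ksq m - \<mu>) * d m + complex_of_real \<epsilon> * conv d m = 0" by simp
  qed
  from eigenspaceI[OF decay this f fd] show ?thesis .
qed

lemma sum_list_comb:
  assumes "distinct \<sigma>s" "set \<sigma>s \<subseteq> Sig" "\<And>\<sigma>. \<sigma> \<in> Sig - set \<sigma>s \<Longrightarrow> a \<sigma> = 0"
  shows "(\<Sum>j<length (map (Phi \<epsilon>) \<sigma>s). map a \<sigma>s ! j * (map (Phi \<epsilon>) \<sigma>s ! j) x) = comb \<epsilon> a x"
proof -
  have "(\<Sum>j<length (map (Phi \<epsilon>) \<sigma>s). map a \<sigma>s ! j * (map (Phi \<epsilon>) \<sigma>s ! j) x)
    = (\<Sum>j<length \<sigma>s. a (\<sigma>s ! j) * Phi \<epsilon> (\<sigma>s ! j) x)"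
    by simp
  also have "\<dots> = (\<Sum>\<sigma>\<in>set \<sigma>s. a \<sigma> * Phi \<epsilon> \<sigma> x)"
    by (rule sum.reindex_bij_betw[OF bij_betw_nth[OF assms(1) refl refl], of "\<lambda>\<sigma>. a \<sigma> * Phi \<epsilon> \<sigma> x"])
  also have "\<dots> = comb \<epsilon> a x"
    unfolding comb_def using assms(2,3) by (intro sum.mono_neutral_left) auto
  finally show ?thesis .
qed

text \<open>Common criterion for whole eigenspaces and for their symmetric parts; uniqueness of the
  coefficient list comes from \<open>comb_extract\<close>.\<close>

lemma L2_basis_comb:
  assumes \<sigma>s: "distinct \<sigma>s" "set \<sigma>s \<subseteq> Sig" and E: "E \<subseteq> L2_M"
    and sub: "\<And>\<sigma>. \<sigma> \<in> set \<sigma>s \<Longrightarrow> Phi \<epsilon> \<sigma> \<in> E"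
    and ex: "\<And>f. f \<in> E \<Longrightarrow> \<exists>a. (\<forall>\<sigma>\<in>Sig - set \<sigma>s. a \<sigma> = 0) \<and> (AE x in lborel. f x = comb \<epsilon> a x)"
  shows "L2_basis (map (Phi \<epsilon>) \<sigma>s) E"
  unfolding L2_basis_def
proof (intro conjI ballI)
  show "set (map (Phi \<epsilon>) \<sigma>s) \<subseteq> E" using sub by auto
  fix f assume f: "f \<in> E"
  then have fL: "f \<in> L2_M" using E by blast
  obtain a where a: "\<And>\<sigma>. \<sigma> \<in> Sig - set \<sigma>s \<Longrightarrow> a \<sigma> = 0" "AE x in lborel. f x = comb \<epsilon> a x"
    using ex[OF f] by blast
  have eq: "(\<Sum>j<length (map (Phi \<epsilon>) \<sigma>s). map a \<sigma>s ! j * (map (Phi \<epsilon>) \<sigma>s ! j) x) = comb \<epsilon> a x" for x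
    by (rule sum_list_comb[OF \<sigma>s a(1)])
  show "\<exists>!as. length as = length (map (Phi \<epsilon>) \<sigma>s) \<and>
     (AE x in lborel. f x = (\<Sum>j<length (map (Phi \<epsilon>) \<sigma>s). as ! j * (map (Phi \<epsilon>) \<sigma>s ! j) x))"
  proof (rule ex1I)
    show "length (map a \<sigma>s) = length (map (Phi \<epsilon>) \<sigma>s) \<and>
       (AE x in lborel. f x = (\<Sum>j<length (map (Phi \<epsilon>) \<sigma>s). map a \<sigma>s ! j * (map (Phi \<epsilon>) \<sigma>s ! j) x))"
      unfolding eq using a(2) by simp
    fix as assume as: "length as = length (map (Phi \<epsilon>) \<sigma>s) \<and>
       (AE x in lborel. f x = (\<Sum>j<length (map (Phi \<epsilon>) \<sigma>s). as ! j * (map (Phi \<epsilon>) \<sigma>s ! j) x))"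
    \<comment> \<open>A competing coefficient list is turned into amplitudes on \<open>Sig\<close>,
      extended by 0 off the list, so that \<open>comb_extract\<close> can compare it with
      \<open>a\<close>.\<close>
    define b where "b \<sigma> = (case map_of (zip \<sigma>s as) \<sigma> of Some v \<Rightarrow> v | None \<Rightarrow> 0)" for \<sigma>
    have len: "length \<sigma>s = length as" using as by simp
    have b: "map b \<sigma>s = as"
      using len \<sigma>s(1) by (intro nth_equalityI) (auto simp: b_def map_of_zip_nth)
    have b0: "b \<sigma> = 0" if "\<sigma> \<in> Sig - set \<sigma>s" for \<sigma>
    proof -
      have "map_of (zip \<sigma>s as) \<sigma> = None" using that len by (simp add: map_of_zip_is_None)
      then show ?thesis by (simp add: b_def)
    qed
    have eqb: "(\<Sum>j<length (map (Phi \<epsilon>) \<sigma>s). map b \<sigma>s ! j * (map (Phi \<epsilon>) \<sigma>s ! j) x) = comb \<epsilon> b x" for x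
      by (rule sum_list_comb[OF \<sigma>s b0])
    have "AE x in lborel. f x = comb \<epsilon> b x"
      using as unfolding b[symmetric] eqb by blast
    then have "b \<sigma> = a \<sigma>" if "\<sigma> \<in> Sig" for \<sigma>
      using comb_extract[OF fL _ that] a(2) by metis
    then have "map b \<sigma>s = map a \<sigma>s" using \<sigma>s(2) by auto
    then show "as = map a \<sigma>s" using b by simp
  qed
qed

lemma Phi_comb: "\<sigma> \<in> Sig \<Longrightarrow> c * Phi \<epsilon> \<sigma> x = comb \<epsilon> (\<lambda>\<tau>. if \<tau> = \<sigma> then c else 0) x"
  by (simp add: comb_def if_distrib[of "\<lambda>y. y * _"] cong: if_cong)

lemma multiple_eigenspace:
  assumes "f \<in> L2_M" "AE x in lborel. f x = c * Phi \<epsilon> \<sigma> x" "\<sigma> \<in> Sig" "\<mu> = ev \<epsilon> \<sigma>"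
  shows "f \<in> X V \<epsilon> \<mu> \<sigma>"
proof -
  have "f \<in> eigenspace V \<epsilon> \<mu>"
    by (rule comb_eigenspace[OF assms(1), of "\<lambda>\<tau>. if \<tau> = \<sigma> then c else 0"])
       (use assms in \<open>auto simp: Phi_comb split: if_splits\<close>)
  moreover have "AE x in lborel. f (transpose R_mat *v x) = \<sigma> * f x"
    using assms(2) AE_lborel_rot[OF assms(2)]
  proof eventually_elim
    case (elim x)
    show ?case unfolding elim Phi_rot[OF assms(3)] by (simp only: mult.left_commute)
  qed
  ultimately show ?thesis using assms(1) by (simp add: X_def L2_M_sigma_def)
qed

lemma Phi_X: "\<sigma> \<in> Sig \<Longrightarrow> \<mu> = ev \<epsilon> \<sigma> \<Longrightarrow> Phi \<epsilon> \<sigma> \<in> X V \<epsilon> \<mu> \<sigma>"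
  by (rule multiple_eigenspace[OF Phi_L2_M, of \<sigma> 1]) auto

lemma eigenspace_basis:
  assumes "distinct \<sigma>s" "set \<sigma>s = {\<sigma> \<in> Sig. ev \<epsilon> \<sigma> = \<mu>}" and \<mu>: "\<bar>\<mu> - 2 * pi\<^sup>2\<bar> \<le> 1"
  shows "L2_basis (map (Phi \<epsilon>) \<sigma>s) (eigenspace V \<epsilon> \<mu>)"
proof (rule L2_basis_comb[OF assms(1)])
  show "set \<sigma>s \<subseteq> Sig" using assms(2) by auto
  show "eigenspace V \<epsilon> \<mu> \<subseteq> L2_M" using eigenspace_L2_M by blast
  show "Phi \<epsilon> \<sigma> \<in> eigenspace V \<epsilon> \<mu>" if "\<sigma> \<in> set \<sigma>s" for \<sigma>
    using Phi_X[of \<sigma> \<mu>] that assms(2) by (simp add: X_def)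
  fix f assume f: "f \<in> eigenspace V \<epsilon> \<mu>"
  show "\<exists>a. (\<forall>\<sigma>\<in>Sig - set \<sigma>s. a \<sigma> = 0) \<and> (AE x in lborel. f x = comb \<epsilon> a x)"
    using eigenspace_comb[OF f \<mu>] assms(2) by (intro exI[of _ "\<lambda>\<sigma>. proj \<sigma> (coef f) 0"]) auto
qed

text \<open>Rotation multiplies the amplitude at \<tau> by \<tau>, while the symmetry of
  \<open>f\<close> multiplies it by \<sigma>; extracting amplitudes forces it to vanish when the two
  differ.\<close>

lemma L2_M_sigma_comb:
  assumes f: "f \<in> L2_M_sigma \<sigma>" and fa: "AE x in lborel. f x = comb \<epsilon> a x" and \<tau>: "\<tau> \<in> Sig" "\<tau> \<noteq> \<sigma>"
  shows "a \<tau> = 0"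
proof -
  have fL: "f \<in> L2_M" and fr: "AE x in lborel. f (transpose R_mat *v x) = \<sigma> * f x"
    using f by (auto simp: L2_M_sigma_def)
  have gL: "(\<lambda>x. \<sigma> * f x) \<in> L2_M" by (rule L2_M_cmult[OF fL])
  have 1: "AE x in lborel. \<sigma> * f x = comb \<epsilon> (\<lambda>\<tau>. \<tau> * a \<tau>) x"
    using fr AE_lborel_rot[OF fa]
  proof eventually_elim
    case (elim x)
    have "comb \<epsilon> a (transpose R_mat *v x) = comb \<epsilon> (\<lambda>\<tau>. \<tau> * a \<tau>) x"
      unfolding comb_def by (intro sum.cong refl) (simp only: Phi_rot mult_ac)
    then show ?case using elim by (simp only:)
  qed
  have 2: "AE x in lborel. \<sigma> * f x = comb \<epsilon> (\<lambda>\<tau>. \<sigma> * a \<tau>) x"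
    using fa by eventually_elim (simp add: comb_def sum_distrib_left mult.assoc)
  have "\<tau> * a \<tau> = \<sigma> * a \<tau>"
    by (rule trans[OF comb_extract[OF gL 1 \<tau>(1), symmetric] comb_extract[OF gL 2 \<tau>(1)]])
  then show ?thesis using \<tau>(2) by auto
qed

lemma X_comb:
  assumes f: "f \<in> X V \<epsilon> \<mu> \<sigma>" and \<mu>: "\<bar>\<mu> - 2 * pi\<^sup>2\<bar> \<le> 1"
  shows "\<exists>a. (\<forall>\<tau>\<in>Sig - {\<sigma>}. a \<tau> = 0) \<and> (AE x in lborel. f x = comb \<epsilon> a x)"
proof -
  have fe: "f \<in> eigenspace V \<epsilon> \<mu>" and fs: "f \<in> L2_M_sigma \<sigma>" using f by (auto simp: X_def)
  show ?thesis
    by (rule exI[of _ "\<lambda>\<sigma>. proj \<sigma> (coef f) 0"], intro conjI ballI eigenspace_comb(1)[OF fe \<mu>])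
       (use L2_M_sigma_comb[OF fs eigenspace_comb(1)[OF fe \<mu>]] in simp)
qed

lemma X_basis:
  assumes "\<sigma> \<in> Sig" "\<mu> = ev \<epsilon> \<sigma>"
  shows "L2_basis [Phi \<epsilon> \<sigma>] (X V \<epsilon> \<mu> \<sigma>)"
proof -
  have \<mu>: "\<bar>\<mu> - 2 * pi\<^sup>2\<bar> \<le> 1" using ev_near[OF assms(1)] assms(2) by linarith
  have "L2_basis (map (Phi \<epsilon>) [\<sigma>]) (X V \<epsilon> \<mu> \<sigma>)"
  proof (rule L2_basis_comb)
    show "X V \<epsilon> \<mu> \<sigma> \<subseteq> L2_M" using eigenspace_L2_M by (auto simp: X_def)
    show "\<exists>a. (\<forall>\<tau>\<in>Sig - set [\<sigma>]. a \<tau> = 0) \<and> (AE x in lborel. f x = comb \<epsilon> a x)"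
      if "f \<in> X V \<epsilon> \<mu> \<sigma>" for f
      using X_comb[OF that \<mu>] by simp
  qed (use assms Phi_X in auto)
  then show ?thesis by simp
qed

lemma comb_cong: "(\<And>\<sigma>. \<sigma> \<in> Sig \<Longrightarrow> a \<sigma> = b \<sigma>) \<Longrightarrow> comb \<epsilon> a x = comb \<epsilon> b x"
  by (simp add: comb_def)

lemma eigenspace_direct_sum:
  assumes s: "{\<sigma> \<in> Sig. ev \<epsilon> \<sigma> = \<mu>} = {\<sigma>1, \<sigma>2}" "\<sigma>1 \<noteq> \<sigma>2"
  shows "L2_direct_sum (eigenspace V \<epsilon> \<mu>) (X V \<epsilon> \<mu> \<sigma>1) (X V \<epsilon> \<mu> \<sigma>2)"
proof -
  have s1: "\<sigma>1 \<in> Sig" "\<mu> = ev \<epsilon> \<sigma>1" and s2: "\<sigma>2 \<in> Sig" "\<mu> = ev \<epsilon> \<sigma>2" using s(1) by auto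
  have \<mu>: "\<bar>\<mu> - 2 * pi\<^sup>2\<bar> \<le> 1" using ev_near[OF s1(1)] s1(2) by linarith
  have XE: "f \<in> eigenspace V \<epsilon> \<mu>" if "f \<in> X V \<epsilon> \<mu> \<sigma>" for f \<sigma> using that by (simp add: X_def)
  have A: "\<exists>g h. f = (\<lambda>x. g x + h x) \<and> g \<in> X V \<epsilon> \<mu> \<sigma>1 \<and> h \<in> X V \<epsilon> \<mu> \<sigma>2"
    if f: "f \<in> eigenspace V \<epsilon> \<mu>" for f
  proof -
    define a where "a \<sigma> = proj \<sigma> (coef f) 0" for \<sigma>
    have fL: "f \<in> L2_M" by (rule eigenspace_L2_M[OF f])
    have fa: "AE x in lborel. f x = comb \<epsilon> a x" and a: "\<And>\<sigma>. \<sigma> \<in> Sig \<Longrightarrow> a \<sigma> \<noteq> 0 \<Longrightarrow> \<mu> = ev \<epsilon> \<sigma>"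
      using eigenspace_comb[OF f \<mu>] unfolding a_def by blast+
    have split: "comb \<epsilon> a x = a \<sigma>1 * Phi \<epsilon> \<sigma>1 x + a \<sigma>2 * Phi \<epsilon> \<sigma>2 x" for x
    proof -
      have "comb \<epsilon> a x = (\<Sum>\<sigma>\<in>{\<sigma>1, \<sigma>2}. a \<sigma> * Phi \<epsilon> \<sigma> x)"
        unfolding comb_def using s(1) a by (intro sum.mono_neutral_right) auto
      then show ?thesis using s(2) by simp
    qed
    define g where "g x = a \<sigma>1 * Phi \<epsilon> \<sigma>1 x" for x
    \<comment> \<open>The sum in \<open>L2_direct_sum\<close> is an equality of functions at every
      point. Taking the remainder for \<open>h\<close> lets it absorb the null set on which
      \<open>f\<close> differs from the combination.\<close>
    define h where "h x = f x - g x" for x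
    have gL: "g \<in> L2_M" unfolding g_def by (intro L2_M_cmult Phi_L2_M s1)
    have hL: "h \<in> L2_M" unfolding h_def by (rule L2_M_diff[OF fL gL])
    have "g \<in> X V \<epsilon> \<mu> \<sigma>1"
      by (rule multiple_eigenspace[of g "a \<sigma>1", OF gL _ s1]) (simp add: g_def)
    moreover have "AE x in lborel. h x = a \<sigma>2 * Phi \<epsilon> \<sigma>2 x"
      using fa by eventually_elim (simp add: h_def g_def split)
    then have "h \<in> X V \<epsilon> \<mu> \<sigma>2" by (rule multiple_eigenspace[OF hL _ s2])
    moreover have "f = (\<lambda>x. g x + h x)" by (simp add: h_def)
    ultimately show ?thesis by blast
  qed
  have B: "(\<lambda>x. g x + h x) \<in> eigenspace V \<epsilon> \<mu>" if g: "g \<in> X V \<epsilon> \<mu> \<sigma>1" and h: "h \<in> X V \<epsilon> \<mu> \<sigma>2" for g h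
  proof -
    define a where "a \<sigma> = proj \<sigma> (coef g) 0" for \<sigma>
    define b where "b \<sigma> = proj \<sigma> (coef h) 0" for \<sigma>
    have ga: "AE x in lborel. g x = comb \<epsilon> a x" and a: "\<And>\<sigma>. \<sigma> \<in> Sig \<Longrightarrow> a \<sigma> \<noteq> 0 \<Longrightarrow> \<mu> = ev \<epsilon> \<sigma>"
      using eigenspace_comb[OF XE[OF g] \<mu>] unfolding a_def by blast+
    have hb: "AE x in lborel. h x = comb \<epsilon> b x" and b: "\<And>\<sigma>. \<sigma> \<in> Sig \<Longrightarrow> b \<sigma> \<noteq> 0 \<Longrightarrow> \<mu> = ev \<epsilon> \<sigma>"
      using eigenspace_comb[OF XE[OF h] \<mu>] unfolding b_def by blast+
    show ?thesis
    proof (rule comb_eigenspace)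
      show "(\<lambda>x. g x + h x) \<in> L2_M"
        by (intro L2_M_add eigenspace_L2_M[OF XE[OF g]] eigenspace_L2_M[OF XE[OF h]])
      show "AE x in lborel. g x + h x = comb \<epsilon> (\<lambda>\<sigma>. a \<sigma> + b \<sigma>) x"
        using ga hb by eventually_elim (simp add: comb_def ring_distribs sum.distrib)
      show "\<mu> = ev \<epsilon> \<sigma>" if "\<sigma> \<in> Sig" "a \<sigma> + b \<sigma> \<noteq> 0" for \<sigma>
        using a[OF that(1)] b[OF that(1)] that(2) by fastforce
    qed
  qed
  have C: "AE x in lborel. f x = 0" if "f \<in> X V \<epsilon> \<mu> \<sigma>1 \<inter> X V \<epsilon> \<mu> \<sigma>2" for f
  proof -
    have fe: "f \<in> eigenspace V \<epsilon> \<mu>" and f1: "f \<in> L2_M_sigma \<sigma>1" and f2: "f \<in> L2_M_sigma \<sigma>2"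
      using that by (auto simp: X_def)
    define a where "a \<sigma> = proj \<sigma> (coef f) 0" for \<sigma>
    have fa: "AE x in lborel. f x = comb \<epsilon> a x"
      using eigenspace_comb[OF fe \<mu>] unfolding a_def by blast
    have "a \<sigma> = 0" if "\<sigma> \<in> Sig" for \<sigma>
      using L2_M_sigma_comb[OF f1 fa that] L2_M_sigma_comb[OF f2 fa that] s(2) by blast
    then have "comb \<epsilon> a x = 0" for x by (simp add: comb_def)
    then show ?thesis using fa by simp
  qed
  show ?thesis
    unfolding L2_direct_sum_def using A B C by blast
qed

lemma eigenspace_sigma:
  assumes s: "{\<sigma> \<in> Sig. ev \<epsilon> \<sigma> = \<mu>} = {\<sigma>}"
  shows "eigenspace V \<epsilon> \<mu> \<subseteq> L2_M_sigma \<sigma>"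
proof
  fix f assume f: "f \<in> eigenspace V \<epsilon> \<mu>"
  have s1: "\<sigma> \<in> Sig" "\<mu> = ev \<epsilon> \<sigma>" using s by auto
  have \<mu>: "\<bar>\<mu> - 2 * pi\<^sup>2\<bar> \<le> 1" using ev_near[OF s1(1)] s1(2) by linarith
  define a where "a \<sigma> = proj \<sigma> (coef f) 0" for \<sigma>
  have fa: "AE x in lborel. f x = comb \<epsilon> a x" and a: "\<And>\<sigma>. \<sigma> \<in> Sig \<Longrightarrow> a \<sigma> \<noteq> 0 \<Longrightarrow> \<mu> = ev \<epsilon> \<sigma>"
    using eigenspace_comb[OF f \<mu>] unfolding a_def by blast+
  have "comb \<epsilon> a x = a \<sigma> * Phi \<epsilon> \<sigma> x" for x
    unfolding Phi_comb[OF s1(1)] using a s by (intro comb_cong) auto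
  then have "AE x in lborel. f x = a \<sigma> * Phi \<epsilon> \<sigma> x" using fa by simp
  from multiple_eigenspace[OF eigenspace_L2_M[OF f] this s1] show "f \<in> L2_M_sigma \<sigma>"
    by (simp add: X_def)
qed

text \<open>With no matching sector all amplitudes vanish, and so does the eigenfunction; conversely
  the sector solutions are nonzero because their coefficient at 0 is 1.\<close>

lemma is_eigenvalue_iff:
  assumes \<mu>: "\<bar>\<mu> - 2 * pi\<^sup>2\<bar> < 1"
  shows "is_eigenvalue V \<epsilon> \<mu> \<longleftrightarrow> \<mu> \<in> ev \<epsilon> ` Sig"
proof
  assume "is_eigenvalue V \<epsilon> \<mu>"
  then obtain f where f: "f \<in> eigenspace V \<epsilon> \<mu>" "\<not> (AE x in lborel. f x = 0)"
    by (auto simp: is_eigenvalue_def)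
  have \<mu>': "\<bar>\<mu> - 2 * pi\<^sup>2\<bar> \<le> 1" using \<mu> by simp
  show "\<mu> \<in> ev \<epsilon> ` Sig"
  proof (rule ccontr)
    assume n: "\<mu> \<notin> ev \<epsilon> ` Sig"
    have "comb \<epsilon> (\<lambda>\<sigma>. proj \<sigma> (coef f) 0) x = 0" for x
      unfolding comb_def using eigenspace_comb(2)[OF f(1) \<mu>'] n by (intro sum.neutral) auto
    then show False using eigenspace_comb(1)[OF f(1) \<mu>'] f(2) by simp
  qed
next
  assume "\<mu> \<in> ev \<epsilon> ` Sig"
  then obtain \<sigma> where \<sigma>: "\<sigma> \<in> Sig" "\<mu> = ev \<epsilon> \<sigma>" by blast
  have "\<not> (AE x in lborel. Phi \<epsilon> \<sigma> x = 0)"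
  proof
    assume "AE x in lborel. Phi \<epsilon> \<sigma> x = 0"
    from coef_cong_AE[OF Phi_L2_M[OF \<sigma>(1)] L2_M_zero this, of 0]
    show False using sol_Sig_0[OF \<sigma>(1)] by (simp add: coef_Phi[OF \<sigma>(1)]) (simp add: coef_def)
  qed
  then show "is_eigenvalue V \<epsilon> \<mu>"
    using Phi_X[OF \<sigma>] by (auto simp: is_eigenvalue_def X_def)
qed

lemma ev_cnj: "\<sigma> \<in> Sig \<Longrightarrow> ev \<epsilon> (cnj \<sigma>) = ev \<epsilon> \<sigma>"
  and Phi_cnj: "\<sigma> \<in> Sig \<Longrightarrow> Phi \<epsilon> (cnj \<sigma>) x = cnj (Phi \<epsilon> \<sigma> (- x))"
  using sol_cnj[OF small Sig_unit] by (simp_all add: ev_def Phi_def pser_cnj)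

lemma ev_expansion:
  "\<sigma> \<in> Sig \<Longrightarrow> \<bar>ev \<epsilon> \<sigma> - (2 * pi\<^sup>2 + \<epsilon> * Re (conv (c0 \<sigma>) 0))\<bar> \<le> Vsum\<^sup>2 * \<epsilon>\<^sup>2"
  unfolding ev_def by (intro mu_expansion[OF small] Sig_unit)

end

end

subsection \<open>Expansions over orbit representatives\<close>

definition rot_orbit :: "int \<times> int \<Rightarrow> (int \<times> int) set" where
  "rot_orbit m = {m, rot_index m, rot_index (rot_index m), rot_index (rot_index (rot_index m))}"

lemma rot_index_pow_orbit: "(rot_index ^^ j) m \<in> rot_orbit m"
  by (induction j) (auto simp: rot_orbit_def rot_index_4)

text \<open>The rotation has order four, so j steps are undone by 4 - j further steps.\<close>

lemma rot_orbit_pow: "n \<in> rot_orbit m \<Longrightarrow> \<exists>j. m = (rot_index ^^ j) n"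
proof -
  assume "n \<in> rot_orbit m"
  then consider "n = m" | "n = rot_index m" | "n = rot_index (rot_index m)"
    | "n = rot_index (rot_index (rot_index m))"
    unfolding rot_orbit_def by blast
  then show ?thesis
  proof cases
    case 1
    then show ?thesis by (intro exI[of _ 0]) simp
  next
    case 2
    then show ?thesis by (intro exI[of _ 3]) (simp add: eval_nat_numeral rot_index_4)
  next
    case 3
    then show ?thesis by (intro exI[of _ 2]) (simp add: eval_nat_numeral rot_index_4)
  next
    case 4
    then show ?thesis by (intro exI[of _ 1]) (simp add: rot_index_4)
  qed
qed

lemma rot_orbit_sym: "n \<in> rot_orbit m \<Longrightarrow> m \<in> rot_orbit n"
  using rot_orbit_pow rot_index_pow_orbit by metis

text \<open>All orbits have exactly four elements: a coincidence would require an integer with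
  \<open>a = - 1 - a\<close>, impossible by parity.\<close>

lemma sum_rot_orbit:
  "(\<Sum>n\<in>rot_orbit m. g n) = g m + g (rot_index m) + g (rot_index (rot_index m)) + g (rot_index (rot_index (rot_index m)))"
  for g :: "int \<times> int \<Rightarrow> 'a::comm_monoid_add"
proof -
  obtain a b where m: "m = (a, b)" by (cases m)
  have "a \<noteq> - 1 - a" by presburger
  then have "m \<notin> {rot_index m, rot_index (rot_index m), rot_index (rot_index (rot_index m))}"
    "rot_index m \<notin> {rot_index (rot_index m), rot_index (rot_index (rot_index m))}"
    "rot_index (rot_index m) \<notin> {rot_index (rot_index (rot_index m))}"
    unfolding m rot_index_def by auto
  then show ?thesis unfolding rot_orbit_def by (simp add: add.assoc)
qed

lemma representatives_unique:
  assumes "orbit_representatives S" "m \<in> S" "n \<in> S" "x \<in> rot_orbit m" "x \<in> rot_orbit n"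
  shows "m = n"
  using assms rot_orbit_pow[OF assms(4)] rot_orbit_pow[OF assms(5)] unfolding orbit_representatives_def by metis

lemma representatives_cover:
  assumes "orbit_representatives S"
  obtains m where "m \<in> S" "x \<in> rot_orbit m"
  using assms rot_index_pow_orbit rot_orbit_sym unfolding orbit_representatives_def by metis

text \<open>The sector relation bundles the series by orbits. A finite set of representatives sums
  over the full orbits \<open>A F\<close>, so the remainder is bounded uniformly by the coefficient
  tail beyond \<open>A F\<close>, and its mean square by the square of that tail.\<close>

lemma L2_has_sum_sector:
  assumes S: "orbit_representatives S" and d: "(\<lambda>m. cmod (d m)) summable_on UNIV"
    and sec: "sector \<sigma> d" and \<sigma>: "\<sigma>^4 = 1"
  shows "L2_has_sum (\<lambda>m x. d m * (ew m x + \<sigma>^3 * ew (rot_index m) x + \<sigma>^2 * ew (rot_index (rot_index m)) x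
     + \<sigma> * ew (rot_index (rot_index (rot_index m))) x)) (pser d) S"
proof -
  let ?g = "\<lambda>m x. d m * (ew m x + \<sigma>^3 * ew (rot_index m) x + \<sigma>^2 * ew (rot_index (rot_index m)) x
     + \<sigma> * ew (rot_index (rot_index (rot_index m))) x)"
  define A where "A F = (\<Union>m\<in>F. rot_orbit m)" for F
  define tail where "tail B = (\<Sum>\<^sub>\<infinity>m. cmod (d m)) - (\<Sum>m\<in>B. cmod (d m))" for B
  have r: "d (rot_index m) = \<sigma>^3 * d m" for m
  proof -
    have "\<sigma>^3 * d m = \<sigma>^3 * (\<sigma> * d (rot_index m))"
      using sec unfolding sector_def by metis
    also have "\<dots> = \<sigma>^4 * d (rot_index m)"
      by (simp add: power3_eq_cube power4_eq_xxxx)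
    finally show ?thesis using \<sigma> by simp
  qed
  have p: "\<sigma>^3 * \<sigma>^3 = \<sigma>^2" "\<sigma>^3 * \<sigma>^2 = \<sigma>"
  proof -
    have "\<sigma>^3 * \<sigma>^3 = \<sigma>^4 * \<sigma>^2" "\<sigma>^3 * \<sigma>^2 = \<sigma>^4 * \<sigma>"
      by (simp_all add: power2_eq_square power3_eq_cube power4_eq_xxxx mult.assoc)
    then show "\<sigma>^3 * \<sigma>^3 = \<sigma>^2" "\<sigma>^3 * \<sigma>^2 = \<sigma>" using \<sigma> by simp_all
  qed
  have r2: "d (rot_index (rot_index m)) = \<sigma>^2 * d m" for m
    unfolding r mult.assoc[symmetric] p ..
  have r3: "d (rot_index (rot_index (rot_index m))) = \<sigma> * d m" for m
    unfolding r r2 mult.assoc[symmetric] p ..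
  have g: "?g m x = (\<Sum>n\<in>rot_orbit m. d n * ew n x)" for m x
    unfolding sum_rot_orbit using r[of m] r2[of m] r3[of m] by (simp add: algebra_simps)
  have fin: "finite (rot_orbit m)" for m by (simp add: rot_orbit_def)
  have sumA: "(\<Sum>m\<in>F. ?g m x) = (\<Sum>n\<in>A F. d n * ew n x)" if "finite F" "F \<subseteq> S" for F x
    unfolding A_def g using that fin
    by (subst sum.UNION_disjoint) (use representatives_unique[OF S] in blast)+
  have "filterlim A (finite_subsets_at_top UNIV) (finite_subsets_at_top S)"
    unfolding filterlim_finite_subsets_at_top
  proof (intro allI impI)
    fix X :: "(int \<times> int) set" assume X: "finite X \<and> X \<subseteq> UNIV"
    have "\<forall>x. \<exists>m. m \<in> S \<and> x \<in> rot_orbit m"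
      using representatives_cover[OF S] by metis
    \<comment> \<open>\<open>q\<close> selects the representative of each index; once
      \<open>F\<close> contains the finitely many representatives of \<open>X\<close>, the orbits
      over \<open>F\<close> cover \<open>X\<close>.\<close>
    then obtain q where q: "\<And>x. q x \<in> S" "\<And>x. x \<in> rot_orbit (q x)" by metis
    have "eventually (\<lambda>F. finite F \<and> q ` X \<subseteq> F \<and> F \<subseteq> S) (finite_subsets_at_top S)"
      unfolding eventually_finite_subsets_at_top using X q(1) by (intro exI[of _ "q ` X"]) auto
    then show "eventually (\<lambda>F. finite (A F) \<and> X \<subseteq> A F \<and> A F \<subseteq> UNIV) (finite_subsets_at_top S)"
    proof eventually_elim
      case (elim F)
      then have "finite (A F)" using fin by (simp add: A_def)
      moreover have "X \<subseteq> A F" using elim q(2) unfolding A_def by blast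
      ultimately show ?case by simp
    qed
  qed
  from filterlim_compose[OF tail_tendsto[OF d] this]
  have tail0: "((\<lambda>F. tail (A F)) \<longlongrightarrow> 0) (finite_subsets_at_top S)"
    by (simp add: tail_def)
  have "((\<lambda>F. (tail (A F))\<^sup>2) \<longlongrightarrow> 0) (finite_subsets_at_top S)"
    using tendsto_power[OF tail0, of 2] by simp
  moreover have "eventually (\<lambda>F. norm (LINT x:unit_cell|lborel. (cmod (pser d x - (\<Sum>m\<in>F. ?g m x)))\<^sup>2) \<le> (tail (A F))\<^sup>2)
      (finite_subsets_at_top S)"
  proof (rule eventually_finite_subsets_at_top_weakI)
    fix F assume F: "finite F" "F \<subseteq> S"
    have fA: "finite (A F)" using F(1) fin by (simp add: A_def)
    have b: "cmod (pser d x - (\<Sum>n\<in>A F. d n * ew n x)) \<le> tail (A F)" for x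
      unfolding pser_def tail_def by (rule wave_tail_bound[OF d fA])
    have c: "continuous_on UNIV (\<lambda>x. (cmod (pser d x - (\<Sum>n\<in>A F. d n * ew n x)))\<^sup>2)"
      by (intro continuous_intros continuous_pser d)
    have "(\<integral>x. (cmod (pser d x - (\<Sum>n\<in>A F. d n * ew n x)))\<^sup>2 \<partial>cell) \<le> (\<integral>x. (tail (A F))\<^sup>2 \<partial>cell)"
      by (intro integral_mono integrable_cell_continuous c continuous_on_const power_mono b) auto
    moreover have "0 \<le> (\<integral>x. (cmod (pser d x - (\<Sum>n\<in>A F. d n * ew n x)))\<^sup>2 \<partial>cell)" by simp
    ultimately show "norm (LINT x:unit_cell|lborel. (cmod (pser d x - (\<Sum>m\<in>F. ?g m x)))\<^sup>2) \<le> (tail (A F))\<^sup>2"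
      unfolding sumA[OF F] LINT_cell by simp
  qed
  ultimately show ?thesis
    unfolding L2_has_sum_def by (rule Lim_null_comparison[rotated])
qed

lemma norm_M_pt: "(norm M_pt)\<^sup>2 = 2 * pi\<^sup>2"
  unfolding power2_norm_eq_inner inner_real2 by (simp add: power2_eq_square)

section \<open>Expansion and separation of the perturbed eigenvalues\<close>

context admissible_potential
begin

lemma Vh_of_real: "Vh k = complex_of_real (Re (Vh k))"
  using Vh_real[of k] by (simp add: complex_eq_iff)

lemma conv_c0_Sig:
  "conv (c0 \<i>) 0 = Vh (0,0) - Vh (1,1)"
  "conv (c0 1) 0 = Vh (0,0) + 2 * Vh (0,1) + Vh (1,1)"
  "conv (c0 (-1)) 0 = Vh (0,0) - 2 * Vh (0,1) + Vh (1,1)"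
  by (simp_all add: conv_c0 power3_eq_cube)

text \<open>The coefficient \<open>L\<close> is complex-valued but real by hypothesis, which lets
  the real estimate \<open>ev_expansion\<close> apply; its smallness condition holds eventually at
  0.\<close>

lemma ev_bigo:
  assumes \<sigma>: "\<sigma> \<in> Sig" and L: "conv (c0 \<sigma>) 0 = L" "cnj L = L"
  shows "(\<lambda>\<epsilon>. complex_of_real (ev \<epsilon> \<sigma>) - (complex_of_real ((norm M_pt)\<^sup>2) + complex_of_real \<epsilon> * L))
     \<in> O[at 0](\<lambda>\<epsilon>. complex_of_real (\<epsilon>\<^sup>2))"
proof (rule bigoI)
  have Lr: "L = complex_of_real (Re L)" using L(2) by (simp add: complex_eq_iff)
  have "((\<lambda>\<epsilon>. \<bar>\<epsilon>\<bar> * Vsum) \<longlongrightarrow> \<bar>0\<bar> * Vsum) (at 0)"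
    by (intro tendsto_intros)
  then have "eventually (\<lambda>\<epsilon>. \<bar>\<epsilon>\<bar> * Vsum < 1/4) (at 0)"
    by (rule order_tendstoD) simp
  then show "eventually (\<lambda>\<epsilon>. norm (complex_of_real (ev \<epsilon> \<sigma>) - (complex_of_real ((norm M_pt)\<^sup>2) + complex_of_real \<epsilon> * L))
     \<le> Vsum\<^sup>2 * norm (complex_of_real (\<epsilon>\<^sup>2))) (at 0)"
  proof eventually_elim
    case (elim \<epsilon>)
    have "complex_of_real (ev \<epsilon> \<sigma>) - (complex_of_real ((norm M_pt)\<^sup>2) + complex_of_real \<epsilon> * L)
      = complex_of_real (ev \<epsilon> \<sigma> - (2 * pi\<^sup>2 + \<epsilon> * Re L))"
      unfolding norm_M_pt by (subst Lr) simp
    then show ?case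
      using ev_expansion[of \<epsilon> \<sigma>] elim \<sigma> L(1) by (simp only: norm_of_real) simp
  qed
qed

text \<open>If the eigenvalues coincided, the first-order gap times
  \<open>\<bar>\<epsilon>\<bar>\<close> would be at most the two second-order errors
  together.\<close>

lemma ev_distinct:
  assumes "\<bar>\<epsilon>\<bar> * Vsum \<le> 1/4" "\<sigma> \<in> Sig" "\<tau> \<in> Sig" "\<epsilon> \<noteq> 0"
    "\<bar>\<epsilon>\<bar> * (2 * Vsum\<^sup>2) < \<bar>Re (conv (c0 \<sigma>) 0) - Re (conv (c0 \<tau>) 0)\<bar>"
  shows "ev \<epsilon> \<sigma> \<noteq> ev \<epsilon> \<tau>"
proof
  assume eq: "ev \<epsilon> \<sigma> = ev \<epsilon> \<tau>"
  let ?a = "Re (conv (c0 \<sigma>) 0)" and ?b = "Re (conv (c0 \<tau>) 0)"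
  have "\<bar>\<epsilon> * ?a - \<epsilon> * ?b\<bar> \<le> 2 * (Vsum\<^sup>2 * \<epsilon>\<^sup>2)"
    using ev_expansion[OF assms(1,2)] ev_expansion[OF assms(1,3)] eq by linarith
  then have "\<bar>\<epsilon>\<bar> * \<bar>?a - ?b\<bar> \<le> \<bar>\<epsilon>\<bar> * (\<bar>\<epsilon>\<bar> * (2 * Vsum\<^sup>2))"
    by (simp add: abs_mult power2_eq_square mult_ac flip: right_diff_distrib)
  then show False using assms(4,5) by simp
qed

lemma ev_separation:
  "\<exists>\<epsilon>1>0. \<forall>\<epsilon>. \<bar>\<epsilon>\<bar> < \<epsilon>1 \<longrightarrow> \<bar>\<epsilon>\<bar> * Vsum \<le> 1/4 \<and>
     (\<forall>\<sigma>\<in>Sig. \<forall>\<tau>\<in>Sig. \<epsilon> \<noteq> 0 \<longrightarrow> Re (conv (c0 \<sigma>) 0) \<noteq> Re (conv (c0 \<tau>) 0) \<longrightarrow> ev \<epsilon> \<sigma> \<noteq> ev \<epsilon> \<tau>)"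
proof -
  \<comment> \<open>The added 1 keeps \<open>K\<close> positive even when \<open>Vsum\<close>
    vanishes.\<close>
  define K where "K = 2 * Vsum\<^sup>2 + 1"
  define L where "L \<sigma> = Re (conv (c0 \<sigma>) 0)" for \<sigma>
  \<comment> \<open>All nonzero first-order gaps between sectors; there are finitely many, so their
    minimum serves every pair at once. The inserted 1 keeps the set nonempty.\<close>
  define D where "D = insert 1 ((\<lambda>(\<sigma>, \<tau>). \<bar>L \<sigma> - L \<tau>\<bar>) ` (Sig \<times> Sig) - {0})"
  define \<epsilon>1 where "\<epsilon>1 = min (1 / (4 * (Vsum + 1))) (Min D / K)"
  have K: "K > 0" unfolding K_def using zero_le_power2[of Vsum] by linarith
  have D: "finite D" "D \<noteq> {}" by (auto simp: D_def)
  have "\<And>x. x \<in> D \<Longrightarrow> x > 0" by (auto simp: D_def)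
  then have "Min D > 0" using Min_in[OF D] by blast
  then have pos: "\<epsilon>1 > 0" using K Vsum_nonneg by (simp add: \<epsilon>1_def)
  moreover have "\<bar>\<epsilon>\<bar> * Vsum \<le> 1/4" if "\<bar>\<epsilon>\<bar> < \<epsilon>1" for \<epsilon>
  proof -
    have "\<bar>\<epsilon>\<bar> \<le> 1 / (4 * (Vsum + 1))" using that by (simp add: \<epsilon>1_def)
    then have "\<bar>\<epsilon>\<bar> * Vsum \<le> 1 / (4 * (Vsum + 1)) * (Vsum + 1)"
      using Vsum_nonneg by (intro mult_mono) auto
    also have "\<dots> = 1/4"
    proof -
      have "1 / (4 * x) * x = 1/4" if "x \<noteq> 0" for x :: real using that by simp
      moreover have "Vsum + 1 \<noteq> 0" using Vsum_nonneg by linarith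
      ultimately show ?thesis by blast
    qed
    finally show ?thesis .
  qed
  moreover have "ev \<epsilon> \<sigma> \<noteq> ev \<epsilon> \<tau>" if "\<bar>\<epsilon>\<bar> < \<epsilon>1" "\<sigma> \<in> Sig" "\<tau> \<in> Sig" "\<epsilon> \<noteq> 0" "L \<sigma> \<noteq> L \<tau>" for \<epsilon> \<sigma> \<tau>
  proof (rule ev_distinct)
    have "\<bar>L \<sigma> - L \<tau>\<bar> \<in> D" using that by (auto simp: D_def)
    then have "Min D \<le> \<bar>L \<sigma> - L \<tau>\<bar>" using D by (intro Min_le)
    moreover have "\<bar>\<epsilon>\<bar> * K < Min D" using that(1) K by (simp add: \<epsilon>1_def pos_less_divide_eq)
    moreover have "\<bar>\<epsilon>\<bar> * (2 * Vsum\<^sup>2) \<le> \<bar>\<epsilon>\<bar> * K" unfolding K_def by (intro mult_left_mono) auto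
    ultimately show "\<bar>\<epsilon>\<bar> * (2 * Vsum\<^sup>2) < \<bar>Re (conv (c0 \<sigma>) 0) - Re (conv (c0 \<tau>) 0)\<bar>"
      unfolding L_def by linarith
  qed (use that calculation(2) in auto)
  ultimately show ?thesis unfolding L_def by blast
qed

lemma sol_square_summable:
  assumes small: "\<bar>\<epsilon>\<bar> * Vsum \<le> 1/4" and \<sigma>: "\<sigma> \<in> Sig"
  shows "(\<lambda>m. (cmod (sol \<epsilon> \<sigma> m))\<^sup>2) summable_on S"
proof (rule summable_on_comparison_test)
  show "(\<lambda>m. cmod (sol \<epsilon> \<sigma> m)) summable_on S"
    by (rule summable_on_subset_banach[OF sol_Sig_summable[OF small \<sigma>]]) simp
  show "(cmod (sol \<epsilon> \<sigma> m))\<^sup>2 \<le> cmod (sol \<epsilon> \<sigma> m)" for m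
    using sol_Sig_bound[OF small \<sigma>, of m] by (simp add: power2_eq_square mult_left_le)
qed simp

lemma Phi_has_sum:
  assumes small: "\<bar>\<epsilon>\<bar> * Vsum \<le> 1/4" and \<sigma>: "\<sigma> \<in> Sig" and S: "orbit_representatives S"
  shows "L2_has_sum (\<lambda>m x. sol \<epsilon> \<sigma> m * (ew m x + \<sigma>^3 * plane_wave (R_mat *v M_shift m) x
     + \<sigma>^2 * plane_wave (R_mat *v (R_mat *v M_shift m)) x
     + \<sigma> * plane_wave (R_mat *v (R_mat *v (R_mat *v M_shift m))) x)) (Phi \<epsilon> \<sigma>) S"
  unfolding R_mat_M_shift Phi_def
  by (rule L2_has_sum_sector[OF S sol_Sig_summable[OF small \<sigma>] sol_Sig_sector[OF small \<sigma>] Sig_unit(2)[OF \<sigma>]])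

end

text \<open>To first order the double level differs from the levels of the sectors 1 and -1 by 2
  \<epsilon> times V_{1,1} + V_{0,1} and V_{1,1} - V_{0,1}, up to sign; these are nonzero exactly by
  nondegeneracy. The two simple levels differ by 4 \<epsilon> V_{0,1}, which may vanish under the
  same assumption, whence the separate treatment of their coincidence.\<close>

theorem theorem5p3:
  fixes V :: "real^2 \<Rightarrow> real" and S :: "(int \<times> int) set"
  assumes V: "admissible V"
    and S: "orbit_representatives S"
    and nondeg_plus: "fourier_coeff V (1, 1) \<noteq> fourier_coeff V (0, 1)"
    and nondeg_minus: "fourier_coeff V (1, 1) \<noteq> - fourier_coeff V (0, 1)"
  shows "(norm M_pt)\<^sup>2 = 2 * pi\<^sup>2 \<and>
    has_L2_dim (eigenspace V 0 ((norm M_pt)\<^sup>2)) 4 \<and>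
    (\<exists>\<epsilon>1 > 0. \<exists>\<delta> > 0. \<exists>(\<mu>S :: real \<Rightarrow> real) (\<mu>p :: real \<Rightarrow> real) (\<mu>m :: real \<Rightarrow> real)
      (\<Phi>1 :: real \<Rightarrow> real^2 \<Rightarrow> complex) (\<Phi>2 :: real \<Rightarrow> real^2 \<Rightarrow> complex)
      (\<Phi>p :: real \<Rightarrow> real^2 \<Rightarrow> complex) (\<Phi>m :: real \<Rightarrow> real^2 \<Rightarrow> complex)
      (ci :: real \<Rightarrow> int \<times> int \<Rightarrow> complex) (cp :: real \<Rightarrow> int \<times> int \<Rightarrow> complex)
      (cm :: real \<Rightarrow> int \<times> int \<Rightarrow> complex).
      (\<lambda>\<epsilon>. complex_of_real (\<mu>S \<epsilon>) - (complex_of_real ((norm M_pt)\<^sup>2) + complex_of_real \<epsilon> *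
          (fourier_coeff V (0, 0) - fourier_coeff V (1, 1))))
        \<in> O[at 0](\<lambda>\<epsilon>. complex_of_real (\<epsilon>\<^sup>2)) \<and>
      (\<lambda>\<epsilon>. complex_of_real (\<mu>p \<epsilon>) - (complex_of_real ((norm M_pt)\<^sup>2) + complex_of_real \<epsilon> *
          (fourier_coeff V (0, 0) + 2 * fourier_coeff V (0, 1) + fourier_coeff V (1, 1))))
        \<in> O[at 0](\<lambda>\<epsilon>. complex_of_real (\<epsilon>\<^sup>2)) \<and>
      (\<lambda>\<epsilon>. complex_of_real (\<mu>m \<epsilon>) - (complex_of_real ((norm M_pt)\<^sup>2) + complex_of_real \<epsilon> *
          (fourier_coeff V (0, 0) - 2 * fourier_coeff V (0, 1) + fourier_coeff V (1, 1))))
        \<in> O[at 0](\<lambda>\<epsilon>. complex_of_real (\<epsilon>\<^sup>2)) \<and>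
      (\<forall>\<epsilon>. 0 < \<bar>\<epsilon>\<bar> \<and> \<bar>\<epsilon>\<bar> < \<epsilon>1 \<longrightarrow>
        {\<mu>. is_eigenvalue V \<epsilon> \<mu> \<and> \<bar>\<mu> - (norm M_pt)\<^sup>2\<bar> < \<delta>} = {\<mu>S \<epsilon>, \<mu>p \<epsilon>, \<mu>m \<epsilon>} \<and>
        \<mu>S \<epsilon> \<noteq> \<mu>p \<epsilon> \<and> \<mu>S \<epsilon> \<noteq> \<mu>m \<epsilon> \<and>
        (fourier_coeff V (0, 1) \<noteq> 0 \<longrightarrow> \<mu>p \<epsilon> \<noteq> \<mu>m \<epsilon>) \<and>
        \<comment> \<open>the double eigenvalue\<close>
        has_L2_dim (eigenspace V \<epsilon> (\<mu>S \<epsilon>)) 2 \<and>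
        L2_direct_sum (eigenspace V \<epsilon> (\<mu>S \<epsilon>)) (X V \<epsilon> (\<mu>S \<epsilon>) \<i>) (X V \<epsilon> (\<mu>S \<epsilon>) (- \<i>)) \<and>
        L2_basis [\<Phi>1 \<epsilon>] (X V \<epsilon> (\<mu>S \<epsilon>) \<i>) \<and>
        L2_basis [\<Phi>2 \<epsilon>] (X V \<epsilon> (\<mu>S \<epsilon>) (- \<i>)) \<and>
        (\<forall>x. \<Phi>2 \<epsilon> x = cnj (\<Phi>1 \<epsilon> (- x))) \<and>
        (\<lambda>m. (cmod (ci \<epsilon> m))\<^sup>2) summable_on S \<and>
        L2_has_sum (\<lambda>m x. ci \<epsilon> m *
            (plane_wave (M_shift m) x
             - \<i> * plane_wave (R_mat *v M_shift m) x
             - plane_wave (R_mat *v (R_mat *v M_shift m)) x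
             + \<i> * plane_wave (R_mat *v (R_mat *v (R_mat *v M_shift m))) x))
          (\<Phi>1 \<epsilon>) S \<and>
        L2_has_sum (\<lambda>m x. cnj (ci \<epsilon> m) *
            (plane_wave (M_shift m) x
             + \<i> * plane_wave (R_mat *v M_shift m) x
             - plane_wave (R_mat *v (R_mat *v M_shift m)) x
             - \<i> * plane_wave (R_mat *v (R_mat *v (R_mat *v M_shift m))) x))
          (\<Phi>2 \<epsilon>) S \<and>
        \<comment> \<open>the simple eigenvalues\<close>
        has_L2_dim (X V \<epsilon> (\<mu>p \<epsilon>) 1) 1 \<and> has_L2_dim (X V \<epsilon> (\<mu>m \<epsilon>) (- 1)) 1 \<and>
        (\<mu>p \<epsilon> \<noteq> \<mu>m \<epsilon> \<longrightarrow>
          has_L2_dim (eigenspace V \<epsilon> (\<mu>p \<epsilon>)) 1 \<and> eigenspace V \<epsilon> (\<mu>p \<epsilon>) \<subseteq> L2_M_sigma 1 \<and>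
          has_L2_dim (eigenspace V \<epsilon> (\<mu>m \<epsilon>)) 1 \<and> eigenspace V \<epsilon> (\<mu>m \<epsilon>) \<subseteq> L2_M_sigma (- 1)) \<and>
        (\<mu>p \<epsilon> = \<mu>m \<epsilon> \<longrightarrow>
          has_L2_dim (eigenspace V \<epsilon> (\<mu>p \<epsilon>)) 2 \<and>
          L2_direct_sum (eigenspace V \<epsilon> (\<mu>p \<epsilon>)) (X V \<epsilon> (\<mu>p \<epsilon>) 1) (X V \<epsilon> (\<mu>m \<epsilon>) (- 1))) \<and>
        L2_basis [\<Phi>p \<epsilon>] (X V \<epsilon> (\<mu>p \<epsilon>) 1) \<and>
        L2_basis [\<Phi>m \<epsilon>] (X V \<epsilon> (\<mu>m \<epsilon>) (- 1)) \<and>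
        (\<lambda>m. (cmod (cp \<epsilon> m))\<^sup>2) summable_on S \<and>
        (\<lambda>m. (cmod (cm \<epsilon> m))\<^sup>2) summable_on S \<and>
        L2_has_sum (\<lambda>m x. cp \<epsilon> m *
            (plane_wave (M_shift m) x
             + plane_wave (R_mat *v M_shift m) x
             + plane_wave (R_mat *v (R_mat *v M_shift m)) x
             + plane_wave (R_mat *v (R_mat *v (R_mat *v M_shift m))) x))
          (\<Phi>p \<epsilon>) S \<and>
        L2_has_sum (\<lambda>m x. cm \<epsilon> m *
            (plane_wave (M_shift m) x
             - plane_wave (R_mat *v M_shift m) x
             + plane_wave (R_mat *v (R_mat *v M_shift m)) x
             - plane_wave (R_mat *v (R_mat *v (R_mat *v M_shift m))) x))
          (\<Phi>m \<epsilon>) S))"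
proof -
  interpret admissible_potential V by unfold_locales (rule V)
  have SigI: "1 \<in> Sig" "-1 \<in> Sig" "\<i> \<in> Sig" "-\<i> \<in> Sig" by (simp_all add: Sig_def)
  have re: "Re (Vh (1,1)) \<noteq> Re (Vh (0,1))" "Re (Vh (1,1)) \<noteq> - Re (Vh (0,1))"
    using nondeg_plus nondeg_minus Vh_of_real[of "(1,1)"] Vh_of_real[of "(0,1)"]
    by (metis, metis of_real_minus)
  obtain \<epsilon>1 where \<epsilon>1: "\<epsilon>1 > 0" and small': "\<And>\<epsilon>. \<bar>\<epsilon>\<bar> < \<epsilon>1 \<Longrightarrow> \<bar>\<epsilon>\<bar> * Vsum \<le> 1/4"
    and sep: "\<And>\<epsilon> \<sigma> \<tau>. \<bar>\<epsilon>\<bar> < \<epsilon>1 \<Longrightarrow> \<sigma> \<in> Sig \<Longrightarrow> \<tau> \<in> Sig \<Longrightarrow> \<epsilon> \<noteq> 0 \<Longrightarrow>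
      Re (conv (c0 \<sigma>) 0) \<noteq> Re (conv (c0 \<tau>) 0) \<Longrightarrow> ev \<epsilon> \<sigma> \<noteq> ev \<epsilon> \<tau>"
    using ev_separation by blast
  \<comment> \<open>The case of zero perturbation is covered by the same analysis: all four sectors
    then have the eigenvalue 2 pi^2.\<close>
  have dim4: "has_L2_dim (eigenspace V 0 ((norm M_pt)\<^sup>2)) 4"
    unfolding has_L2_dim_def norm_M_pt
  proof (intro exI conjI)
    show "L2_basis (map (Phi 0) [1, -1, \<i>, -\<i>]) (eigenspace V 0 (2 * pi\<^sup>2))"
      by (rule eigenspace_basis) (auto simp: Sig_def ev_def mu_def Sig_distinct)
  qed simp
  have main: "{\<mu>. is_eigenvalue V \<epsilon> \<mu> \<and> \<bar>\<mu> - (norm M_pt)\<^sup>2\<bar> < 1} = {ev \<epsilon> \<i>, ev \<epsilon> 1, ev \<epsilon> (-1)}"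
    "ev \<epsilon> \<i> \<noteq> ev \<epsilon> 1" "ev \<epsilon> \<i> \<noteq> ev \<epsilon> (-1)" "Vh (0,1) \<noteq> 0 \<longrightarrow> ev \<epsilon> 1 \<noteq> ev \<epsilon> (-1)"
    "ev \<epsilon> (-\<i>) = ev \<epsilon> \<i>"
    if \<epsilon>: "0 < \<bar>\<epsilon>\<bar>" "\<bar>\<epsilon>\<bar> < \<epsilon>1" for \<epsilon>
  proof -
    note small = small'[OF \<epsilon>(2)]
    have \<epsilon>0: "\<epsilon> \<noteq> 0" using \<epsilon>(1) by simp
    show c: "ev \<epsilon> (-\<i>) = ev \<epsilon> \<i>" using ev_cnj[OF small SigI(3)] by simp
    show "ev \<epsilon> \<i> \<noteq> ev \<epsilon> 1" "ev \<epsilon> \<i> \<noteq> ev \<epsilon> (-1)"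
      by (rule sep[OF \<epsilon>(2) _ _ \<epsilon>0]; use re SigI in \<open>simp add: conv_c0_Sig\<close>)+
    show "Vh (0,1) \<noteq> 0 \<longrightarrow> ev \<epsilon> 1 \<noteq> ev \<epsilon> (-1)"
    proof
      assume "Vh (0,1) \<noteq> 0"
      then have "Re (Vh (0,1)) \<noteq> 0" using Vh_of_real[of "(0,1)"] by auto
      then show "ev \<epsilon> 1 \<noteq> ev \<epsilon> (-1)"
        by (intro sep[OF \<epsilon>(2) _ _ \<epsilon>0]) (use SigI in \<open>simp_all add: conv_c0_Sig\<close>)
    qed
    have im: "ev \<epsilon> ` Sig = {ev \<epsilon> \<i>, ev \<epsilon> 1, ev \<epsilon> (-1)}"
      unfolding Sig_def using c by auto
    show "{\<mu>. is_eigenvalue V \<epsilon> \<mu> \<and> \<bar>\<mu> - (norm M_pt)\<^sup>2\<bar> < 1} = {ev \<epsilon> \<i>, ev \<epsilon> 1, ev \<epsilon> (-1)}"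
      unfolding im[symmetric] norm_M_pt
    proof (intro set_eqI iffI)
      fix \<mu> assume "\<mu> \<in> ev \<epsilon> ` Sig"
      then have "\<bar>\<mu> - 2 * pi\<^sup>2\<bar> < 1" using ev_near[OF small] by fastforce
      with \<open>\<mu> \<in> ev \<epsilon> ` Sig\<close> show "\<mu> \<in> {\<mu>. is_eigenvalue V \<epsilon> \<mu> \<and> \<bar>\<mu> - 2 * pi\<^sup>2\<bar> < 1}"
        using is_eigenvalue_iff[OF small] by simp
    qed (use is_eigenvalue_iff[OF small] in auto)
  qed
  have one: "has_L2_dim E 1" if "L2_basis [\<Phi>] E" for E \<Phi>
    unfolding has_L2_dim_def using that by (intro exI[of _ "[\<Phi>]"]) simp
  have dim: "has_L2_dim (eigenspace V \<epsilon> \<mu>) (length \<sigma>s)"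
    if "\<bar>\<epsilon>\<bar> < \<epsilon>1" "distinct \<sigma>s" "set \<sigma>s = {\<sigma> \<in> Sig. ev \<epsilon> \<sigma> = \<mu>}" "\<sigma>s \<noteq> []" for \<epsilon> \<mu> \<sigma>s
  proof -
    have "hd \<sigma>s \<in> {\<sigma> \<in> Sig. ev \<epsilon> \<sigma> = \<mu>}" using that(3,4) hd_in_set by metis
    then have "\<bar>\<mu> - 2 * pi\<^sup>2\<bar> \<le> 1/4" using ev_near[OF small'[OF that(1)], of "hd \<sigma>s"] by simp
    then have "L2_basis (map (Phi \<epsilon>) \<sigma>s) (eigenspace V \<epsilon> \<mu>)"
      by (intro eigenspace_basis[OF small'[OF that(1)] that(2,3)]) linarith
    then show ?thesis unfolding has_L2_dim_def by (intro exI[of _ "map (Phi \<epsilon>) \<sigma>s"]) simp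
  qed
  show ?thesis
  \<comment> \<open>The window radius 1 is the range in which \<open>is_eigenvalue_iff\<close>
    accounts for every eigenvalue; the coefficient families are the sector solutions
    themselves.\<close>
  proof (rule conjI[OF norm_M_pt], rule conjI[OF dim4], rule exI[of _ \<epsilon>1], rule conjI[OF \<epsilon>1],
      rule exI[of _ "1::real"], rule conjI[OF zero_less_one],
      rule exI[of _ "\<lambda>\<epsilon>. ev \<epsilon> \<i>"], rule exI[of _ "\<lambda>\<epsilon>. ev \<epsilon> 1"], rule exI[of _ "\<lambda>\<epsilon>. ev \<epsilon> (-1)"],
      rule exI[of _ "\<lambda>\<epsilon>. Phi \<epsilon> \<i>"], rule exI[of _ "\<lambda>\<epsilon>. Phi \<epsilon> (-\<i>)"],
      rule exI[of _ "\<lambda>\<epsilon>. Phi \<epsilon> 1"], rule exI[of _ "\<lambda>\<epsilon>. Phi \<epsilon> (-1)"],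
      rule exI[of _ "\<lambda>\<epsilon>. sol \<epsilon> \<i>"], rule exI[of _ "\<lambda>\<epsilon>. sol \<epsilon> 1"], rule exI[of _ "\<lambda>\<epsilon>. sol \<epsilon> (-1)"],
      intro conjI ev_bigo SigI conv_c0_Sig allI impI)
    fix \<epsilon> :: real assume "0 < \<bar>\<epsilon>\<bar> \<and> \<bar>\<epsilon>\<bar> < \<epsilon>1"
    then have \<epsilon>: "0 < \<bar>\<epsilon>\<bar>" "\<bar>\<epsilon>\<bar> < \<epsilon>1" by auto
    note small = small'[OF \<epsilon>(2)] and m = main[OF \<epsilon>]
    have setS: "{\<sigma> \<in> Sig. ev \<epsilon> \<sigma> = ev \<epsilon> \<i>} = {\<i>, -\<i>}"
      unfolding Sig_def using m by auto
    show "{\<mu>. is_eigenvalue V \<epsilon> \<mu> \<and> \<bar>\<mu> - (norm M_pt)\<^sup>2\<bar> < 1} = {ev \<epsilon> \<i>, ev \<epsilon> 1, ev \<epsilon> (-1)}"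
      "ev \<epsilon> \<i> \<noteq> ev \<epsilon> 1" "ev \<epsilon> \<i> \<noteq> ev \<epsilon> (-1)" by (rule m)+
    show "ev \<epsilon> 1 \<noteq> ev \<epsilon> (-1)" if "Vh (0,1) \<noteq> 0" using m(4) that by blast
    show "has_L2_dim (eigenspace V \<epsilon> (ev \<epsilon> \<i>)) 2"
      using dim[OF \<epsilon>(2), of "[\<i>, -\<i>]" "ev \<epsilon> \<i>"] setS Sig_distinct by (simp add: numeral_2_eq_2)
    show "L2_direct_sum (eigenspace V \<epsilon> (ev \<epsilon> \<i>)) (X V \<epsilon> (ev \<epsilon> \<i>) \<i>) (X V \<epsilon> (ev \<epsilon> \<i>) (-\<i>))"
      by (rule eigenspace_direct_sum[OF small setS Sig_distinct(1)])
    show "L2_basis [Phi \<epsilon> \<i>] (X V \<epsilon> (ev \<epsilon> \<i>) \<i>)" "L2_basis [Phi \<epsilon> (-\<i>)] (X V \<epsilon> (ev \<epsilon> \<i>) (-\<i>))"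
      and P: "L2_basis [Phi \<epsilon> 1] (X V \<epsilon> (ev \<epsilon> 1) 1)" and M: "L2_basis [Phi \<epsilon> (-1)] (X V \<epsilon> (ev \<epsilon> (-1)) (-1))"
      by (intro X_basis[OF small] SigI refl m(5)[symmetric])+
    show "has_L2_dim (X V \<epsilon> (ev \<epsilon> 1) 1) 1" "has_L2_dim (X V \<epsilon> (ev \<epsilon> (-1)) (-1)) 1"
      by (rule one[OF P], rule one[OF M])
    show "Phi \<epsilon> (-\<i>) x = cnj (Phi \<epsilon> \<i> (- x))" for x
      using Phi_cnj[OF small SigI(3)] by simp
    show "(\<lambda>m. (cmod (sol \<epsilon> \<i> m))\<^sup>2) summable_on S" "(\<lambda>m. (cmod (sol \<epsilon> 1 m))\<^sup>2) summable_on S"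
      "(\<lambda>m. (cmod (sol \<epsilon> (-1) m))\<^sup>2) summable_on S"
      by (intro sol_square_summable[OF small] SigI)+
    show "L2_has_sum (\<lambda>m x. sol \<epsilon> \<i> m *
            (plane_wave (M_shift m) x
             - \<i> * plane_wave (R_mat *v M_shift m) x
             - plane_wave (R_mat *v (R_mat *v M_shift m)) x
             + \<i> * plane_wave (R_mat *v (R_mat *v (R_mat *v M_shift m))) x))
          (Phi \<epsilon> \<i>) S"
      using Phi_has_sum[OF small SigI(3) S] by (simp add: power3_eq_cube)
    have "sol \<epsilon> (-\<i>) = (\<lambda>m. cnj (sol \<epsilon> \<i> m))"
      using sol_cnj(1)[OF small Sig_unit[OF SigI(3)]] by simp
    then show "L2_has_sum (\<lambda>m x. cnj (sol \<epsilon> \<i> m) *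
            (plane_wave (M_shift m) x
             + \<i> * plane_wave (R_mat *v M_shift m) x
             - plane_wave (R_mat *v (R_mat *v M_shift m)) x
             - \<i> * plane_wave (R_mat *v (R_mat *v (R_mat *v M_shift m))) x))
          (Phi \<epsilon> (-\<i>)) S"
      using Phi_has_sum[OF small SigI(4) S] by (simp add: power3_eq_cube)
    show "L2_has_sum (\<lambda>m x. sol \<epsilon> 1 m *
            (plane_wave (M_shift m) x
             + plane_wave (R_mat *v M_shift m) x
             + plane_wave (R_mat *v (R_mat *v M_shift m)) x
             + plane_wave (R_mat *v (R_mat *v (R_mat *v M_shift m))) x))
          (Phi \<epsilon> 1) S"
      using Phi_has_sum[OF small SigI(1) S] by simp
    show "L2_has_sum (\<lambda>m x. sol \<epsilon> (-1) m *
            (plane_wave (M_shift m) x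
             - plane_wave (R_mat *v M_shift m) x
             + plane_wave (R_mat *v (R_mat *v M_shift m)) x
             - plane_wave (R_mat *v (R_mat *v (R_mat *v M_shift m))) x))
          (Phi \<epsilon> (-1)) S"
      using Phi_has_sum[OF small SigI(2) S] by (simp add: power3_eq_cube)
    {
      assume ne: "ev \<epsilon> 1 \<noteq> ev \<epsilon> (-1)"
      have setP: "{\<sigma> \<in> Sig. ev \<epsilon> \<sigma> = ev \<epsilon> 1} = {1}" and setM: "{\<sigma> \<in> Sig. ev \<epsilon> \<sigma> = ev \<epsilon> (-1)} = {-1}"
        unfolding Sig_def using m ne by auto
      show "has_L2_dim (eigenspace V \<epsilon> (ev \<epsilon> 1)) 1" "has_L2_dim (eigenspace V \<epsilon> (ev \<epsilon> (-1))) 1"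
        using dim[OF \<epsilon>(2), of "[1]" "ev \<epsilon> 1"] dim[OF \<epsilon>(2), of "[-1]" "ev \<epsilon> (-1)"] setP setM by simp_all
      show "eigenspace V \<epsilon> (ev \<epsilon> 1) \<subseteq> L2_M_sigma 1" "eigenspace V \<epsilon> (ev \<epsilon> (-1)) \<subseteq> L2_M_sigma (-1)"
        by (rule eigenspace_sigma[OF small setP], rule eigenspace_sigma[OF small setM])
    }
    {
      assume eq: "ev \<epsilon> 1 = ev \<epsilon> (-1)"
      have setP: "{\<sigma> \<in> Sig. ev \<epsilon> \<sigma> = ev \<epsilon> 1} = {1, -1}"
        unfolding Sig_def using m eq by auto
      show "has_L2_dim (eigenspace V \<epsilon> (ev \<epsilon> 1)) 2"
        using dim[OF \<epsilon>(2), of "[1, -1]" "ev \<epsilon> 1"] setP Sig_distinct by (simp add: numeral_2_eq_2)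
      show "L2_direct_sum (eigenspace V \<epsilon> (ev \<epsilon> 1)) (X V \<epsilon> (ev \<epsilon> 1) 1) (X V \<epsilon> (ev \<epsilon> (-1)) (-1))"
        unfolding eq[symmetric] by (rule eigenspace_direct_sum[OF small setP Sig_distinct(11)])
    }
  qed (simp_all add: Vh_real)
qed

end
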